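(* Let $\mathcal C$ be a small additive idempotent complete strict ribbon category enriched over $\mathcal{V}ect_k$, with $k$ a field, whose tensor unit $\mathbf 1$ is simple and absolutely simple. Then the relation $\backsim$ (defined in the context) on simple Jandl algebras in $\mathcal C$ is an equivalence relation.
   Context: Absolutely simple means $\mathrm{End}(\mathbf 1)=k\,\mathrm{id}_{\mathbf 1}$; $\mathcal{V}ect_k$ is the category of finite-dimensional $k$-vector spaces. $\mathcal C$ has braiding $c_{U,V}$, twist $\theta_U$, left duality $d_U:U^\vee\otimes U\to\mathbf 1$, $b_U:\mathbf 1\to U\otimes U^\vee$, and right duality $\tilde d_U:U\otimes U^\vee\to\mathbf 1$, $\tilde b_U:\mathbf 1\to U^\vee\otimes U$; left and right dualities agree as functors (${}^\vee U=U^\vee$, ${}^\vee f=f^\vee$), and $(U\otimes V)^\vee$ is identified with $V^\vee\otimes U^\vee$. Set $\delta_U:=(\mathrm{id}_{U^{\vee\vee}}\otimes d_U)\circ[(c_{U^\vee,U^{\vee\vee}}\circ b_{U^\vee})\otimes\theta_U]\in\mathrm{Hom}(U,U^{\vee\vee})$. Symmetric special Frobenius algebras: $A=(A,m,\eta,\Delta,\varepsilon)$ with $(A,m,\eta)$ a unital associative algebra and $(A,\Delta,\varepsilon)$ a counital coassociative coalgebra such that $(\mathrm{id}_A\otimes m)\circ(\Delta\otimes\mathrm{id}_A)=\Delta\circ m=(m\otimes\mathrm{id}_A)\circ(\mathrm{id}_A\otimes\Delta)$; special: $\varepsilon\circ\eta$ and $m\circ\Delta$ are nonzero multiples of identities,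 normalized by convention so that $\varepsilon\circ\eta=\dim(A)\,\mathrm{id}_{\mathbf 1}$, $m\circ\Delta=\mathrm{id}_A$; symmetric: $((\varepsilon\circ m)\otimes\mathrm{id}_{A^\vee})\circ(\mathrm{id}_A\otimes b_A)=(\mathrm{id}_{A^\vee}\otimes(\varepsilon\circ m))\circ(\tilde b_A\otimes\mathrm{id}_A)$. $A$ is simple iff it is simple as a bimodule over itself. A Jandl algebra $(A,\sigma)$ is a symmetric special Frobenius algebra $A$ with a reversion, i.e. a morphism $\sigma\in\mathrm{Hom}(A,A)$ with $\sigma\circ\eta=\eta$, $\sigma\circ m=m\circ c_{A,A}\circ(\sigma\otimes\sigma)$, $\sigma\circ\sigma=\theta_A$. Two Jandl algebras $(A,\sigma)$, $(B,\tau)$ are isomorphic iff there is an isomorphism $\varphi:A\to B$ of symmetric special Frobenius algebras with $\varphi\circ\sigma=\tau\circ\varphi$. Let $(A,\sigma)$ be a simple Jandl algebra and $M=(\dot M,\rho)$ a left $A$-module. $M^\vee$ is the right $A$-module $(\dot M^\vee,(\mathrm{id}_{\dot M^\vee}\otimes d_A)\circ(\rho^\vee\otimes\mathrm{id}_A))$, and $M^\sigma$ is the left $A$-module $(\dot M^\vee,(\tilde d_A\otimes\mathrm{id}_{\dot M^\vee})\circ(\sigma\otimes{}^\vee(\rho\circ c_{\dot M,A})))$. The object $M^\vee\otimes_A M$ is the retract of $\dot M^\vee\otimes\dot M$, with embedding $e$ and restriction $r$ ($r\circ e=\mathrm{id}$), for which $e\circ r$ is the idempotent $(\rho_{M^\vee}\otimes\rho)\circ(\mathrm{id}_{\dot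 M^\vee}\otimes(\Delta\circ\eta)\otimes\mathrm{id}_{\dot M})$, with $\rho_{M^\vee}$ the right action on $M^\vee$. It is an algebra with product $r\circ(\mathrm{id}_{\dot M^\vee}\otimes\tilde d_{\dot M}\otimes\mathrm{id}_{\dot M})\circ(e\otimes e)$ and unit $r\circ\tilde b_{\dot M}$. It is required that $B:=M^\vee\otimes_A M$ lies in the Morita class $[A]$ with $M$ as interpolating bimodule (i.e. $M\otimes_B M^\vee\cong A$ as $A$-bimodules, where $B$ acts on $M$ and $M^\vee$ through $e$ and $\tilde d_{\dot M}$) and is a symmetric special Frobenius algebra (the normalized Frobenius structure is then determined by the algebra structure). Suppose there is an isomorphism $g\in\mathrm{Hom}_A(M,M^\sigma)$ of left $A$-modules with $g=\nu\,g^\vee\circ\delta_{\dot M}$ for some $\nu\in k$. Then $$\sigma_g:=r\circ(g\otimes g^{-1})\circ(\theta_{\dot M}\otimes\mathrm{id}_{\dot M^\vee})\circ c_{\dot M^\vee,\dot M}\circ e$$ is a reversion on $M^\vee\otimes_A M$. Definition of $\backsim$: $(A,\sigma)\backsim(B,\tau)$ iff $(B,\tau)$ is isomorphic, as a Jandl algebra, to $(M^\vee\otimes_A M,\sigma_g)$ for some $M$ and $g$ as just described. *)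

theory Defs
  imports Main
begin

text \<open>
  Hom-sets are subsets of a common type of arrows, so the vector space axioms are relative to a carrier.
\<close>

definition subspace_in ::
  "'m set \<Rightarrow> 'm \<Rightarrow> ('m \<Rightarrow> 'm \<Rightarrow> 'm) \<Rightarrow> ('k \<Rightarrow> 'm \<Rightarrow> 'm) \<Rightarrow> 'm set \<Rightarrow> bool" where
  "subspace_in V z add smul S \<longleftrightarrow>
     S \<subseteq> V \<and> z \<in> S \<and> (\<forall>f\<in>S. \<forall>g\<in>S. add f g \<in> S) \<and> (\<forall>a. \<forall>f\<in>S. smul a f \<in> S)"

definition fin_dim_vector_space ::
  "'m set \<Rightarrow> 'm \<Rightarrow> ('m \<Rightarrow> 'm \<Rightarrow> 'm) \<Rightarrow> ('k::field \<Rightarrow> 'm \<Rightarrow> 'm) \<Rightarrow> bool" where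
  "fin_dim_vector_space V z add smul \<longleftrightarrow>
     z \<in> V \<and> (\<forall>f\<in>V. \<forall>g\<in>V. add f g \<in> V) \<and> (\<forall>a. \<forall>f\<in>V. smul a f \<in> V) \<and>
     (\<forall>f\<in>V. \<forall>g\<in>V. \<forall>h\<in>V. add (add f g) h = add f (add g h)) \<and>
     (\<forall>f\<in>V. \<forall>g\<in>V. add f g = add g f) \<and>
     (\<forall>f\<in>V. add z f = f) \<and>
     (\<forall>f\<in>V. \<exists>g\<in>V. add f g = z) \<and>
     (\<forall>a. \<forall>f\<in>V. \<forall>g\<in>V. smul a (add f g) = add (smul a f) (smul a g)) \<and>
     (\<forall>a b. \<forall>f\<in>V. smul (a + b) f = add (smul a f) (smul b f)) \<and>
     (\<forall>a b. \<forall>f\<in>V. smul (a * b) f = smul a (smul b f)) \<and>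
     (\<forall>f\<in>V. smul 1 f = f) \<and>
     (\<exists>F. finite F \<and> F \<subseteq> V \<and> (\<forall>S. subspace_in V z add smul S \<and> F \<subseteq> S \<longrightarrow> S = V))"

text \<open>
  For \<open>f\<close> from \<open>U\<close> to \<open>V\<close> and \<open>g\<close> from \<open>V\<close> to \<open>W\<close>, the composite \<open>g \<cdot> f\<close> goes from \<open>U\<close> to \<open>W\<close>.
  The tensor product binds more tightly than composition.
\<close>

record ('o, 'm, 'k) ribbon_structure =
  Ob :: "'o set"
  Arr :: "'m set"
  dom :: "'m \<Rightarrow> 'o"
  cod :: "'m \<Rightarrow> 'o"
  ident :: "'o \<Rightarrow> 'm"
  comp :: "'m \<Rightarrow> 'm \<Rightarrow> 'm"  (infixl "\<cdot>\<index>" 65)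
  zero_arr :: "'o \<Rightarrow> 'o \<Rightarrow> 'm"
  add_arr :: "'m \<Rightarrow> 'm \<Rightarrow> 'm"
  scale_arr :: "'k \<Rightarrow> 'm \<Rightarrow> 'm"
  unit_ob :: "'o"  ("\<one>\<index>")
  tensor_ob :: "'o \<Rightarrow> 'o \<Rightarrow> 'o"  (infixl "\<odot>\<index>" 70)
  tensor_arr :: "'m \<Rightarrow> 'm \<Rightarrow> 'm"  (infixl "\<otimes>\<index>" 70)
  braiding :: "'o \<Rightarrow> 'o \<Rightarrow> 'm"
  twist :: "'o \<Rightarrow> 'm"
  dual :: "'o \<Rightarrow> 'o"
  left_ev :: "'o \<Rightarrow> 'm"
  left_coev :: "'o \<Rightarrow> 'm"

record ('o, 'm) frobenius =
  alg_ob :: "'o"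
  mult :: "'m"
  unit :: "'m"
  comult :: "'m"
  counit :: "'m"

record ('o, 'm) jandl = "('o, 'm) frobenius" +
  reversion :: "'m"

locale ribbon_data =
  fixes C :: "('o, 'm, 'k::field) ribbon_structure" (structure)
begin

abbreviation Id :: "'o \<Rightarrow> 'm" where "Id \<equiv> ident C"
abbreviation br :: "'o \<Rightarrow> 'o \<Rightarrow> 'm" where "br \<equiv> braiding C"
abbreviation tw :: "'o \<Rightarrow> 'm" where "tw \<equiv> twist C"
abbreviation du :: "'o \<Rightarrow> 'o" where "du \<equiv> dual C"
abbreviation ev :: "'o \<Rightarrow> 'm" where "ev \<equiv> left_ev C"
abbreviation cv :: "'o \<Rightarrow> 'm" where "cv \<equiv> left_coev C"

definition Hom :: "'o \<Rightarrow> 'o \<Rightarrow> 'm set" where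
  "Hom U V = {f \<in> Arr C. dom C f = U \<and> cod C f = V}"

definition inverse_arrows :: "'m \<Rightarrow> 'm \<Rightarrow> bool" where
  "inverse_arrows f h \<longleftrightarrow> f \<in> Arr C \<and> h \<in> Hom (cod C f) (dom C f) \<and>
     h \<cdot> f = Id (dom C f) \<and> f \<cdot> h = Id (cod C f)"

definition iso :: "'m \<Rightarrow> bool" where
  "iso f \<longleftrightarrow> (\<exists>h. inverse_arrows f h)"

definition inv_arr :: "'m \<Rightarrow> 'm" where
  "inv_arr f = (THE h. inverse_arrows f h)"

definition monic :: "'m \<Rightarrow> bool" where
  "monic f \<longleftrightarrow> f \<in> Arr C \<and>
     (\<forall>W\<in>Ob C. \<forall>u\<in>Hom W (dom C f). \<forall>v\<in>Hom W (dom C f). f \<cdot> u = f \<cdot> v \<longrightarrow> u = v)"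

definition zero_object :: "'o \<Rightarrow> bool" where
  "zero_object Z \<longleftrightarrow> Z \<in> Ob C \<and>
     (\<forall>U\<in>Ob C. (\<exists>!f. f \<in> Hom U Z) \<and> (\<exists>!f. f \<in> Hom Z U))"

definition biproduct :: "'o \<Rightarrow> 'o \<Rightarrow> 'o \<Rightarrow> 'm \<Rightarrow> 'm \<Rightarrow> 'm \<Rightarrow> 'm \<Rightarrow> bool" where
  "biproduct U V W i j p q \<longleftrightarrow> W \<in> Ob C \<and>
     i \<in> Hom U W \<and> j \<in> Hom V W \<and> p \<in> Hom W U \<and> q \<in> Hom W V \<and>
     p \<cdot> i = Id U \<and> q \<cdot> j = Id V \<and> p \<cdot> j = zero_arr C V U \<and> q \<cdot> i = zero_arr C U V \<and>
     add_arr C (i \<cdot> p) (j \<cdot> q) = Id W"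

definition additive :: bool where
  "additive \<longleftrightarrow> (\<exists>Z. zero_object Z) \<and>
     (\<forall>U\<in>Ob C. \<forall>V\<in>Ob C. \<exists>W i j p q. biproduct U V W i j p q)"

text \<open>\<open>X\<close> is the retract of \<open>U\<close> that splits the idempotent \<open>p\<close>, embedded by \<open>e\<close> and restricted to by \<open>r\<close>.\<close>

definition splits :: "'o \<Rightarrow> 'm \<Rightarrow> 'o \<Rightarrow> 'm \<Rightarrow> 'm \<Rightarrow> bool" where
  "splits U p X e r \<longleftrightarrow> X \<in> Ob C \<and> e \<in> Hom X U \<and> r \<in> Hom U X \<and> r \<cdot> e = Id X \<and> e \<cdot> r = p"

definition idempotent_complete :: bool where
  "idempotent_complete \<longleftrightarrow>
     (\<forall>U\<in>Ob C. \<forall>p\<in>Hom U U. p \<cdot> p = p \<longrightarrow> (\<exists>X e r. splits U p X e r))"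

definition simple_object :: "'o \<Rightarrow> bool" where
  "simple_object U \<longleftrightarrow> U \<in> Ob C \<and> \<not> zero_object U \<and>
     (\<forall>V\<in>Ob C. \<forall>f\<in>Hom V U. monic f \<longrightarrow> f = zero_arr C V U \<or> iso f)"

definition absolutely_simple :: "'o \<Rightarrow> bool" where
  "absolutely_simple U \<longleftrightarrow> U \<in> Ob C \<and> Hom U U = {scale_arr C a (Id U) | a. True}"

definition left_dual_arr :: "'m \<Rightarrow> 'm" where
  "left_dual_arr f = (let U = dom C f; V = cod C f in
     (ev V \<otimes> Id (du U)) \<cdot> (Id (du V) \<otimes> f \<otimes> Id (du U)) \<cdot> (Id (du V) \<otimes> cv U))"

text \<open>The right duality of a ribbon category is built from the left duality, the braiding and the twist.\<close>

definition right_ev :: "'o \<Rightarrow> 'm" where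
  "right_ev U = ev U \<cdot> br U (du U) \<cdot> (tw U \<otimes> Id (du U))"

definition right_coev :: "'o \<Rightarrow> 'm" where
  "right_coev U = (Id (du U) \<otimes> tw U) \<cdot> br U (du U) \<cdot> cv U"

definition right_dual_arr :: "'m \<Rightarrow> 'm" where
  "right_dual_arr f = (let U = dom C f; V = cod C f in
     (Id (du U) \<otimes> right_ev V) \<cdot> (Id (du U) \<otimes> f \<otimes> Id (du V)) \<cdot> (right_coev U \<otimes> Id (du V)))"

text \<open>
  The canonical isomorphism from \<open>du (U \<odot> V)\<close> to \<open>du V \<odot> du U\<close>. It makes the customary identification
  of these two objects explicit, so that they need not be equal.
\<close>

definition dual_tensor :: "'o \<Rightarrow> 'o \<Rightarrow> 'm" where
  "dual_tensor U V =
     (ev (U \<odot> V) \<otimes> Id (du V \<odot> du U)) \<cdot>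
     (Id (du (U \<odot> V)) \<otimes> ((Id U \<otimes> cv V \<otimes> Id (du U)) \<cdot> cv U))"

definition \<delta> :: "'o \<Rightarrow> 'm" where
  "\<delta> U = (Id (du (du U)) \<otimes> ev U) \<cdot> ((br (du U) (du (du U)) \<cdot> cv (du U)) \<otimes> tw U)"

definition qdim :: "'o \<Rightarrow> 'k" where
  "qdim U = (THE a. scale_arr C a (Id \<one>) = right_ev U \<cdot> cv U)"

end

locale strict_linear_ribbon_category = ribbon_data C
  for C :: "('o, 'm, 'k::field) ribbon_structure" (structure) +
  assumes dom_cod: "f \<in> Arr C \<Longrightarrow> dom C f \<in> Ob C \<and> cod C f \<in> Ob C"
    and ident_Hom: "U \<in> Ob C \<Longrightarrow> Id U \<in> Hom U U"
    and comp_Hom: "f \<in> Hom U V \<Longrightarrow> g \<in> Hom V W \<Longrightarrow> g \<cdot> f \<in> Hom U W"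
    and comp_assoc: "f \<in> Hom U V \<Longrightarrow> g \<in> Hom V W \<Longrightarrow> h \<in> Hom W X \<Longrightarrow>
          (h \<cdot> g) \<cdot> f = h \<cdot> (g \<cdot> f)"
    and ident_left: "f \<in> Hom U V \<Longrightarrow> Id V \<cdot> f = f"
    and ident_right: "f \<in> Hom U V \<Longrightarrow> f \<cdot> Id U = f"
    and Hom_vector_space: "U \<in> Ob C \<Longrightarrow> V \<in> Ob C \<Longrightarrow>
          fin_dim_vector_space (Hom U V) (zero_arr C U V) (add_arr C) (scale_arr C)"
    and comp_add_left: "f \<in> Hom U V \<Longrightarrow> g \<in> Hom V W \<Longrightarrow> g' \<in> Hom V W \<Longrightarrow>
          add_arr C g g' \<cdot> f = add_arr C (g \<cdot> f) (g' \<cdot> f)"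
    and comp_add_right: "f \<in> Hom U V \<Longrightarrow> f' \<in> Hom U V \<Longrightarrow> g \<in> Hom V W \<Longrightarrow>
          g \<cdot> add_arr C f f' = add_arr C (g \<cdot> f) (g \<cdot> f')"
    and comp_scale_left: "f \<in> Hom U V \<Longrightarrow> g \<in> Hom V W \<Longrightarrow>
          scale_arr C a g \<cdot> f = scale_arr C a (g \<cdot> f)"
    and comp_scale_right: "f \<in> Hom U V \<Longrightarrow> g \<in> Hom V W \<Longrightarrow>
          g \<cdot> scale_arr C a f = scale_arr C a (g \<cdot> f)"
    and unit_Ob: "\<one> \<in> Ob C"
    and tensor_Ob: "U \<in> Ob C \<Longrightarrow> V \<in> Ob C \<Longrightarrow> U \<odot> V \<in> Ob C"
    and tensor_Ob_assoc: "U \<in> Ob C \<Longrightarrow> V \<in> Ob C \<Longrightarrow> W \<in> Ob C \<Longrightarrow>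
          (U \<odot> V) \<odot> W = U \<odot> (V \<odot> W)"
    and tensor_Ob_unit: "U \<in> Ob C \<Longrightarrow> \<one> \<odot> U = U \<and> U \<odot> \<one> = U"
    and tensor_Hom: "f \<in> Hom U V \<Longrightarrow> g \<in> Hom U' V' \<Longrightarrow> f \<otimes> g \<in> Hom (U \<odot> U') (V \<odot> V')"
    and tensor_assoc: "f \<in> Arr C \<Longrightarrow> g \<in> Arr C \<Longrightarrow> h \<in> Arr C \<Longrightarrow>
          (f \<otimes> g) \<otimes> h = f \<otimes> (g \<otimes> h)"
    and tensor_unit: "f \<in> Arr C \<Longrightarrow> Id \<one> \<otimes> f = f \<and> f \<otimes> Id \<one> = f"
    and tensor_ident: "U \<in> Ob C \<Longrightarrow> V \<in> Ob C \<Longrightarrow> Id U \<otimes> Id V = Id (U \<odot> V)"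
    and tensor_comp: "f \<in> Hom U V \<Longrightarrow> g \<in> Hom V W \<Longrightarrow> f' \<in> Hom U' V' \<Longrightarrow> g' \<in> Hom V' W' \<Longrightarrow>
          (g \<cdot> f) \<otimes> (g' \<cdot> f') = (g \<otimes> g') \<cdot> (f \<otimes> f')"
    and tensor_add_left: "f \<in> Hom U V \<Longrightarrow> f' \<in> Hom U V \<Longrightarrow> g \<in> Arr C \<Longrightarrow>
          add_arr C f f' \<otimes> g = add_arr C (f \<otimes> g) (f' \<otimes> g)"
    and tensor_add_right: "f \<in> Hom U V \<Longrightarrow> f' \<in> Hom U V \<Longrightarrow> g \<in> Arr C \<Longrightarrow>
          g \<otimes> add_arr C f f' = add_arr C (g \<otimes> f) (g \<otimes> f')"
    and tensor_scale_left: "f \<in> Arr C \<Longrightarrow> g \<in> Arr C \<Longrightarrow>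
          scale_arr C a f \<otimes> g = scale_arr C a (f \<otimes> g)"
    and tensor_scale_right: "f \<in> Arr C \<Longrightarrow> g \<in> Arr C \<Longrightarrow>
          f \<otimes> scale_arr C a g = scale_arr C a (f \<otimes> g)"
    and braiding_Hom: "U \<in> Ob C \<Longrightarrow> V \<in> Ob C \<Longrightarrow> br U V \<in> Hom (U \<odot> V) (V \<odot> U)"
    and braiding_iso: "U \<in> Ob C \<Longrightarrow> V \<in> Ob C \<Longrightarrow> iso (br U V)"
    and braiding_natural: "f \<in> Hom U V \<Longrightarrow> g \<in> Hom U' V' \<Longrightarrow>
          br V V' \<cdot> (f \<otimes> g) = (g \<otimes> f) \<cdot> br U U'"
    and braiding_tensor_left: "U \<in> Ob C \<Longrightarrow> V \<in> Ob C \<Longrightarrow> W \<in> Ob C \<Longrightarrow>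
          br (U \<odot> V) W = (br U W \<otimes> Id V) \<cdot> (Id U \<otimes> br V W)"
    and braiding_tensor_right: "U \<in> Ob C \<Longrightarrow> V \<in> Ob C \<Longrightarrow> W \<in> Ob C \<Longrightarrow>
          br U (V \<odot> W) = (Id V \<otimes> br U W) \<cdot> (br U V \<otimes> Id W)"
    and twist_Hom: "U \<in> Ob C \<Longrightarrow> tw U \<in> Hom U U"
    and twist_iso: "U \<in> Ob C \<Longrightarrow> iso (tw U)"
    and twist_natural: "f \<in> Hom U V \<Longrightarrow> tw V \<cdot> f = f \<cdot> tw U"
    and twist_tensor: "U \<in> Ob C \<Longrightarrow> V \<in> Ob C \<Longrightarrow>
          tw (U \<odot> V) = br V U \<cdot> br U V \<cdot> (tw U \<otimes> tw V)"
    and dual_Ob: "U \<in> Ob C \<Longrightarrow> du U \<in> Ob C"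
    and left_ev_Hom: "U \<in> Ob C \<Longrightarrow> ev U \<in> Hom (du U \<odot> U) \<one>"
    and left_coev_Hom: "U \<in> Ob C \<Longrightarrow> cv U \<in> Hom \<one> (U \<odot> du U)"
    and left_duality: "U \<in> Ob C \<Longrightarrow> (Id U \<otimes> ev U) \<cdot> (cv U \<otimes> Id U) = Id U"
    and left_duality_dual: "U \<in> Ob C \<Longrightarrow> (ev U \<otimes> Id (du U)) \<cdot> (Id (du U) \<otimes> cv U) = Id (du U)"
    and twist_dual: "U \<in> Ob C \<Longrightarrow> tw (du U) = left_dual_arr (tw U)"

context ribbon_data
begin

definition sym_special_frobenius :: "('o, 'm, 'z) frobenius_scheme \<Rightarrow> bool" where
  "sym_special_frobenius A \<longleftrightarrow>
    (let X = alg_ob A; m = mult A; \<eta> = unit A; \<Delta> = comult A; \<epsilon> = counit A in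
      X \<in> Ob C \<and>
      m \<in> Hom (X \<odot> X) X \<and> \<eta> \<in> Hom \<one> X \<and> \<Delta> \<in> Hom X (X \<odot> X) \<and> \<epsilon> \<in> Hom X \<one> \<and>
      m \<cdot> (m \<otimes> Id X) = m \<cdot> (Id X \<otimes> m) \<and>
      m \<cdot> (\<eta> \<otimes> Id X) = Id X \<and> m \<cdot> (Id X \<otimes> \<eta>) = Id X \<and>
      (\<Delta> \<otimes> Id X) \<cdot> \<Delta> = (Id X \<otimes> \<Delta>) \<cdot> \<Delta> \<and>
      (\<epsilon> \<otimes> Id X) \<cdot> \<Delta> = Id X \<and> (Id X \<otimes> \<epsilon>) \<cdot> \<Delta> = Id X \<and>
      (Id X \<otimes> m) \<cdot> (\<Delta> \<otimes> Id X) = \<Delta> \<cdot> m \<and>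
      \<Delta> \<cdot> m = (m \<otimes> Id X) \<cdot> (Id X \<otimes> \<Delta>) \<and>
      qdim X \<noteq> 0 \<and> \<epsilon> \<cdot> \<eta> = scale_arr C (qdim X) (Id \<one>) \<and> m \<cdot> \<Delta> = Id X \<and>
      ((\<epsilon> \<cdot> m) \<otimes> Id (du X)) \<cdot> (Id X \<otimes> cv X) =
        (Id (du X) \<otimes> (\<epsilon> \<cdot> m)) \<cdot> (right_coev X \<otimes> Id X))"

definition left_module :: "('o, 'm, 'z) frobenius_scheme \<Rightarrow> 'o \<Rightarrow> 'm \<Rightarrow> bool" where
  "left_module A M \<rho> \<longleftrightarrow> M \<in> Ob C \<and> \<rho> \<in> Hom (alg_ob A \<odot> M) M \<and>
     \<rho> \<cdot> (mult A \<otimes> Id M) = \<rho> \<cdot> (Id (alg_ob A) \<otimes> \<rho>) \<and> \<rho> \<cdot> (unit A \<otimes> Id M) = Id M"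

definition right_module :: "('o, 'm, 'z) frobenius_scheme \<Rightarrow> 'o \<Rightarrow> 'm \<Rightarrow> bool" where
  "right_module A M \<rho> \<longleftrightarrow> M \<in> Ob C \<and> \<rho> \<in> Hom (M \<odot> alg_ob A) M \<and>
     \<rho> \<cdot> (Id M \<otimes> mult A) = \<rho> \<cdot> (\<rho> \<otimes> Id (alg_ob A)) \<and> \<rho> \<cdot> (Id M \<otimes> unit A) = Id M"

definition left_module_hom ::
  "('o, 'm, 'z) frobenius_scheme \<Rightarrow> 'o \<Rightarrow> 'm \<Rightarrow> 'o \<Rightarrow> 'm \<Rightarrow> 'm \<Rightarrow> bool" where
  "left_module_hom A M \<rho> N \<rho>' f \<longleftrightarrow> f \<in> Hom M N \<and> f \<cdot> \<rho> = \<rho>' \<cdot> (Id (alg_ob A) \<otimes> f)"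

definition bimodule :: "('o, 'm, 'z) frobenius_scheme \<Rightarrow> 'o \<Rightarrow> 'm \<Rightarrow> 'm \<Rightarrow> bool" where
  "bimodule A X l r \<longleftrightarrow> left_module A X l \<and> right_module A X r \<and>
     l \<cdot> (Id (alg_ob A) \<otimes> r) = r \<cdot> (l \<otimes> Id (alg_ob A))"

definition bimodule_hom ::
  "('o, 'm, 'z) frobenius_scheme \<Rightarrow> 'o \<Rightarrow> 'm \<Rightarrow> 'm \<Rightarrow> 'o \<Rightarrow> 'm \<Rightarrow> 'm \<Rightarrow> 'm \<Rightarrow> bool" where
  "bimodule_hom A X l r Y l' r' f \<longleftrightarrow> f \<in> Hom X Y \<and>
     f \<cdot> l = l' \<cdot> (Id (alg_ob A) \<otimes> f) \<and> f \<cdot> r = r' \<cdot> (f \<otimes> Id (alg_ob A))"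

definition bimodule_monic ::
  "('o, 'm, 'z) frobenius_scheme \<Rightarrow> 'o \<Rightarrow> 'm \<Rightarrow> 'm \<Rightarrow> 'm \<Rightarrow> bool" where
  "bimodule_monic A X l r f \<longleftrightarrow>
     (\<forall>W l' r' u v. bimodule A W l' r' \<and> bimodule_hom A W l' r' X l r u \<and>
        bimodule_hom A W l' r' X l r v \<and> f \<cdot> u = f \<cdot> v \<longrightarrow> u = v)"

definition simple_bimodule :: "('o, 'm, 'z) frobenius_scheme \<Rightarrow> 'o \<Rightarrow> 'm \<Rightarrow> 'm \<Rightarrow> bool" where
  "simple_bimodule A X l r \<longleftrightarrow> bimodule A X l r \<and> \<not> zero_object X \<and>
     (\<forall>Y l' r' f. bimodule A Y l' r' \<and> bimodule_hom A Y l' r' X l r f \<and>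
        bimodule_monic A Y l' r' f \<longrightarrow> f = zero_arr C Y X \<or> iso f)"

definition simple_algebra :: "('o, 'm, 'z) frobenius_scheme \<Rightarrow> bool" where
  "simple_algebra A \<longleftrightarrow> simple_bimodule A (alg_ob A) (mult A) (mult A)"

definition jandl_algebra :: "('o, 'm) jandl \<Rightarrow> bool" where
  "jandl_algebra A \<longleftrightarrow> sym_special_frobenius A \<and>
     (let X = alg_ob A; \<sigma> = reversion A in
       \<sigma> \<in> Hom X X \<and> \<sigma> \<cdot> unit A = unit A \<and>
       \<sigma> \<cdot> mult A = mult A \<cdot> br X X \<cdot> (\<sigma> \<otimes> \<sigma>) \<and> \<sigma> \<cdot> \<sigma> = tw X)"

definition simple_jandl_algebra :: "('o, 'm) jandl \<Rightarrow> bool" where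
  "simple_jandl_algebra A \<longleftrightarrow> jandl_algebra A \<and> simple_algebra A"

definition frobenius_iso ::
  "('o, 'm, 'z) frobenius_scheme \<Rightarrow> ('o, 'm, 'z) frobenius_scheme \<Rightarrow> 'm \<Rightarrow> bool" where
  "frobenius_iso A B \<phi> \<longleftrightarrow> \<phi> \<in> Hom (alg_ob A) (alg_ob B) \<and> iso \<phi> \<and>
     \<phi> \<cdot> mult A = mult B \<cdot> (\<phi> \<otimes> \<phi>) \<and> \<phi> \<cdot> unit A = unit B \<and>
     (\<phi> \<otimes> \<phi>) \<cdot> comult A = comult B \<cdot> \<phi> \<and> counit B \<cdot> \<phi> = counit A"

definition jandl_isomorphic :: "('o, 'm) jandl \<Rightarrow> ('o, 'm) jandl \<Rightarrow> bool" where
  "jandl_isomorphic A B \<longleftrightarrow> jandl_algebra A \<and> jandl_algebra B \<and>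
     (\<exists>\<phi>. frobenius_iso A B \<phi> \<and> \<phi> \<cdot> reversion A = reversion B \<cdot> \<phi>)"

text \<open>
  The right action on the dual of a left module \<open>M\<close>, and the left action on \<open>du M\<close> that defines the
  conjugate module of \<open>M\<close> with respect to the reversion.
\<close>

definition dual_action :: "('o, 'm, 'z) frobenius_scheme \<Rightarrow> 'o \<Rightarrow> 'm \<Rightarrow> 'm" where
  "dual_action A M \<rho> =
     (Id (du M) \<otimes> ev (alg_ob A)) \<cdot>
     ((dual_tensor (alg_ob A) M \<cdot> left_dual_arr \<rho>) \<otimes> Id (alg_ob A))"

definition conj_action :: "('o, 'm) jandl \<Rightarrow> 'o \<Rightarrow> 'm \<Rightarrow> 'm" where
  "conj_action A M \<rho> =
     (right_ev (alg_ob A) \<otimes> Id (du M)) \<cdot>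
     (reversion A \<otimes> (dual_tensor M (alg_ob A) \<cdot> right_dual_arr (\<rho> \<cdot> br M (alg_ob A))))"

text \<open>
  The idempotent on \<open>N \<odot> M\<close> whose retract is the tensor product over \<open>A\<close> of a right module \<open>(N, \<rho>\<^sub>N)\<close>
  and a left module \<open>(M, \<rho>\<^sub>M)\<close>.
\<close>

definition tensor_over ::
  "('o, 'm, 'z) frobenius_scheme \<Rightarrow> 'o \<Rightarrow> 'm \<Rightarrow> 'o \<Rightarrow> 'm \<Rightarrow> 'm" where
  "tensor_over A N \<rho>\<^sub>N M \<rho>\<^sub>M = (\<rho>\<^sub>N \<otimes> \<rho>\<^sub>M) \<cdot> (Id N \<otimes> (comult A \<cdot> unit A) \<otimes> Id M)"

text \<open>
  \<open>B\<close> has the algebra structure induced from the embedding \<open>e\<close> and the restriction \<open>r\<close> of \<open>alg_ob B\<close>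
  as the retract of \<open>du M \<odot> M\<close> that represents the tensor product over \<open>A\<close>.
\<close>

definition internal_end ::
  "('o, 'm, 'z) frobenius_scheme \<Rightarrow> 'o \<Rightarrow> 'm \<Rightarrow> ('o, 'm, 'y) frobenius_scheme \<Rightarrow> 'm \<Rightarrow> 'm \<Rightarrow> bool" where
  "internal_end A M \<rho> B e r \<longleftrightarrow>
     splits (du M \<odot> M) (tensor_over A (du M) (dual_action A M \<rho>) M \<rho>) (alg_ob B) e r \<and>
     mult B = r \<cdot> (Id (du M) \<otimes> right_ev M \<otimes> Id M) \<cdot> (e \<otimes> e) \<and>
     unit B = r \<cdot> right_coev M"

text \<open>
  The tensor product over \<open>B\<close> of \<open>M\<close> and its dual is isomorphic to \<open>A\<close> as an \<open>A\<close>-bimodule, where \<open>B\<close>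
  acts on \<open>M\<close> and on \<open>du M\<close> through \<open>e\<close>.
\<close>

definition interpolating ::
  "('o, 'm, 'z) frobenius_scheme \<Rightarrow> 'o \<Rightarrow> 'm \<Rightarrow> ('o, 'm, 'y) frobenius_scheme \<Rightarrow> 'm \<Rightarrow> bool" where
  "interpolating A M \<rho> B e \<longleftrightarrow>
     (\<exists>Y e' r' \<psi>.
        splits (M \<odot> du M)
          (tensor_over B M ((right_ev M \<otimes> Id M) \<cdot> (Id M \<otimes> e))
             (du M) ((Id (du M) \<otimes> right_ev M) \<cdot> (e \<otimes> Id (du M)))) Y e' r' \<and>
        bimodule_hom A
          Y (r' \<cdot> (\<rho> \<otimes> Id (du M)) \<cdot> (Id (alg_ob A) \<otimes> e'))
            (r' \<cdot> (Id M \<otimes> dual_action A M \<rho>) \<cdot> (e' \<otimes> Id (alg_ob A)))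
          (alg_ob A) (mult A) (mult A) \<psi> \<and>
        iso \<psi>)"

definition induced_reversion :: "'o \<Rightarrow> 'm \<Rightarrow> 'm \<Rightarrow> 'm \<Rightarrow> 'm" where
  "induced_reversion M g e r =
     r \<cdot> (g \<otimes> inv_arr g) \<cdot> (tw M \<otimes> Id (du M)) \<cdot> br (du M) M \<cdot> e"

text \<open>
  That \<open>induced_reversion M g e r\<close> is a reversion is part of \<open>jandl_isomorphic B E\<close>; since it maps
  \<open>unit E\<close> to \<open>\<nu>\<close> times \<open>unit E\<close>, this constrains \<open>\<nu>\<close>.
\<close>

definition jandl_related :: "('o, 'm) jandl \<Rightarrow> ('o, 'm) jandl \<Rightarrow> bool" where
  "jandl_related A B \<longleftrightarrow>
     (\<exists>M \<rho> E e r g \<nu>.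
        left_module A M \<rho> \<and>
        internal_end A M \<rho> E e r \<and>
        sym_special_frobenius E \<and>
        interpolating A M \<rho> E e \<and>
        left_module_hom A M \<rho> (du M) (conj_action A M \<rho>) g \<and> iso g \<and>
        g = scale_arr C \<nu> (left_dual_arr g \<cdot> \<delta> M) \<and>
        reversion E = induced_reversion M g e r \<and>
        jandl_isomorphic B E)"

definition simple_jandl_algebras :: "('o, 'm) jandl set" where
  "simple_jandl_algebras = {A. simple_jandl_algebra A}"

definition jandl_relation :: "(('o, 'm) jandl \<times> ('o, 'm) jandl) set" where
  "jandl_relation = {(A, B) \<in> simple_jandl_algebras \<times> simple_jandl_algebras. jandl_related A B}"

end

end

theory Submission
  imports Defs
begin

text \<open>
  Two Jandl algebras are called linked if they are the two diagonal corners of a Morita context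
  \<open>(P i j)\<close>, \<open>i, j :: bool\<close>, that carries an anti-involution \<open>P i j \<rightarrow> P j i\<close> squaring to the twist and
  extending both reversions, and whose pairings hit the units. This notion is visibly reflexive and
  symmetric. It is transitive because the objects \<open>P i 2 \<otimes> P' 2 j\<close>, tensored over the common corner, form
  such a context again.

  Being linked is the same as the relation of the theorem. A module \<open>M\<close> with its dual is one
  half of such a context: the pairing \<open>M \<otimes> M\<^sup>\<or> \<rightarrow> A\<close> is the evaluation transposed along the Frobenius form,
  and the isomorphism \<open>g\<close> supplies the anti-involution, where \<open>\<epsilon> \<sigma> = \<epsilon>\<close> by uniqueness of the normalized
  counit. Conversely, composing the pairing with the counit identifies \<open>P 1 0\<close> with the dual of \<open>P 0 1\<close>.

  Most identities are checked on generalized elements: the laws of the structure are used in the form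
  \<open>f \<cdot> (x \<otimes> y) = \<dots>\<close> for arbitrary arrows \<open>x\<close> and \<open>y\<close>, so that no identity morphisms have to be moved around.
\<close>

text \<open>Linkings mention no dual objects. In \<open>jandl_related\<close> itself, symmetry and
  transitivity would require identifying the dual of a module over \<open>E\<close>, or of a tensor
  product of modules, together with all twists. With linkings, uniqueness of duals enters only when
  a linking is turned back into a module. A preimage of the unit under a pairing is a dual basis. It
  makes the form obtained from the counit exact, and it inverts the map from a tensor product to a
  corner. Two obstacles remain on the way from a module to a linking. The bimodule isomorphism in
  \<open>interpolating\<close> is arbitrary, so it does not say that the canonical pairing
  \<open>h\<close> hits the unit; comparing the two pairings shows that they differ by a factor
  whose action on the module has a right inverse.\<close>

context strict_linear_ribbon_category
begin

section \<open>Types of arrows and the interchange law\<close>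

definition hom_type :: "'o \<Rightarrow> 'o \<Rightarrow> ('o \<times> 'o) option"  (infix "\<rightarrowtail>" 55) where
  "U \<rightarrowtail> V = Some (U, V)"

text \<open>Membership in a hom-set becomes an equation, so simplification computes the type of a
  compound arrow and settles side conditions with unknown ends by reflexivity.
  \<open>hom_type\<close> stays folded so that such an equation is not split into equations between
  objects.\<close>

definition ty :: "'m \<Rightarrow> ('o \<times> 'o) option" where
  "ty f = (if f \<in> Arr C then Some (dom C f, cod C f) else None)"

lemma ty_iff: "ty f = U \<rightarrowtail> V \<longleftrightarrow> f \<in> Arr C \<and> dom C f = U \<and> cod C f = V"
  by (auto simp: ty_def hom_type_def)

lemma Hom_iff [simp]: "f \<in> Hom U V \<longleftrightarrow> ty f = U \<rightarrowtail> V"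
  by (simp add: Hom_def ty_iff)

lemma ty_simps [simp]:
  "ty f = U \<rightarrowtail> V \<Longrightarrow> f \<in> Arr C"
  "ty f = U \<rightarrowtail> V \<Longrightarrow> dom C f = U"
  "ty f = U \<rightarrowtail> V \<Longrightarrow> cod C f = V"
  by (simp_all add: ty_iff)

lemma ty_inject: "U \<rightarrowtail> V = U' \<rightarrowtail> V' \<longleftrightarrow> U = U' \<and> V = V'"
  by (simp add: hom_type_def)

lemma Ob_rules [simp]:
  "\<one> \<in> Ob C"
  "U \<in> Ob C \<Longrightarrow> V \<in> Ob C \<Longrightarrow> U \<odot> V \<in> Ob C"
  "U \<in> Ob C \<Longrightarrow> du U \<in> Ob C"
  using unit_Ob tensor_Ob dual_Ob by auto

lemma ty_Ob: "ty f = U \<rightarrowtail> V \<Longrightarrow> U \<in> Ob C" "ty f = U \<rightarrowtail> V \<Longrightarrow> V \<in> Ob C"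
  using dom_cod[of f] unfolding ty_iff by auto

lemma Ob_assoc [simp]:
  "U \<in> Ob C \<Longrightarrow> V \<in> Ob C \<Longrightarrow> W \<in> Ob C \<Longrightarrow> (U \<odot> V) \<odot> W = U \<odot> (V \<odot> W)"
  "U \<in> Ob C \<Longrightarrow> \<one> \<odot> U = U"
  "U \<in> Ob C \<Longrightarrow> U \<odot> \<one> = U"
  using tensor_Ob_assoc tensor_Ob_unit by auto

lemma comp_ty [simp]: "ty f = U \<rightarrowtail> V \<Longrightarrow> ty g = V \<rightarrowtail> W \<Longrightarrow> ty (g \<cdot> f) = U \<rightarrowtail> W"
  using comp_Hom[of f U V g W] by simp

lemma tensor_ty [simp]: "ty f = U \<rightarrowtail> V \<Longrightarrow> ty g = U' \<rightarrowtail> V' \<Longrightarrow> ty (f \<otimes> g) = (U \<odot> U') \<rightarrowtail> (V \<odot> V')"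
  using tensor_Hom[of f U V g U' V'] by simp

lemma ob_arrow_ty [simp]:
  assumes "U \<in> Ob C"
  shows "ty (Id U) = U \<rightarrowtail> U" "ty (tw U) = U \<rightarrowtail> U"
    "ty (ev U) = (du U \<odot> U) \<rightarrowtail> \<one>" "ty (cv U) = \<one> \<rightarrowtail> (U \<odot> du U)"
  using ident_Hom twist_Hom left_ev_Hom left_coev_Hom assms by simp_all

lemma br_ty [simp]: "U \<in> Ob C \<Longrightarrow> V \<in> Ob C \<Longrightarrow> ty (br U V) = (U \<odot> V) \<rightarrowtail> (V \<odot> U)"
  using braiding_Hom by simp

lemma comp_reassoc [simp]:
  "ty f = U \<rightarrowtail> V \<Longrightarrow> ty g = V \<rightarrowtail> W \<Longrightarrow> ty h = W \<rightarrowtail> X \<Longrightarrow> (h \<cdot> g) \<cdot> f = h \<cdot> (g \<cdot> f)"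
  using comp_assoc[of f U V g W h X] by simp

lemma ident_rules [simp]:
  "ty f = U \<rightarrowtail> V \<Longrightarrow> Id V \<cdot> f = f"
  "ty f = U \<rightarrowtail> V \<Longrightarrow> f \<cdot> Id U = f"
  using ident_left ident_right by simp_all

lemma tensor_rules [simp]:
  "ty f = U \<rightarrowtail> U' \<Longrightarrow> ty g = V \<rightarrowtail> V' \<Longrightarrow> ty h = W \<rightarrowtail> W' \<Longrightarrow> (f \<otimes> g) \<otimes> h = f \<otimes> (g \<otimes> h)"
  "ty f = U \<rightarrowtail> U' \<Longrightarrow> Id \<one> \<otimes> f = f"
  "ty f = U \<rightarrowtail> U' \<Longrightarrow> f \<otimes> Id \<one> = f"
  "U \<in> Ob C \<Longrightarrow> V \<in> Ob C \<Longrightarrow> Id U \<otimes> Id V = Id (U \<odot> V)"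
  using tensor_assoc[of f g h] tensor_unit[of f] tensor_ident by auto

lemma ident_tensor_split:
  "U \<in> Ob C \<Longrightarrow> V \<in> Ob C \<Longrightarrow> ty f = W \<rightarrowtail> W' \<Longrightarrow> Id (U \<odot> V) \<otimes> f = Id U \<otimes> (Id V \<otimes> f)"
  using tensor_rules(1)[of "Id U" U U "Id V" V V f W W'] by simp

lemma interchange [simp]:
  assumes "ty x = U \<rightarrowtail> V" "ty f = V \<rightarrowtail> W" "ty y = U' \<rightarrowtail> V'" "ty g = V' \<rightarrowtail> W'"
  shows "(f \<otimes> g) \<cdot> (x \<otimes> y) = (f \<cdot> x) \<otimes> (g \<cdot> y)"
  using tensor_comp[of x U V f W y U' V' g W'] assms by simp

text \<open>Tensor products are kept nested to the right, so the two factors of a composite may be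
  cut at different places. This lemma and its variants give the interchange law for each such
  mismatch of bracketings.\<close>

lemma interchange2 [simp]:
  assumes "ty x = U1 \<rightarrowtail> V1" "ty y = U2 \<rightarrowtail> V2" "ty f = V \<rightarrowtail> W" "V = V1 \<odot> V2"
    "ty z = U' \<rightarrowtail> V'" "ty g = V' \<rightarrowtail> W'"
  shows "(f \<otimes> g) \<cdot> (x \<otimes> (y \<otimes> z)) = (f \<cdot> (x \<otimes> y)) \<otimes> (g \<cdot> z)"
  using interchange[of "x \<otimes> y" "U1 \<odot> U2" V f W z U' V' g W'] tensor_rules(1)[of x _ _ y _ _ z] assms by simp

lemma interchange3 [simp]:
  assumes "ty x = U1 \<rightarrowtail> V1" "ty y = U2 \<rightarrowtail> V2" "ty w = U3 \<rightarrowtail> V3" "ty f = V \<rightarrowtail> W"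
    "V = V1 \<odot> (V2 \<odot> V3)" "ty z = U' \<rightarrowtail> V'" "ty g = V' \<rightarrowtail> W'"
  shows "(f \<otimes> g) \<cdot> (x \<otimes> (y \<otimes> (w \<otimes> z))) = (f \<cdot> (x \<otimes> (y \<otimes> w))) \<otimes> (g \<cdot> z)"
proof -
  have "x \<otimes> (y \<otimes> (w \<otimes> z)) = (x \<otimes> (y \<otimes> w)) \<otimes> z" using assms by simp
  then show ?thesis using assms interchange[of "x \<otimes> (y \<otimes> w)" "U1 \<odot> (U2 \<odot> U3)" V f W z U' V' g W'] by simp
qed

lemma interchange_split [simp]:
  assumes "ty f = U1 \<rightarrowtail> V1" "ty g = U2 \<rightarrowtail> V2" "ty x = U \<rightarrowtail> V" "V = U1 \<odot> U2"
    "ty y = U' \<rightarrowtail> V'" "ty h = V' \<rightarrowtail> W'"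
  shows "(f \<otimes> (g \<otimes> h)) \<cdot> (x \<otimes> y) = ((f \<otimes> g) \<cdot> x) \<otimes> (h \<cdot> y)"
proof -
  have "f \<otimes> (g \<otimes> h) = (f \<otimes> g) \<otimes> h" using assms by simp
  then show ?thesis using assms interchange[of x U V "f \<otimes> g" "V1 \<odot> V2" y U' V' h W'] by simp
qed

lemma interchange_split3 [simp]:
  assumes "ty f = U1 \<rightarrowtail> V1" "ty g = U2 \<rightarrowtail> V2" "ty k = U3 \<rightarrowtail> V3" "ty x = U \<rightarrowtail> V" "V = U1 \<odot> (U2 \<odot> U3)"
    "ty y = U' \<rightarrowtail> V'" "ty h = V' \<rightarrowtail> W'"
  shows "(f \<otimes> (g \<otimes> (k \<otimes> h))) \<cdot> (x \<otimes> y) = ((f \<otimes> (g \<otimes> k)) \<cdot> x) \<otimes> (h \<cdot> y)"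
proof -
  have "f \<otimes> (g \<otimes> (k \<otimes> h)) = (f \<otimes> (g \<otimes> k)) \<otimes> h" using assms by simp
  then show ?thesis using assms interchange[of x U V "f \<otimes> (g \<otimes> k)" "V1 \<odot> (V2 \<odot> V3)" y U' V' h W'] by simp
qed

lemma interchange22 [simp]:
  assumes "ty f = U1 \<rightarrowtail> V1" "ty g = U2 \<rightarrowtail> V2" "ty x = U3 \<rightarrowtail> V3" "ty y = U4 \<rightarrowtail> V4"
    "V3 \<odot> V4 = U1 \<odot> U2" "ty z = U' \<rightarrowtail> V'" "ty h = V' \<rightarrowtail> W'"
  shows "(f \<otimes> (g \<otimes> h)) \<cdot> (x \<otimes> (y \<otimes> z)) = ((f \<otimes> g) \<cdot> (x \<otimes> y)) \<otimes> (h \<cdot> z)"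
proof -
  have "f \<otimes> (g \<otimes> h) = (f \<otimes> g) \<otimes> h" "x \<otimes> (y \<otimes> z) = (x \<otimes> y) \<otimes> z" using assms by simp_all
  then show ?thesis
    using assms interchange[of "x \<otimes> y" "U3 \<odot> U4" "U1 \<odot> U2" "f \<otimes> g" "V1 \<odot> V2" z U' V' h W'] by simp
qed

lemma interchange_tail [simp]:
  assumes "ty x = U \<rightarrowtail> V" "ty f = V \<rightarrowtail> W" "ty y = U' \<rightarrowtail> V'" "ty g = V' \<rightarrowtail> W'" "ty z = X \<rightarrowtail> (U \<odot> U')"
  shows "(f \<otimes> g) \<cdot> ((x \<otimes> y) \<cdot> z) = ((f \<cdot> x) \<otimes> (g \<cdot> y)) \<cdot> z"
proof -
  have "(f \<otimes> g) \<cdot> ((x \<otimes> y) \<cdot> z) = ((f \<otimes> g) \<cdot> (x \<otimes> y)) \<cdot> z"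
    using assms by (simp del: interchange)
  then show ?thesis using assms by simp
qed

lemma interchange2_tail [simp]:
  assumes "ty x = U1 \<rightarrowtail> V1" "ty y = U2 \<rightarrowtail> V2" "ty f = V \<rightarrowtail> W" "V = V1 \<odot> V2"
    "ty z = U' \<rightarrowtail> V'" "ty g = V' \<rightarrowtail> W'" "ty w = X \<rightarrowtail> (U1 \<odot> U2 \<odot> U')"
  shows "(f \<otimes> g) \<cdot> ((x \<otimes> (y \<otimes> z)) \<cdot> w) = ((f \<cdot> (x \<otimes> y)) \<otimes> (g \<cdot> z)) \<cdot> w"
proof -
  have "U1 \<in> Ob C" "U2 \<in> Ob C" "U' \<in> Ob C" using assms ty_Ob by auto
  then have "(f \<otimes> g) \<cdot> ((x \<otimes> (y \<otimes> z)) \<cdot> w) = ((f \<otimes> g) \<cdot> (x \<otimes> (y \<otimes> z))) \<cdot> w"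
    using assms ty_Ob(2)[OF assms(1)] ty_Ob(2)[OF assms(2)] ty_Ob(2)[OF assms(5)] by (simp del: interchange interchange2)
  then show ?thesis using assms by simp
qed

lemma interchange_split_tail [simp]:
  assumes "ty f = U1 \<rightarrowtail> V1" "ty g = U2 \<rightarrowtail> V2" "ty x = U \<rightarrowtail> V" "V = U1 \<odot> U2"
    "ty y = U' \<rightarrowtail> V'" "ty h = V' \<rightarrowtail> W'" "ty w = X \<rightarrowtail> (U \<odot> U')"
  shows "(f \<otimes> (g \<otimes> h)) \<cdot> ((x \<otimes> y) \<cdot> w) = (((f \<otimes> g) \<cdot> x) \<otimes> (h \<cdot> y)) \<cdot> w"
proof -
  have "U1 \<in> Ob C" "U2 \<in> Ob C" "V' \<in> Ob C" using assms ty_Ob by auto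
  then have "(f \<otimes> (g \<otimes> h)) \<cdot> ((x \<otimes> y) \<cdot> w) = ((f \<otimes> (g \<otimes> h)) \<cdot> (x \<otimes> y)) \<cdot> w"
    using assms by (simp del: interchange interchange_split)
  then show ?thesis using assms by simp
qed

lemma interchange23 [simp]:
  assumes "ty f = U1 \<rightarrowtail> V1" "ty g = U2 \<rightarrowtail> V2" "ty x = U3 \<rightarrowtail> V3" "ty y = U4 \<rightarrowtail> V4" "ty w = U5 \<rightarrowtail> V5"
    "V3 \<odot> (V4 \<odot> V5) = U1 \<odot> U2" "ty z = U' \<rightarrowtail> V'" "ty h = V' \<rightarrowtail> W'"
  shows "(f \<otimes> (g \<otimes> h)) \<cdot> (x \<otimes> (y \<otimes> (w \<otimes> z))) = ((f \<otimes> g) \<cdot> (x \<otimes> (y \<otimes> w))) \<otimes> (h \<cdot> z)"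
proof -
  have "f \<otimes> (g \<otimes> h) = (f \<otimes> g) \<otimes> h" "x \<otimes> (y \<otimes> (w \<otimes> z)) = (x \<otimes> (y \<otimes> w)) \<otimes> z" using assms by simp_all
  then show ?thesis
    using assms interchange[of "x \<otimes> (y \<otimes> w)" "U3 \<odot> (U4 \<odot> U5)" "U1 \<odot> U2" "f \<otimes> g" "V1 \<odot> V2" z U' V' h W'] by simp
qed

text \<open>Collected so that a calculation can keep the layers of a composite apart while one of
  them is rewritten.\<close>

lemmas ich = interchange23 interchange interchange2 interchange3 interchange_split interchange_split3 interchange22
  interchange_tail interchange2_tail interchange_split_tail

lemmas split_ident = tensor_rules(4)[symmetric]

lemma tensor_ident_comp:
  assumes "ty f = U \<rightarrowtail> V" "ty g = V \<rightarrowtail> W" "X \<in> Ob C"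
  shows "Id X \<otimes> (g \<cdot> f) = (Id X \<otimes> g) \<cdot> (Id X \<otimes> f)" "(g \<cdot> f) \<otimes> Id X = (g \<otimes> Id X) \<cdot> (f \<otimes> Id X)"
  using assms by simp_all

lemma precomp:
  assumes "F = G" shows "F \<cdot> x = G \<cdot> x"
  using assms by simp

lemma comp_eq_tail:
  assumes "a \<cdot> b = c" "ty x = U \<rightarrowtail> V" "ty b = V \<rightarrowtail> W" "ty a = W \<rightarrowtail> X"
  shows "a \<cdot> (b \<cdot> x) = c \<cdot> x"
  using comp_reassoc[OF assms(2-4)] assms(1) by simp

lemma comp_eq_tail2:
  assumes "a \<cdot> b = c \<cdot> d" "ty x = U \<rightarrowtail> V" "ty b = V \<rightarrowtail> W" "ty a = W \<rightarrowtail> X" "ty d = V \<rightarrowtail> W'" "ty c = W' \<rightarrowtail> X'"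
  shows "a \<cdot> (b \<cdot> x) = c \<cdot> (d \<cdot> x)"
  using comp_reassoc[OF assms(2-4)] comp_reassoc[OF assms(2,5,6)] assms(1) by simp

section \<open>Naturality, isomorphisms and the unit object\<close>

lemma br_nat:
  assumes "ty f = U \<rightarrowtail> U'" "ty g = V \<rightarrowtail> V'"
  shows "br U' V' \<cdot> (f \<otimes> g) = (g \<otimes> f) \<cdot> br U V"
  using braiding_natural[of f U U' g V V'] assms by simp

lemma tw_nat:
  assumes "ty f = U \<rightarrowtail> V"
  shows "tw V \<cdot> f = f \<cdot> tw U"
  using twist_natural[of f U V] assms by simp

lemma isoE:
  assumes "iso a"
  obtains b U V where "ty a = U \<rightarrowtail> V" "ty b = V \<rightarrowtail> U" "b \<cdot> a = Id U" "a \<cdot> b = Id V"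
  using assms unfolding iso_def inverse_arrows_def Hom_iff by (metis ty_iff)

lemma iso_cancel_right:
  assumes "iso a" "ty a = U \<rightarrowtail> V" "ty f = V \<rightarrowtail> W" "ty g = V \<rightarrowtail> W" "f \<cdot> a = g \<cdot> a"
  shows "f = g"
proof -
  obtain b where b: "ty b = V \<rightarrowtail> U" "a \<cdot> b = Id V"
    using isoE[OF assms(1)] assms(2) by (metis ty_inject)
  have "f = (f \<cdot> a) \<cdot> b" using b assms(1-4) by simp
  also have "\<dots> = (g \<cdot> a) \<cdot> b" by (simp only: assms(5))
  also have "\<dots> = g" using b assms(1-4) by simp
  finally show ?thesis .
qed

lemma iso_cancel_left:
  assumes "iso a" "ty a = U \<rightarrowtail> V" "ty f = W \<rightarrowtail> U" "ty g = W \<rightarrowtail> U" "a \<cdot> f = a \<cdot> g"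
  shows "f = g"
proof -
  obtain b where b: "ty b = V \<rightarrowtail> U" "b \<cdot> a = Id U"
    using isoE[OF assms(1)] assms(2) by (metis ty_inject)
  have "f = (b \<cdot> a) \<cdot> f" using b assms(1-4) by simp
  also have "\<dots> = b \<cdot> (a \<cdot> f)" using b(1) assms(2-4) by (rule_tac comp_reassoc)
  also have "\<dots> = b \<cdot> (a \<cdot> g)" by (simp only: assms(5))
  also have "\<dots> = (b \<cdot> a) \<cdot> g" using b(1) assms(2-4) by (rule_tac comp_reassoc[symmetric])
  also have "\<dots> = g" using b assms(1-4) by simp
  finally show ?thesis .
qed

text \<open>The hexagon with two unit factors makes this braiding idempotent, and an invertible
  idempotent is an identity.\<close>

lemma br_unit [simp]:
  assumes "U \<in> Ob C"
  shows "br U \<one> = Id U" "br \<one> U = Id U"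
proof -
  have "br U \<one> \<cdot> br U \<one> = br U \<one> \<cdot> Id U"
    using braiding_tensor_right[of U \<one> \<one>] assms by simp
  then show "br U \<one> = Id U"
    using iso_cancel_left[OF braiding_iso[of U \<one>], of U U "br U \<one>" U "Id U"] assms br_ty[of U \<one>] by simp
  have "br \<one> U \<cdot> br \<one> U = br \<one> U \<cdot> Id U"
    using braiding_tensor_left[of \<one> \<one> U] assms by simp
  then show "br \<one> U = Id U"
    using iso_cancel_left[OF braiding_iso[of \<one> U], of U U "br \<one> U" U "Id U"] assms br_ty[of \<one> U] by simp
qed

text \<open>By strictness an arrow into the unit can be moved to any height of a diagram. This
  replaces the customary drawing of a cap below or above another arrow;
  \<open>coscalar_tensor\<close> does the same for cups.\<close>

lemma scalar_tensor:
  assumes "ty f = U \<rightarrowtail> \<one>" "ty g = V \<rightarrowtail> W"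
  shows "f \<otimes> g = g \<cdot> (f \<otimes> Id V)" "g \<otimes> f = g \<cdot> (Id V \<otimes> f)"
proof -
  have "V \<in> Ob C" "W \<in> Ob C" using assms ty_Ob by auto
  then show "f \<otimes> g = g \<cdot> (f \<otimes> Id V)" "g \<otimes> f = g \<cdot> (Id V \<otimes> f)"
    using interchange[of f U \<one> "Id \<one>" \<one> "Id V" V V g W] interchange[of "Id V" V V g W f U \<one> "Id \<one>" \<one>] assms
    by auto
qed

lemma coscalar_tensor:
  assumes "ty f = \<one> \<rightarrowtail> U" "ty g = V \<rightarrowtail> W"
  shows "f \<otimes> g = (f \<otimes> Id W) \<cdot> g" "g \<otimes> f = (Id W \<otimes> f) \<cdot> g"
proof -
  have "V \<in> Ob C" "W \<in> Ob C" using assms ty_Ob by auto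
  then show "f \<otimes> g = (f \<otimes> Id W) \<cdot> g" "g \<otimes> f = (Id W \<otimes> f) \<cdot> g"
    using interchange[of "Id \<one>" \<one> \<one> f U g V W "Id W" W] interchange[of g V W "Id W" W "Id \<one>" \<one> \<one> f U] assms
    by auto
qed

lemma tw_unit [simp]: "tw \<one> = Id \<one>"
proof -
  have "tw \<one> = tw \<one> \<otimes> tw \<one>"
    using twist_tensor[of \<one> \<one>] by simp
  also have "\<dots> = tw \<one> \<cdot> tw \<one>"
    using scalar_tensor(1)[of "tw \<one>" \<one> "tw \<one>" \<one> \<one>] by simp
  finally have "tw \<one> \<cdot> tw \<one> = tw \<one> \<cdot> Id \<one>" by simp
  then show ?thesis
    using iso_cancel_left[OF twist_iso[of \<one>], of \<one> \<one> "tw \<one>" \<one> "Id \<one>"] by simp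
qed

lemma tw_scalar: "ty f = U \<rightarrowtail> \<one> \<Longrightarrow> f \<cdot> tw U = f"
  using tw_nat[of f U \<one>] by simp

lemma slide_scalar:
  assumes "ty f = W \<rightarrowtail> \<one>" "Y \<in> Ob C"
  shows "(Id Y \<otimes> f) \<cdot> br W Y = f \<otimes> Id Y" "(f \<otimes> Id Y) \<cdot> br Y W = Id Y \<otimes> f"
  using br_nat[of f W \<one> "Id Y" Y Y] br_nat[of "Id Y" Y Y f W \<one>] assms by auto

lemma slide_coscalar:
  assumes "ty f = \<one> \<rightarrowtail> W" "Y \<in> Ob C"
  shows "br W Y \<cdot> (f \<otimes> Id Y) = Id Y \<otimes> f" "br Y W \<cdot> (Id Y \<otimes> f) = f \<otimes> Id Y"
  using br_nat[of f \<one> W "Id Y" Y Y] br_nat[of "Id Y" Y Y f \<one> W] assms by auto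

lemma isoI:
  assumes "ty f = U \<rightarrowtail> V" "ty h = V \<rightarrowtail> U" "h \<cdot> f = Id U" "f \<cdot> h = Id V"
  shows "iso f"
  unfolding iso_def inverse_arrows_def using assms by (auto intro!: exI[of _ h])

lemma iso_ident: "U \<in> Ob C \<Longrightarrow> iso (Id U)"
  by (rule isoI[of _ U U "Id U"]) auto

lemma iso_tensor:
  assumes "iso f" "iso g"
  shows "iso (f \<otimes> g)"
proof -
  obtain f' U V where f: "ty f = U \<rightarrowtail> V" "ty f' = V \<rightarrowtail> U" "f' \<cdot> f = Id U" "f \<cdot> f' = Id V"
    using isoE[OF assms(1)] .
  obtain g' U' V' where g: "ty g = U' \<rightarrowtail> V'" "ty g' = V' \<rightarrowtail> U'" "g' \<cdot> g = Id U'" "g \<cdot> g' = Id V'"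
    using isoE[OF assms(2)] .
  show ?thesis
    using f g ty_Ob by (intro isoI[of _ "U \<odot> U'" "V \<odot> V'" "f' \<otimes> g'"]) simp_all
qed

section \<open>Exact pairings and left duality\<close>

text \<open>The left duality, the right duality, the Frobenius form and the form on a linking are
  all instances, so transposition is treated once for all of them.\<close>

definition dual_pair :: "'o \<Rightarrow> 'o \<Rightarrow> 'm \<Rightarrow> 'm \<Rightarrow> bool" where
  "dual_pair X Y p c \<longleftrightarrow> X \<in> Ob C \<and> Y \<in> Ob C \<and> ty p = (X \<odot> Y) \<rightarrowtail> \<one> \<and> ty c = \<one> \<rightarrowtail> (Y \<odot> X) \<and>
     (p \<otimes> Id X) \<cdot> (Id X \<otimes> c) = Id X \<and> (Id Y \<otimes> p) \<cdot> (c \<otimes> Id Y) = Id Y"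

lemma dual_pair_typing:
  assumes "dual_pair X Y p c"
  shows "X \<in> Ob C" "Y \<in> Ob C" "ty p = (X \<odot> Y) \<rightarrowtail> \<one>" "ty c = \<one> \<rightarrowtail> (Y \<odot> X)"
  using assms by (auto simp: dual_pair_def)

lemma dual_pair_transpose_left:
  assumes d: "dual_pair X Y p c" and f: "ty f = Z \<rightarrowtail> X"
  shows "((p \<cdot> (f \<otimes> Id Y)) \<otimes> Id X) \<cdot> (Id Z \<otimes> c) = f"
proof -
  note [simp] = dual_pair_typing[OF d]
  have Z: "Z \<in> Ob C" using f ty_Ob by blast
  have "((p \<cdot> (f \<otimes> Id Y)) \<otimes> Id X) = (p \<otimes> Id X) \<cdot> (f \<otimes> (Id Y \<otimes> Id X))"
    using f Z by (simp del: tensor_rules(4))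
  then have "((p \<cdot> (f \<otimes> Id Y)) \<otimes> Id X) \<cdot> (Id Z \<otimes> c) = (p \<otimes> Id X) \<cdot> (f \<otimes> c)"
    using f Z by simp
  also have "\<dots> = ((p \<otimes> Id X) \<cdot> (Id X \<otimes> c)) \<cdot> f"
    using f Z coscalar_tensor(2)[of c _ f] by simp
  also have "\<dots> = f"
    using f Z d by (simp add: dual_pair_def del: comp_reassoc)
  finally show ?thesis .
qed

lemma dual_pair_transpose_right:
  assumes d: "dual_pair X Y p c" and f: "ty f = Z \<rightarrowtail> Y"
  shows "(Id Y \<otimes> (p \<cdot> (Id X \<otimes> f))) \<cdot> (c \<otimes> Id Z) = f"
proof -
  note [simp] = dual_pair_typing[OF d]
  have Z: "Z \<in> Ob C" using f ty_Ob by blast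
  have "(Id Y \<otimes> (p \<cdot> (Id X \<otimes> f))) = (Id Y \<otimes> p) \<cdot> ((Id Y \<otimes> Id X) \<otimes> f)"
    using f Z by (simp del: tensor_rules(4))
  then have "(Id Y \<otimes> (p \<cdot> (Id X \<otimes> f))) \<cdot> (c \<otimes> Id Z) = (Id Y \<otimes> p) \<cdot> (c \<otimes> f)"
    using f Z by simp
  also have "\<dots> = ((Id Y \<otimes> p) \<cdot> (c \<otimes> Id Y)) \<cdot> f"
    using f Z coscalar_tensor(1)[of c _ f] by simp
  also have "\<dots> = f"
    using f Z d by (simp add: dual_pair_def del: comp_reassoc)
  finally show ?thesis .
qed

text \<open>Transposition recovers \<open>f\<close>, so the pairing is nondegenerate. Identities
  between arrows into a dual are proved below by pairing both sides.\<close>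

lemma dual_pair_test_left:
  assumes "dual_pair X Y p c" "ty f = Z \<rightarrowtail> X" "ty f' = Z \<rightarrowtail> X" "p \<cdot> (f \<otimes> Id Y) = p \<cdot> (f' \<otimes> Id Y)"
  shows "f = f'"
proof -
  have "f = ((p \<cdot> (f \<otimes> Id Y)) \<otimes> Id X) \<cdot> (Id Z \<otimes> c)"
    by (rule dual_pair_transpose_left[OF assms(1), symmetric]) (use assms in auto)
  also have "\<dots> = ((p \<cdot> (f' \<otimes> Id Y)) \<otimes> Id X) \<cdot> (Id Z \<otimes> c)"
    by (simp only: assms(4))
  also have "\<dots> = f'"
    by (rule dual_pair_transpose_left[OF assms(1)]) (use assms in auto)
  finally show ?thesis .
qed

lemma dual_pair_test_right:
  assumes "dual_pair X Y p c" "ty f = Z \<rightarrowtail> Y" "ty f' = Z \<rightarrowtail> Y" "p \<cdot> (Id X \<otimes> f) = p \<cdot> (Id X \<otimes> f')"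
  shows "f = f'"
proof -
  have "f = (Id Y \<otimes> (p \<cdot> (Id X \<otimes> f))) \<cdot> (c \<otimes> Id Z)"
    by (rule dual_pair_transpose_right[OF assms(1), symmetric]) (use assms in auto)
  also have "\<dots> = (Id Y \<otimes> (p \<cdot> (Id X \<otimes> f'))) \<cdot> (c \<otimes> Id Z)"
    by (simp only: assms(4))
  also have "\<dots> = f'"
    by (rule dual_pair_transpose_right[OF assms(1)]) (use assms in auto)
  finally show ?thesis .
qed

lemma dual_pair_curry_left:
  assumes d: "dual_pair X Y p c" and f: "ty f = (Z \<odot> Y) \<rightarrowtail> \<one>" "Z \<in> Ob C"
  shows "p \<cdot> (((f \<otimes> Id X) \<cdot> (Id Z \<otimes> c)) \<otimes> Id Y) = f"
proof -
  note [simp] = dual_pair_typing[OF d]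
  have "p \<cdot> (((f \<otimes> Id X) \<cdot> (Id Z \<otimes> c)) \<otimes> Id Y) = p \<cdot> ((f \<otimes> Id X \<otimes> Id Y) \<cdot> (Id Z \<otimes> c \<otimes> Id Y))"
    using f by (simp del: tensor_rules(4))
  also have "\<dots> = (p \<cdot> (f \<otimes> Id (X \<odot> Y))) \<cdot> (Id Z \<otimes> c \<otimes> Id Y)"
    using f by simp
  also have "\<dots> = (f \<otimes> p) \<cdot> (Id Z \<otimes> c \<otimes> Id Y)"
    using f scalar_tensor(1)[of f _ p] by simp
  also have "\<dots> = f \<cdot> ((Id (Z \<odot> Y) \<otimes> p) \<cdot> (Id Z \<otimes> c \<otimes> Id Y))"
    using f scalar_tensor(2)[of p _ f] by simp
  also have "\<dots> = f \<cdot> (Id Z \<otimes> ((Id Y \<otimes> p) \<cdot> (c \<otimes> Id Y)))"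
    using f by (simp add: ident_tensor_split)
  also have "\<dots> = f"
    using f d by (simp add: dual_pair_def)
  finally show ?thesis .
qed

lemma dual_pair_curry_right:
  assumes d: "dual_pair X Y p c" and f: "ty f = (X \<odot> Z) \<rightarrowtail> \<one>" "Z \<in> Ob C"
  shows "p \<cdot> (Id X \<otimes> ((Id Y \<otimes> f) \<cdot> (c \<otimes> Id Z))) = f"
proof -
  note [simp] = dual_pair_typing[OF d]
  have "p \<cdot> (Id X \<otimes> ((Id Y \<otimes> f) \<cdot> (c \<otimes> Id Z))) = p \<cdot> ((Id (X \<odot> Y) \<otimes> f) \<cdot> (Id X \<otimes> (c \<otimes> Id Z)))"
    using f by (simp add: ident_tensor_split)
  also have "\<dots> = (p \<cdot> (Id (X \<odot> Y) \<otimes> f)) \<cdot> (Id X \<otimes> (c \<otimes> Id Z))"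
    using f by simp
  also have "\<dots> = (p \<otimes> f) \<cdot> (Id X \<otimes> (c \<otimes> Id Z))"
    using f scalar_tensor(2)[of f _ p] by simp
  also have "\<dots> = f \<cdot> ((p \<otimes> Id (X \<odot> Z)) \<cdot> (Id X \<otimes> (c \<otimes> Id Z)))"
    using f scalar_tensor(1)[of p _ f] by simp
  also have "\<dots> = f \<cdot> (((p \<otimes> Id X) \<cdot> (Id X \<otimes> c)) \<otimes> Id Z)"
    using f tensor_rules(4)[of X Z, symmetric] by (simp del: tensor_rules(4))
  also have "\<dots> = f"
    using f d by (simp add: dual_pair_def)
  finally show ?thesis .
qed

lemma left_dual_pair: "U \<in> Ob C \<Longrightarrow> dual_pair (du U) U (ev U) (cv U)"
  by (simp add: dual_pair_def left_duality left_duality_dual)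

lemma left_dual_arr_ty [simp]:
  assumes "ty f = U \<rightarrowtail> V"
  shows "ty (left_dual_arr f) = du V \<rightarrowtail> du U"
  using assms ty_Ob[OF assms] by (simp_all add: left_dual_arr_def Let_def)

lemma ev_left_dual_arr:
  assumes "ty f = U \<rightarrowtail> V"
  shows "ev U \<cdot> (left_dual_arr f \<otimes> Id U) = ev V \<cdot> (Id (du V) \<otimes> f)"
proof -
  have U: "U \<in> Ob C" "V \<in> Ob C" using assms ty_Ob by auto
  have "left_dual_arr f = ((ev V \<cdot> (Id (du V) \<otimes> f)) \<otimes> Id (du U)) \<cdot> (Id (du V) \<otimes> cv U)"
    using assms U by (simp add: left_dual_arr_def Let_def)
  then show ?thesis
    using dual_pair_curry_left[OF left_dual_pair[OF U(1)], of "ev V \<cdot> (Id (du V) \<otimes> f)" "du V"] assms U by simp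
qed

lemma ev_tw:
  assumes "U \<in> Ob C"
  shows "ev U \<cdot> (tw (du U) \<otimes> Id U) = ev U \<cdot> (Id (du U) \<otimes> tw U)"
  using ev_left_dual_arr[of "tw U" U U] twist_dual[of U] assms by simp

text \<open>For \<open>ev Y\<close> this is the axiom that the twist of a dual is the dual of the
  twist. Every form factors through \<open>ev Y\<close>, and the twist is natural.\<close>

lemma pairing_tw:
  assumes "ty \<beta> = (X \<odot> Y) \<rightarrowtail> \<one>" "X \<in> Ob C" "Y \<in> Ob C"
  shows "\<beta> \<cdot> (tw X \<otimes> Id Y) = \<beta> \<cdot> (Id X \<otimes> tw Y)"
proof -
  define \<phi> where "\<phi> = (\<beta> \<otimes> Id (du Y)) \<cdot> (Id X \<otimes> cv Y)"
  have [simp]: "ty \<phi> = X \<rightarrowtail> du Y"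
    using assms by (simp add: \<phi>_def)
  have \<beta>: "\<beta> = ev Y \<cdot> (\<phi> \<otimes> Id Y)"
    using dual_pair_curry_left[OF left_dual_pair[of Y], of \<beta> X] assms by (simp add: \<phi>_def)
  have "\<beta> \<cdot> (tw X \<otimes> Id Y) = ev Y \<cdot> ((\<phi> \<cdot> tw X) \<otimes> Id Y)"
    using assms by (simp add: \<beta>)
  also have "\<dots> = (ev Y \<cdot> (tw (du Y) \<otimes> Id Y)) \<cdot> (\<phi> \<otimes> Id Y)"
    using assms tw_nat[of \<phi> X "du Y"] by simp
  also have "\<dots> = \<beta> \<cdot> (Id X \<otimes> tw Y)"
    unfolding ev_tw[OF assms(3)] using assms by (simp add: \<beta>)
  finally show ?thesis .
qed

section \<open>The right duality from braiding and twist\<close>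

lemma right_ev_ty [simp]:
  assumes "U \<in> Ob C"
  shows "ty (right_ev U) = (U \<odot> du U) \<rightarrowtail> \<one>" "ty (right_coev U) = \<one> \<rightarrowtail> (du U \<odot> U)"
  using assms by (simp_all add: right_ev_def right_coev_def)

lemma right_ev_eq:
  assumes "U \<in> Ob C"
  shows "right_ev U = ev U \<cdot> (Id (du U) \<otimes> tw U) \<cdot> br U (du U)"
  using br_nat[of "tw U" U U "Id (du U)" "du U" "du U"] assms by (simp add: right_ev_def)

text \<open>Two twists accumulate on \<open>U\<close>; moving one of them to \<open>du U\<close>
  completes the double braiding to the twist of \<open>du U \<odot> U\<close>, which is trivial
  before an arrow into the unit.\<close>

lemma right_ev_br:
  assumes "U \<in> Ob C"
  shows "right_ev U \<cdot> br (du U) U \<cdot> (Id (du U) \<otimes> tw U) = ev U"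
proof -
  let ?V = "du U"
  have "right_ev U \<cdot> br ?V U \<cdot> (Id ?V \<otimes> tw U)
      = ev U \<cdot> (br U ?V \<cdot> ((tw U \<otimes> Id ?V) \<cdot> (br ?V U \<cdot> (Id ?V \<otimes> tw U))))"
    using assms by (simp add: right_ev_def)
  also have "(tw U \<otimes> Id ?V) \<cdot> (br ?V U \<cdot> (Id ?V \<otimes> tw U)) = br ?V U \<cdot> ((Id ?V \<otimes> tw U) \<cdot> (Id ?V \<otimes> tw U))"
    by (rule comp_eq_tail2[OF br_nat[symmetric]]) (use assms in simp_all)
  also have "ev U \<cdot> (br U ?V \<cdot> \<dots>) = (ev U \<cdot> (br U ?V \<cdot> (br ?V U \<cdot> (Id ?V \<otimes> tw U)))) \<cdot> (Id ?V \<otimes> tw U)"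
    using assms by (simp del: interchange)
  also have "ev U \<cdot> (br U ?V \<cdot> (br ?V U \<cdot> (Id ?V \<otimes> tw U))) \<cdot> (Id ?V \<otimes> tw U)
     = ev U \<cdot> (br U ?V \<cdot> (br ?V U \<cdot> (Id ?V \<otimes> tw U))) \<cdot> (tw ?V \<otimes> Id U)"
    using pairing_tw[of "ev U \<cdot> (br U ?V \<cdot> (br ?V U \<cdot> (Id ?V \<otimes> tw U)))" ?V U] assms by simp
  also have "\<dots> = ev U \<cdot> tw (?V \<odot> U)"
    using assms by (simp add: twist_tensor)
  also have "\<dots> = ev U" using tw_scalar[of "ev U"] assms by simp
  finally show ?thesis .
qed

lemma right_zigzag:
  assumes "U \<in> Ob C"
  shows "(right_ev U \<otimes> Id U) \<cdot> (Id U \<otimes> right_coev U) = Id U"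
proof -
  let ?V = "du U"
  define b where "b = br U ?V \<cdot> cv U"
  \<comment> \<open>\<open>F\<close> is the zigzag without the twist contained in
    \<open>right_coev U\<close>. This kink turns out to be inverse to \<open>tw U\<close>.\<close>
  define F where "F = (right_ev U \<otimes> Id U) \<cdot> (Id U \<otimes> b)"
  note [simp] = assms
  have [simp]: "ty b = \<one> \<rightarrowtail> (?V \<odot> U)" "ty F = U \<rightarrowtail> U"
    by (simp_all add: b_def F_def)
  have "(right_ev U \<otimes> Id U) \<cdot> br (?V \<odot> U) U \<cdot> (Id ?V \<otimes> Id U \<otimes> tw U)
     = ((right_ev U \<cdot> br ?V U) \<otimes> Id U) \<cdot> (Id ?V \<otimes> (br U U \<cdot> (Id U \<otimes> tw U)))"
    by (simp add: braiding_tensor_left ident_tensor_split)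
  also have "br U U \<cdot> (Id U \<otimes> tw U) = (tw U \<otimes> Id U) \<cdot> br U U"
    by (rule br_nat) simp_all
  also have "Id ?V \<otimes> ((tw U \<otimes> Id U) \<cdot> br U U) = (Id ?V \<otimes> tw U \<otimes> Id U) \<cdot> (Id ?V \<otimes> br U U)"
    by simp
  also have "((right_ev U \<cdot> br ?V U) \<otimes> Id U) \<cdot> \<dots>
    = ((right_ev U \<cdot> br ?V U \<cdot> (Id ?V \<otimes> tw U)) \<otimes> Id U) \<cdot> (Id ?V \<otimes> br U U)"
    by (rule comp_eq_tail) simp_all
  finally have 1: "(right_ev U \<otimes> Id U) \<cdot> br (?V \<odot> U) U \<cdot> (Id ?V \<otimes> Id U \<otimes> tw U) = (ev U \<otimes> Id U) \<cdot> (Id ?V \<otimes> br U U)"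
    by (simp only: right_ev_br assms)
  have "F \<cdot> tw U = (right_ev U \<otimes> Id U) \<cdot> (br (?V \<odot> U) U \<cdot> (b \<otimes> Id U)) \<cdot> tw U"
    using slide_coscalar(1)[of b "?V \<odot> U" U] by (simp add: F_def)
  also have "\<dots> = (right_ev U \<otimes> Id U) \<cdot> br (?V \<odot> U) U \<cdot> (b \<otimes> tw U)"
    using coscalar_tensor(1)[of b _ "tw U"] by simp
  also have "\<dots> = ((right_ev U \<otimes> Id U) \<cdot> br (?V \<odot> U) U \<cdot> (Id ?V \<otimes> Id U \<otimes> tw U)) \<cdot> (b \<otimes> Id U)"
    by simp
  also have "\<dots> = ((ev U \<otimes> Id U) \<cdot> (Id ?V \<otimes> br U U)) \<cdot> (b \<otimes> Id U)"
    by (simp only: 1)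
  also have "\<dots> = (ev U \<otimes> Id U) \<cdot> br U (?V \<odot> U) \<cdot> (cv U \<otimes> Id U)"
    by (simp add: braiding_tensor_right b_def)
  also have "\<dots> = (Id U \<otimes> ev U) \<cdot> (cv U \<otimes> Id U)"
    using slide_scalar(2)[of "ev U" "?V \<odot> U" U] by simp
  finally have 2: "F \<cdot> tw U = Id U" by (simp add: left_duality)
  have "(right_ev U \<otimes> Id U) \<cdot> (Id U \<otimes> right_coev U) = (right_ev U \<otimes> tw U) \<cdot> (Id U \<otimes> b)"
  proof -
    have "Id U \<otimes> right_coev U = (Id U \<otimes> Id ?V \<otimes> tw U) \<cdot> (Id U \<otimes> b)"
      by (simp add: right_coev_def b_def del: tensor_rules(4))
    moreover have "(right_ev U \<otimes> Id U) \<cdot> ((Id U \<otimes> Id ?V \<otimes> tw U) \<cdot> (Id U \<otimes> b)) = (right_ev U \<otimes> tw U) \<cdot> (Id U \<otimes> b)"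
      by (rule comp_eq_tail) simp_all
    ultimately show ?thesis by (simp only:)
  qed
  also have "\<dots> = tw U \<cdot> F"
    using scalar_tensor(1)[of "right_ev U" _ "tw U"] by (simp add: F_def)
  also have "\<dots> = Id U" using tw_nat[of F U U] 2 by simp
  finally show ?thesis .
qed

text \<open>The second zigzag \<open>p\<close> follows from the first: \<open>right_ev U\<close>
  absorbs \<open>p\<close>, and since it equals \<open>ev U\<close> up to invertible arrows,
  nondegeneracy of \<open>ev U\<close> forces \<open>p\<close> to be the identity.\<close>

lemma right_dual_pair:
  assumes "U \<in> Ob C"
  shows "dual_pair U (du U) (right_ev U) (right_coev U)"
proof -
  let ?V = "du U"
  define p where "p = (Id ?V \<otimes> right_ev U) \<cdot> (right_coev U \<otimes> Id ?V)"
  note [simp] = assms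
  have [simp]: "ty p = ?V \<rightarrowtail> ?V" by (simp add: p_def)
  have "right_ev U \<cdot> (Id U \<otimes> p)
      = right_ev U \<cdot> (Id (U \<odot> ?V) \<otimes> right_ev U) \<cdot> (Id U \<otimes> right_coev U \<otimes> Id ?V)"
    by (simp add: p_def ident_tensor_split)
  also have "\<dots> = (right_ev U \<otimes> right_ev U) \<cdot> (Id U \<otimes> right_coev U \<otimes> Id ?V)"
    using scalar_tensor(2)[of "right_ev U" _ "right_ev U"] by simp
  also have "\<dots> = right_ev U \<cdot> ((right_ev U \<otimes> (Id U \<otimes> Id ?V)) \<cdot> (Id U \<otimes> right_coev U \<otimes> Id ?V))"
    using scalar_tensor(1)[of "right_ev U" _ "right_ev U"] by simp
  also have "(right_ev U \<otimes> (Id U \<otimes> Id ?V)) \<cdot> (Id U \<otimes> right_coev U \<otimes> Id ?V)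
      = ((right_ev U \<otimes> Id U) \<cdot> (Id U \<otimes> right_coev U)) \<otimes> Id ?V"
    by (simp del: tensor_rules(4))
  also have "right_ev U \<cdot> \<dots> = right_ev U" by (simp add: right_zigzag)
  finally have 1: "right_ev U \<cdot> (Id U \<otimes> p) = right_ev U" .
  have "ev U \<cdot> (p \<otimes> tw U) \<cdot> br U ?V = right_ev U \<cdot> (Id U \<otimes> p)"
    using br_nat[of "tw U" U U p ?V ?V] by (simp add: right_ev_def)
  also have "\<dots> = ev U \<cdot> (Id ?V \<otimes> tw U) \<cdot> br U ?V" unfolding 1 by (simp add: right_ev_eq)
  finally have 2: "ev U \<cdot> (p \<otimes> tw U) \<cdot> br U ?V = ev U \<cdot> (Id ?V \<otimes> tw U) \<cdot> br U ?V" .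
  have 3: "ev U \<cdot> (p \<otimes> tw U) = ev U \<cdot> (Id ?V \<otimes> tw U)"
    by (rule iso_cancel_right[OF _ _ _ _ 2, where U = "U \<odot> ?V" and V = "?V \<odot> U" and W = \<one>])
      (simp_all add: braiding_iso)
  have "iso (Id ?V \<otimes> tw U)"
    by (rule iso_tensor) (simp_all add: twist_iso iso_ident)
  then have "ev U \<cdot> (p \<otimes> Id U) = ev U"
    by (rule iso_cancel_right[where U = "?V \<odot> U" and V = "?V \<odot> U" and W = \<one>]) (simp_all add: 3)
  then have "p = Id ?V"
    using dual_pair_test_left[OF left_dual_pair[of U], of p ?V "Id ?V"] by simp
  then show ?thesis by (simp add: dual_pair_def right_zigzag p_def)
qed

lemma dual_pair_tensor:
  assumes d: "dual_pair X Y p c" and d': "dual_pair X' Y' p' c'"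
  shows "dual_pair (X' \<odot> X) (Y \<odot> Y') (p' \<cdot> (Id X' \<otimes> p \<otimes> Id Y')) ((Id Y \<otimes> c' \<otimes> Id X) \<cdot> c)"
proof -
  note [simp] = dual_pair_typing[OF d] dual_pair_typing[OF d']
  have z: "(p \<otimes> Id X) \<cdot> (Id X \<otimes> c) = Id X" "(Id Y \<otimes> p) \<cdot> (c \<otimes> Id Y) = Id Y"
    "(p' \<otimes> Id X') \<cdot> (Id X' \<otimes> c') = Id X'" "(Id Y' \<otimes> p') \<cdot> (c' \<otimes> Id Y') = Id Y'"
    using d d' by (simp_all add: dual_pair_def)
  have e: "(p' \<cdot> (Id X' \<otimes> p \<otimes> Id Y')) \<otimes> Id (X' \<odot> X) = (p' \<otimes> Id X' \<otimes> Id X) \<cdot> (Id X' \<otimes> p \<otimes> Id Y' \<otimes> Id X' \<otimes> Id X)"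
    "Id (X' \<odot> X) \<otimes> ((Id Y \<otimes> c' \<otimes> Id X) \<cdot> c) = (Id X' \<otimes> Id X \<otimes> Id Y \<otimes> c' \<otimes> Id X) \<cdot> (Id X' \<otimes> Id X \<otimes> c)"
    "Id (Y \<odot> Y') \<otimes> (p' \<cdot> (Id X' \<otimes> p \<otimes> Id Y')) = (Id Y \<otimes> Id Y' \<otimes> p') \<cdot> (Id Y \<otimes> Id Y' \<otimes> Id X' \<otimes> p \<otimes> Id Y')"
    "((Id Y \<otimes> c' \<otimes> Id X) \<cdot> c) \<otimes> Id (Y \<odot> Y') = (Id Y \<otimes> c' \<otimes> Id X \<otimes> Id Y \<otimes> Id Y') \<cdot> (c \<otimes> Id Y \<otimes> Id Y')"
    by (simp_all add: split_ident del: tensor_rules(4))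
  have pc: "(Id X' \<otimes> p \<otimes> Id Y' \<otimes> Id X' \<otimes> Id X) \<cdot> (Id X' \<otimes> Id X \<otimes> Id Y \<otimes> c' \<otimes> Id X) =
      (Id X' \<otimes> c' \<otimes> Id X) \<cdot> (Id X' \<otimes> p \<otimes> Id X)"
    using scalar_tensor(1)[of p "X \<odot> Y" c' \<one> "Y' \<odot> X'", symmetric]
    by (simp add: split_ident del: tensor_rules(4)) simp
  have cp: "(Id Y \<otimes> Id Y' \<otimes> Id X' \<otimes> p \<otimes> Id Y') \<cdot> (Id Y \<otimes> c' \<otimes> Id X \<otimes> Id Y \<otimes> Id Y') =
      (Id Y \<otimes> c' \<otimes> Id Y') \<cdot> (Id Y \<otimes> p \<otimes> Id Y')"
    using scalar_tensor(2)[of p "X \<odot> Y" c' \<one> "Y' \<odot> X'", symmetric]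
    by (simp add: split_ident del: tensor_rules(4)) simp
  have "((p' \<cdot> (Id X' \<otimes> p \<otimes> Id Y')) \<otimes> Id (X' \<odot> X)) \<cdot> (Id (X' \<odot> X) \<otimes> ((Id Y \<otimes> c' \<otimes> Id X) \<cdot> c))
      = (p' \<otimes> Id X' \<otimes> Id X) \<cdot> ((Id X' \<otimes> p \<otimes> Id Y' \<otimes> Id X' \<otimes> Id X) \<cdot> (Id X' \<otimes> Id X \<otimes> Id Y \<otimes> c' \<otimes> Id X)) \<cdot> (Id X' \<otimes> Id X \<otimes> c)"
    unfolding e by (simp del: ich tensor_rules(4))
  also have "\<dots> = ((p' \<otimes> Id X' \<otimes> Id X) \<cdot> (Id X' \<otimes> c' \<otimes> Id X)) \<cdot> ((Id X' \<otimes> p \<otimes> Id X) \<cdot> (Id X' \<otimes> Id X \<otimes> c))"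
    unfolding pc by (simp del: ich tensor_rules(4))
  also have "\<dots> = Id (X' \<odot> X)"
    using z(1,3) by (simp del: tensor_rules(4)) simp
  finally have 1: "((p' \<cdot> (Id X' \<otimes> p \<otimes> Id Y')) \<otimes> Id (X' \<odot> X)) \<cdot> (Id (X' \<odot> X) \<otimes> ((Id Y \<otimes> c' \<otimes> Id X) \<cdot> c)) = Id (X' \<odot> X)" .
  have "(Id (Y \<odot> Y') \<otimes> (p' \<cdot> (Id X' \<otimes> p \<otimes> Id Y'))) \<cdot> (((Id Y \<otimes> c' \<otimes> Id X) \<cdot> c) \<otimes> Id (Y \<odot> Y'))
      = (Id Y \<otimes> Id Y' \<otimes> p') \<cdot> ((Id Y \<otimes> Id Y' \<otimes> Id X' \<otimes> p \<otimes> Id Y') \<cdot> (Id Y \<otimes> c' \<otimes> Id X \<otimes> Id Y \<otimes> Id Y')) \<cdot> (c \<otimes> Id Y \<otimes> Id Y')"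
    unfolding e by (simp del: ich tensor_rules(4))
  also have "\<dots> = ((Id Y \<otimes> Id Y' \<otimes> p') \<cdot> (Id Y \<otimes> c' \<otimes> Id Y')) \<cdot> ((Id Y \<otimes> p \<otimes> Id Y') \<cdot> (c \<otimes> Id Y \<otimes> Id Y'))"
    unfolding cp by (simp del: ich tensor_rules(4))
  also have "\<dots> = Id (Y \<odot> Y')"
    using z(2,4) by (simp del: tensor_rules(4)) simp
  finally show ?thesis using 1 by (simp add: dual_pair_def)
qed

section \<open>Duals of tensor products and of actions\<close>

lemma dual_tensor_ty [simp]:
  assumes "U \<in> Ob C" "V \<in> Ob C"
  shows "ty (dual_tensor U V) = du (U \<odot> V) \<rightarrowtail> (du V \<odot> du U)"
  using assms by (simp add: dual_tensor_def)

text \<open>\<open>dual_tensor U V\<close> is by definition a transpose along the nested pairing of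
  \<open>du V \<odot> du U\<close> with \<open>U \<odot> V\<close>. Only this characterization is
  used from here on.\<close>

lemma ev_dual_tensor:
  assumes "U \<in> Ob C" "V \<in> Ob C"
  shows "ev V \<cdot> (Id (du V) \<otimes> ev U \<otimes> Id V) \<cdot> (dual_tensor U V \<otimes> Id (U \<odot> V)) = ev (U \<odot> V)"
  using dual_pair_curry_left[OF dual_pair_tensor[OF left_dual_pair[OF assms(1)] left_dual_pair[OF assms(2)]], of "ev (U \<odot> V)" "du (U \<odot> V)"]
    assms by (simp add: dual_tensor_def)

text \<open>The identification made with the left duality is also right for the right duality. The
  braiding of two pairs of strands produces crossings of \<open>U\<close> with \<open>V\<close>;
  they cancel against the double braiding in \<open>tw (U \<odot> V)\<close> once the caps have been
  slid off the other strands.\<close>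

lemma right_ev_dual_tensor:
  assumes [simp]: "U \<in> Ob C" "V \<in> Ob C"
  shows "right_ev U \<cdot> (Id U \<otimes> right_ev V \<otimes> Id (du U)) \<cdot> (Id (U \<odot> V) \<otimes> dual_tensor U V) = right_ev (U \<odot> V)"
proof -
  let ?U = "du U" and ?V = "du V"
  let ?Z = "?V \<odot> ?U"
  let ?E = "ev V \<cdot> (Id ?V \<otimes> ev U \<otimes> Id V)"
  let ?D = "right_ev U \<cdot> (Id U \<otimes> right_ev V \<otimes> Id ?U)"
  have 1: "(ev U \<otimes> Id V) \<cdot> (Id ?U \<otimes> br V U) \<cdot> (br V ?U \<otimes> Id U) = Id V \<otimes> ev U"
    using slide_scalar(2)[of "ev U" "?U \<odot> U" V] braiding_tensor_right[of V ?U U] by simp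
  have 2: "((ev V \<cdot> br V ?V) \<otimes> Id U) \<cdot> (Id V \<otimes> br U ?V) \<cdot> (br U V \<otimes> Id ?V) = Id U \<otimes> (ev V \<cdot> br V ?V)"
    using slide_scalar(2)[of "ev V \<cdot> br V ?V" "V \<odot> ?V" U] braiding_tensor_right[of U V ?V] by simp
  have "?E \<cdot> br (U \<odot> V) ?Z \<cdot> (br V U \<otimes> Id ?Z) = ?E \<cdot> (Id ?Z \<otimes> br V U) \<cdot> br (V \<odot> U) ?Z"
    using br_nat[of "br V U" "V \<odot> U" "U \<odot> V" "Id ?Z" ?Z ?Z] by simp
  also have "br (V \<odot> U) ?Z = (Id ?V \<otimes> br V ?U \<otimes> Id U) \<cdot> ((br V ?V \<otimes> br U ?U) \<cdot> (Id V \<otimes> br U ?V \<otimes> Id ?U))"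
  proof -
    have "br (V \<odot> U) ?Z = (br V ?Z \<otimes> Id U) \<cdot> (Id V \<otimes> br U ?Z)"
      by (simp add: braiding_tensor_left)
    also have "br V ?Z \<otimes> Id U = (Id ?V \<otimes> br V ?U \<otimes> Id U) \<cdot> (br V ?V \<otimes> Id ?U \<otimes> Id U)"
      by (simp add: braiding_tensor_right split_ident del: tensor_rules(4))
    also have "Id V \<otimes> br U ?Z = (Id V \<otimes> Id ?V \<otimes> br U ?U) \<cdot> (Id V \<otimes> br U ?V \<otimes> Id ?U)"
      by (simp add: braiding_tensor_right split_ident del: tensor_rules(4))
    also have "((Id ?V \<otimes> br V ?U \<otimes> Id U) \<cdot> (br V ?V \<otimes> Id ?U \<otimes> Id U)) \<cdot> \<dots>
       = (Id ?V \<otimes> br V ?U \<otimes> Id U) \<cdot> (((br V ?V \<otimes> Id ?U \<otimes> Id U) \<cdot> (Id V \<otimes> Id ?V \<otimes> br U ?U)) \<cdot> (Id V \<otimes> br U ?V \<otimes> Id ?U))"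
      by (simp del: ich tensor_rules(4))
    also have "(br V ?V \<otimes> Id ?U \<otimes> Id U) \<cdot> (Id V \<otimes> Id ?V \<otimes> br U ?U) = br V ?V \<otimes> br U ?U"
      by simp
    finally show ?thesis .
  qed
  also have "?E \<cdot> (Id ?Z \<otimes> br V U) \<cdot> ((Id ?V \<otimes> br V ?U \<otimes> Id U) \<cdot> ((br V ?V \<otimes> br U ?U) \<cdot> (Id V \<otimes> br U ?V \<otimes> Id ?U)))
      = (ev V \<cdot> (Id ?V \<otimes> ((ev U \<otimes> Id V) \<cdot> (Id ?U \<otimes> br V U) \<cdot> (br V ?U \<otimes> Id U)))) \<cdot> ((br V ?V \<otimes> br U ?U) \<cdot> (Id V \<otimes> br U ?V \<otimes> Id ?U))"
    by (simp add: ident_tensor_split)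
  also have "ev V \<cdot> (Id ?V \<otimes> ((ev U \<otimes> Id V) \<cdot> (Id ?U \<otimes> br V U) \<cdot> (br V ?U \<otimes> Id U))) = ev V \<otimes> ev U"
    unfolding 1 using scalar_tensor(2)[of "ev U" _ "ev V"] by (simp add: ident_tensor_split)
  also have "(ev V \<otimes> ev U) \<cdot> ((br V ?V \<otimes> br U ?U) \<cdot> (Id V \<otimes> br U ?V \<otimes> Id ?U))
      = ((ev V \<cdot> br V ?V) \<otimes> (ev U \<cdot> br U ?U)) \<cdot> (Id V \<otimes> br U ?V \<otimes> Id ?U)"
    by simp
  also have "(ev V \<cdot> br V ?V) \<otimes> (ev U \<cdot> br U ?U) = (ev U \<cdot> br U ?U) \<cdot> ((ev V \<cdot> br V ?V) \<otimes> Id U \<otimes> Id ?U)"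
    using scalar_tensor(1)[of "ev V \<cdot> br V ?V" _ "ev U \<cdot> br U ?U"] by simp
  finally have 3: "?E \<cdot> br (U \<odot> V) ?Z \<cdot> (br V U \<otimes> Id ?Z) =
      (ev U \<cdot> br U ?U) \<cdot> ((ev V \<cdot> br V ?V) \<otimes> Id U \<otimes> Id ?U) \<cdot> (Id V \<otimes> br U ?V \<otimes> Id ?U)" .
  have tw: "tw (U \<odot> V) \<otimes> Id ?Z = (br V U \<otimes> Id ?Z) \<cdot> ((br U V \<otimes> Id ?Z) \<cdot> (tw U \<otimes> tw V \<otimes> Id ?Z))"
    by (simp add: twist_tensor)
  have "?E \<cdot> br (U \<odot> V) ?Z \<cdot> (tw (U \<odot> V) \<otimes> Id ?Z)
      = (?E \<cdot> br (U \<odot> V) ?Z \<cdot> (br V U \<otimes> Id ?Z)) \<cdot> ((br U V \<otimes> Id ?Z) \<cdot> (tw U \<otimes> tw V \<otimes> Id ?Z))"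
    unfolding tw by (simp del: ich)
  also have "\<dots> = (ev U \<cdot> br U ?U) \<cdot> (((ev V \<cdot> br V ?V) \<otimes> Id U \<otimes> Id ?U) \<cdot> ((Id V \<otimes> br U ?V \<otimes> Id ?U) \<cdot> ((br U V \<otimes> Id ?V \<otimes> Id ?U) \<cdot> (tw U \<otimes> tw V \<otimes> Id ?Z))))"
    unfolding 3 by (simp del: ich)
  also have "((ev V \<cdot> br V ?V) \<otimes> Id U \<otimes> Id ?U) \<cdot> ((Id V \<otimes> br U ?V \<otimes> Id ?U) \<cdot> ((br U V \<otimes> Id ?V \<otimes> Id ?U) \<cdot> (tw U \<otimes> tw V \<otimes> Id ?Z)))
      = ((((ev V \<cdot> br V ?V) \<otimes> Id U) \<cdot> (Id V \<otimes> br U ?V) \<cdot> (br U V \<otimes> Id ?V)) \<otimes> Id ?U) \<cdot> (tw U \<otimes> tw V \<otimes> Id ?Z)"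
    by (simp add: tensor_ident_comp del: ich)
  also have "(ev U \<cdot> br U ?U) \<cdot> \<dots> = ?D"
    unfolding 2 by (simp add: right_ev_def split_ident del: tensor_rules(4))
  finally have 4: "?E \<cdot> br (U \<odot> V) ?Z \<cdot> (tw (U \<odot> V) \<otimes> Id ?Z) = ?D" .
  have "right_ev (U \<odot> V) = (?E \<cdot> (dual_tensor U V \<otimes> Id (U \<odot> V))) \<cdot> (br (U \<odot> V) (du (U \<odot> V)) \<cdot> (tw (U \<odot> V) \<otimes> Id (du (U \<odot> V))))"
    unfolding ev_dual_tensor[OF assms] by (simp add: right_ev_def)
  also have "\<dots> = ?E \<cdot> ((dual_tensor U V \<otimes> Id (U \<odot> V)) \<cdot> (br (U \<odot> V) (du (U \<odot> V)) \<cdot> (tw (U \<odot> V) \<otimes> Id (du (U \<odot> V)))))"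
    by simp
  also have "(dual_tensor U V \<otimes> Id (U \<odot> V)) \<cdot> (br (U \<odot> V) (du (U \<odot> V)) \<cdot> (tw (U \<odot> V) \<otimes> Id (du (U \<odot> V))))
      = br (U \<odot> V) ?Z \<cdot> ((Id (U \<odot> V) \<otimes> dual_tensor U V) \<cdot> (tw (U \<odot> V) \<otimes> Id (du (U \<odot> V))))"
    by (rule comp_eq_tail2[OF br_nat[symmetric]]) simp_all
  also have "(Id (U \<odot> V) \<otimes> dual_tensor U V) \<cdot> (tw (U \<odot> V) \<otimes> Id (du (U \<odot> V))) = (tw (U \<odot> V) \<otimes> Id ?Z) \<cdot> (Id (U \<odot> V) \<otimes> dual_tensor U V)"
    by simp
  also have "?E \<cdot> (br (U \<odot> V) ?Z \<cdot> \<dots>) = (?E \<cdot> br (U \<odot> V) ?Z \<cdot> (tw (U \<odot> V) \<otimes> Id ?Z)) \<cdot> (Id (U \<odot> V) \<otimes> dual_tensor U V)"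
    by (simp del: ich)
  finally show ?thesis unfolding 4 by simp
qed

lemma dual_action_ty [simp]:
  assumes "ty \<rho> = (alg_ob A \<odot> M) \<rightarrowtail> M" "alg_ob A \<in> Ob C" "M \<in> Ob C"
  shows "ty (dual_action A M \<rho>) = (du M \<odot> alg_ob A) \<rightarrowtail> du M"
  using assms left_dual_arr_ty[OF assms(1)] by (simp add: dual_action_def)

text \<open>The dual action is adjoint to \<rho> under evaluation, and this determines it; the
  explicit formula with \<open>dual_tensor\<close> is not unfolded again.\<close>

lemma ev_dual_action:
  assumes \<rho>: "ty \<rho> = (alg_ob A \<odot> M) \<rightarrowtail> M" and [simp]: "alg_ob A \<in> Ob C" "M \<in> Ob C"
  shows "ev M \<cdot> (dual_action A M \<rho> \<otimes> Id M) = ev M \<cdot> (Id (du M) \<otimes> \<rho>)"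
proof -
  let ?A = "alg_ob A"
  note [simp] = \<rho> left_dual_arr_ty[OF \<rho>]
  have "dual_action A M \<rho> \<otimes> Id M = (Id (du M) \<otimes> ev ?A \<otimes> Id M) \<cdot> ((dual_tensor ?A M \<cdot> left_dual_arr \<rho>) \<otimes> Id ?A \<otimes> Id M)"
    by (simp add: dual_action_def del: tensor_rules(4))
  also have "(dual_tensor ?A M \<cdot> left_dual_arr \<rho>) \<otimes> Id ?A \<otimes> Id M = (dual_tensor ?A M \<otimes> Id (?A \<odot> M)) \<cdot> (left_dual_arr \<rho> \<otimes> Id (?A \<odot> M))"
    by simp
  finally have "ev M \<cdot> (dual_action A M \<rho> \<otimes> Id M) = (ev M \<cdot> (Id (du M) \<otimes> ev ?A \<otimes> Id M) \<cdot> (dual_tensor ?A M \<otimes> Id (?A \<odot> M))) \<cdot> (left_dual_arr \<rho> \<otimes> Id (?A \<odot> M))"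
    by (simp del: ich tensor_rules(4))
  also have "\<dots> = ev M \<cdot> (Id (du M) \<otimes> \<rho>)"
    unfolding ev_dual_tensor[OF assms(2,3)] using ev_left_dual_arr[OF \<rho>] by simp
  finally show ?thesis .
qed

lemma right_dual_arr_ty [simp]:
  assumes "ty f = U \<rightarrowtail> V"
  shows "ty (right_dual_arr f) = du V \<rightarrowtail> du U"
  using assms ty_Ob[OF assms] by (simp_all add: right_dual_arr_def Let_def)

lemma right_ev_right_dual_arr:
  assumes "ty f = U \<rightarrowtail> V"
  shows "right_ev U \<cdot> (Id U \<otimes> right_dual_arr f) = right_ev V \<cdot> (f \<otimes> Id (du V))"
proof -
  note [simp] = assms ty_Ob[OF assms]
  have "right_dual_arr f = (Id (du U) \<otimes> (right_ev V \<cdot> (f \<otimes> Id (du V)))) \<cdot> (right_coev U \<otimes> Id (du V))"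
    by (simp add: right_dual_arr_def Let_def)
  then show ?thesis
    using dual_pair_curry_right[OF right_dual_pair[of U], of "right_ev V \<cdot> (f \<otimes> Id (du V))" "du V"] by simp
qed

lemma conj_action_ty [simp]:
  assumes "ty \<rho> = (alg_ob A \<odot> M) \<rightarrowtail> M" "alg_ob A \<in> Ob C" "M \<in> Ob C" "ty (reversion A) = alg_ob A \<rightarrowtail> alg_ob A"
  shows "ty (conj_action A M \<rho>) = (alg_ob A \<odot> du M) \<rightarrowtail> du M"
  using assms right_dual_arr_ty[of "\<rho> \<cdot> br M (alg_ob A)" "M \<odot> alg_ob A" M] by (simp add: conj_action_def)

text \<open>The corresponding adjunction for the conjugate module: the algebra strand crosses
  \<open>M\<close> and picks up the reversion before it acts.\<close>

lemma right_ev_conj_action: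
  assumes \<rho>: "ty \<rho> = (alg_ob A \<odot> M) \<rightarrowtail> M" and [simp]: "alg_ob A \<in> Ob C" "M \<in> Ob C"
    "ty (reversion A) = alg_ob A \<rightarrowtail> alg_ob A"
  shows "right_ev M \<cdot> (Id M \<otimes> conj_action A M \<rho>) =
    right_ev M \<cdot> ((\<rho> \<cdot> br M (alg_ob A) \<cdot> (Id M \<otimes> reversion A)) \<otimes> Id (du M))"
proof -
  let ?A = "alg_ob A" and ?\<sigma> = "reversion A"
  define R where "R = right_dual_arr (\<rho> \<cdot> br M ?A)"
  note [simp] = \<rho>
  have R [simp]: "ty R = du M \<rightarrowtail> du (M \<odot> ?A)" unfolding R_def by (rule right_dual_arr_ty) simp
  have "right_ev M \<cdot> (Id M \<otimes> conj_action A M \<rho>) =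
      right_ev M \<cdot> (Id M \<otimes> right_ev ?A \<otimes> Id (du M)) \<cdot> (Id M \<otimes> ?\<sigma> \<otimes> (dual_tensor M ?A \<cdot> R))"
    by (simp add: conj_action_def R_def[symmetric])
  also have "Id M \<otimes> ?\<sigma> \<otimes> (dual_tensor M ?A \<cdot> R) = (Id M \<otimes> Id ?A \<otimes> dual_tensor M ?A) \<cdot> (Id M \<otimes> ?\<sigma> \<otimes> R)"
    by (simp del: tensor_rules(4))
  also have "right_ev M \<cdot> (Id M \<otimes> right_ev ?A \<otimes> Id (du M)) \<cdot> \<dots> =
      (right_ev M \<cdot> (Id M \<otimes> right_ev ?A \<otimes> Id (du M)) \<cdot> (Id (M \<odot> ?A) \<otimes> dual_tensor M ?A)) \<cdot> (Id M \<otimes> ?\<sigma> \<otimes> R)"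
    by (simp add: ident_tensor_split del: ich tensor_rules(4))
  also have "\<dots> = (right_ev (M \<odot> ?A) \<cdot> (Id (M \<odot> ?A) \<otimes> R)) \<cdot> (Id M \<otimes> ?\<sigma> \<otimes> Id (du M))"
    unfolding right_ev_dual_tensor[OF assms(3,2)] by (simp add: ident_tensor_split)
  also have "right_ev (M \<odot> ?A) \<cdot> (Id (M \<odot> ?A) \<otimes> R) = right_ev M \<cdot> ((\<rho> \<cdot> br M ?A) \<otimes> Id (du M))"
    unfolding R_def by (rule right_ev_right_dual_arr) simp
  finally show ?thesis by simp
qed

section \<open>The map to the double dual and rotated pairings\<close>

lemma \<delta>_ty [simp]: "U \<in> Ob C \<Longrightarrow> ty (\<delta> U) = U \<rightarrowtail> du (du U)"
  by (simp add: \<delta>_def)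

text \<open>This identifies \<delta> as the pivotal map that carries the right duality of
  \<open>U\<close> to the left duality of \<open>du U\<close>. The loop it contains is pulled
  straight by sliding a strand over a cap.\<close>

lemma ev_\<delta>:
  assumes [simp]: "U \<in> Ob C"
  shows "ev (du U) \<cdot> (\<delta> U \<otimes> Id (du U)) = right_ev U"
proof -
  let ?Y = "du U"
  let ?W = "du ?Y"
  define \<zeta> where "\<zeta> = br ?Y ?W \<cdot> cv ?Y"
  have [simp]: "ty \<zeta> = \<one> \<rightarrowtail> (?W \<odot> ?Y)" by (simp add: \<zeta>_def)
  have K: "(ev ?Y \<otimes> Id ?Y) \<cdot> (Id ?W \<otimes> br ?Y ?Y) \<cdot> (\<zeta> \<otimes> Id ?Y) = Id ?Y"
  proof -
    have "(ev ?Y \<otimes> Id ?Y) \<cdot> (Id ?W \<otimes> br ?Y ?Y) \<cdot> (\<zeta> \<otimes> Id ?Y) = ((ev ?Y \<otimes> Id ?Y) \<cdot> br ?Y (?W \<odot> ?Y)) \<cdot> (cv ?Y \<otimes> Id ?Y)"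
      by (simp add: \<zeta>_def braiding_tensor_right)
    also have "\<dots> = Id ?Y"
      using slide_scalar(2)[of "ev ?Y" "?W \<odot> ?Y" ?Y] left_duality[of ?Y] by simp
    finally show ?thesis .
  qed
  have "ev ?Y \<cdot> (\<delta> U \<otimes> Id ?Y) = ev ?Y \<cdot> (Id ?W \<otimes> (ev U \<otimes> Id ?Y)) \<cdot> (\<zeta> \<otimes> tw U \<otimes> Id ?Y)"
    by (simp add: \<delta>_def \<zeta>_def)
  also have "ev U \<otimes> Id ?Y = (Id ?Y \<otimes> ev U) \<cdot> br (?Y \<odot> U) ?Y"
    using slide_scalar(1)[of "ev U" "?Y \<odot> U" ?Y] by simp
  also have "br (?Y \<odot> U) ?Y = (br ?Y ?Y \<otimes> Id U) \<cdot> (Id ?Y \<otimes> br U ?Y)"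
    by (simp add: braiding_tensor_left)
  also have "ev ?Y \<cdot> (Id ?W \<otimes> ((Id ?Y \<otimes> ev U) \<cdot> \<dots>)) = ((ev ?Y \<cdot> (Id (?W \<odot> ?Y) \<otimes> ev U)) \<cdot> (Id ?W \<otimes> br ?Y ?Y \<otimes> Id U)) \<cdot> (Id ?W \<otimes> Id ?Y \<otimes> br U ?Y)"
    by (simp add: ident_tensor_split)
  also have "ev ?Y \<cdot> (Id (?W \<odot> ?Y) \<otimes> ev U) = ev U \<cdot> (ev ?Y \<otimes> Id ?Y \<otimes> Id U)"
    using scalar_tensor(2)[of "ev U" "?Y \<odot> U" "ev ?Y" "?W \<odot> ?Y" \<one>]
      scalar_tensor(1)[of "ev ?Y" "?W \<odot> ?Y" "ev U" "?Y \<odot> U" \<one>] by simp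
  also have "ev U \<cdot> (ev ?Y \<otimes> Id ?Y \<otimes> Id U) \<cdot> (Id ?W \<otimes> br ?Y ?Y \<otimes> Id U) \<cdot> (Id ?W \<otimes> Id ?Y \<otimes> br U ?Y) \<cdot> (\<zeta> \<otimes> tw U \<otimes> Id ?Y)
      = ev U \<cdot> ((((ev ?Y \<otimes> Id ?Y) \<cdot> (Id ?W \<otimes> br ?Y ?Y)) \<otimes> Id U) \<cdot> (\<zeta> \<otimes> (br U ?Y \<cdot> (tw U \<otimes> Id ?Y))))"
    by (simp add: split_ident del: tensor_rules(4)) simp
  also have "\<zeta> \<otimes> (br U ?Y \<cdot> (tw U \<otimes> Id ?Y)) = (\<zeta> \<otimes> Id ?Y \<otimes> Id U) \<cdot> (br U ?Y \<cdot> (tw U \<otimes> Id ?Y))"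
    using coscalar_tensor(1)[of \<zeta> _ "br U ?Y \<cdot> (tw U \<otimes> Id ?Y)"] by simp
  also have "(((ev ?Y \<otimes> Id ?Y) \<cdot> (Id ?W \<otimes> br ?Y ?Y)) \<otimes> Id U) \<cdot> \<dots>
      = (((ev ?Y \<otimes> Id ?Y) \<cdot> (Id ?W \<otimes> br ?Y ?Y) \<cdot> (\<zeta> \<otimes> Id ?Y)) \<otimes> Id U) \<cdot> (br U ?Y \<cdot> (tw U \<otimes> Id ?Y))"
    by (rule comp_eq_tail) (simp_all del: tensor_rules(4))
  finally show ?thesis unfolding K by (simp add: right_ev_def)
qed

text \<open>Translates the condition relating \<open>g\<close> to its dual into a symmetry between
  the forms \<open>ev M \<cdot> (g \<otimes> Id M)\<close> and
  \<open>right_ev M \<cdot> (Id M \<otimes> g)\<close>.\<close>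

lemma ev_left_dual_\<delta>:
  assumes g: "ty g = M \<rightarrowtail> du M" and [simp]: "M \<in> Ob C"
  shows "ev M \<cdot> ((left_dual_arr g \<cdot> \<delta> M) \<otimes> Id M) = right_ev M \<cdot> (Id M \<otimes> g)"
proof -
  note [simp] = g left_dual_arr_ty[OF g]
  have "ev M \<cdot> ((left_dual_arr g \<cdot> \<delta> M) \<otimes> Id M) = (ev M \<cdot> (left_dual_arr g \<otimes> Id M)) \<cdot> (\<delta> M \<otimes> Id M)"
    by simp
  also have "\<dots> = (ev (du M) \<cdot> (\<delta> M \<otimes> Id (du M))) \<cdot> (Id M \<otimes> g)"
    unfolding ev_left_dual_arr[OF g] by simp
  finally show ?thesis by (simp add: ev_\<delta>)
qed

lemma cyclic_braid:
  assumes [simp]: "A \<in> Ob C" "X \<in> Ob C" "Y \<in> Ob C"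
  shows "br X (Y \<odot> A) \<cdot> br A (X \<odot> Y) = (Id Y \<otimes> (br X A \<cdot> br A X)) \<cdot> br (A \<odot> X) Y"
proof -
  have "br X (Y \<odot> A) \<cdot> br A (X \<odot> Y) = (Id Y \<otimes> br X A) \<cdot> ((br (X \<odot> A) Y) \<cdot> (br A X \<otimes> Id Y))"
    by (simp add: braiding_tensor_right braiding_tensor_left)
  also have "(br (X \<odot> A) Y) \<cdot> (br A X \<otimes> Id Y) = (Id Y \<otimes> br A X) \<cdot> br (A \<odot> X) Y"
    by (rule br_nat) simp_all
  finally show ?thesis by simp
qed

lemma iso_comp:
  assumes "iso f" "iso g" "ty g = U \<rightarrowtail> V" "ty f = V \<rightarrowtail> W"
  shows "iso (f \<cdot> g)"
proof -
  obtain f' where f': "ty f' = W \<rightarrowtail> V" "f' \<cdot> f = Id V" "f \<cdot> f' = Id W"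
    using isoE[OF assms(1)] assms(4) by (metis ty_inject)
  obtain g' where g': "ty g' = V \<rightarrowtail> U" "g' \<cdot> g = Id U" "g \<cdot> g' = Id V"
    using isoE[OF assms(2)] assms(3) by (metis ty_inject)
  have "f' \<cdot> (f \<cdot> g) = Id V \<cdot> g" "g \<cdot> (g' \<cdot> f') = Id V \<cdot> f'"
    by (rule comp_eq_tail[OF f'(2)] comp_eq_tail[OF g'(3)]; use assms f' g' in simp)+
  then show ?thesis
    using assms f' g' by (intro isoI[of _ U W "g' \<cdot> f'"]) simp_all
qed

text \<open>Passing from \<beta> to \<beta>' is what turns \<open>ev\<close> into
  \<open>right_ev\<close>. Invariance of \<beta>, in elements \<beta>(y, a x) = \<beta>(y a, x),
  becomes an identity for \<beta>' in which \<open>A\<close> is carried around both strands, because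
  the two pairs of sides differ by the same invertible \<open>T\<close>.\<close>

lemma twisted_pairing_action:
  assumes [simp]: "A \<in> Ob C" "X \<in> Ob C" "Y \<in> Ob C"
    and [simp]: "ty l = (A \<odot> X) \<rightarrowtail> X" "ty \<rho> = (Y \<odot> A) \<rightarrowtail> Y" "ty \<beta> = (Y \<odot> X) \<rightarrowtail> \<one>"
    and \<beta>': "\<beta>' = \<beta> \<cdot> (Id Y \<otimes> tw X) \<cdot> br X Y"
  shows "\<beta>' \<cdot> (l \<otimes> Id Y) = (\<beta>' \<cdot> (Id X \<otimes> (\<rho> \<cdot> (Id Y \<otimes> tw A)))) \<cdot> br A (X \<odot> Y) \<longleftrightarrow> \<beta> \<cdot> (Id Y \<otimes> l) = \<beta> \<cdot> (\<rho> \<otimes> Id X)"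
proof -
  define T where "T = (Id Y \<otimes> tw A \<otimes> tw X) \<cdot> (br X (Y \<odot> A) \<cdot> br A (X \<odot> Y))"
  have T [simp]: "ty T = (A \<odot> X \<odot> Y) \<rightarrowtail> (Y \<odot> A \<odot> X)" by (simp add: T_def)
  have T2: "T = (Id Y \<otimes> tw (A \<odot> X)) \<cdot> br (A \<odot> X) Y"
  proof -
    have "T = (Id Y \<otimes> ((tw A \<otimes> tw X) \<cdot> (br X A \<cdot> br A X))) \<cdot> br (A \<odot> X) Y"
      unfolding T_def cyclic_braid[OF assms(1-3)] by simp
    also have "(tw A \<otimes> tw X) \<cdot> (br X A \<cdot> br A X) = br X A \<cdot> ((tw X \<otimes> tw A) \<cdot> br A X)"
      by (rule comp_eq_tail2[OF br_nat[symmetric]]) simp_all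
    also have "(tw X \<otimes> tw A) \<cdot> br A X = br A X \<cdot> (tw A \<otimes> tw X)"
      by (rule br_nat[symmetric]) simp_all
    finally show ?thesis by (simp add: twist_tensor)
  qed
  have iT: "iso T"
  proof -
    show ?thesis
      unfolding T2
      by (rule iso_comp[of _ _ "A \<odot> X \<odot> Y" "Y \<odot> A \<odot> X" "Y \<odot> A \<odot> X"])
        (simp_all add: iso_tensor twist_iso iso_ident braiding_iso)
  qed
  have nat: "tw X \<cdot> l = l \<cdot> tw (A \<odot> X)"
    by (rule tw_nat) simp
  have "\<beta>' \<cdot> (l \<otimes> Id Y) = \<beta> \<cdot> (Id Y \<otimes> tw X) \<cdot> (br X Y \<cdot> (l \<otimes> Id Y))"
    unfolding \<beta>' by simp
  also have "br X Y \<cdot> (l \<otimes> Id Y) = (Id Y \<otimes> l) \<cdot> br (A \<odot> X) Y"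
    by (rule br_nat) simp_all
  also have "\<beta> \<cdot> (Id Y \<otimes> tw X) \<cdot> \<dots> = (\<beta> \<cdot> (Id Y \<otimes> l)) \<cdot> T"
    unfolding T2 by (simp add: nat)
  finally have 1: "\<beta>' \<cdot> (l \<otimes> Id Y) = (\<beta> \<cdot> (Id Y \<otimes> l)) \<cdot> T" .
  have "(\<beta>' \<cdot> (Id X \<otimes> (\<rho> \<cdot> (Id Y \<otimes> tw A)))) \<cdot> br A (X \<odot> Y)
      = \<beta> \<cdot> (Id Y \<otimes> tw X) \<cdot> ((br X Y \<cdot> (Id X \<otimes> (\<rho> \<cdot> (Id Y \<otimes> tw A)))) \<cdot> br A (X \<odot> Y))"
    unfolding \<beta>' by simp
  also have "br X Y \<cdot> (Id X \<otimes> (\<rho> \<cdot> (Id Y \<otimes> tw A))) = ((\<rho> \<cdot> (Id Y \<otimes> tw A)) \<otimes> Id X) \<cdot> br X (Y \<odot> A)"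
    by (rule br_nat) simp_all
  also have "\<beta> \<cdot> (Id Y \<otimes> tw X) \<cdot> (\<dots> \<cdot> br A (X \<odot> Y)) = (\<beta> \<cdot> (\<rho> \<otimes> Id X)) \<cdot> T"
    unfolding T_def by simp
  finally have 2: "(\<beta>' \<cdot> (Id X \<otimes> (\<rho> \<cdot> (Id Y \<otimes> tw A)))) \<cdot> br A (X \<odot> Y) = (\<beta> \<cdot> (\<rho> \<otimes> Id X)) \<cdot> T" .
  show ?thesis
    unfolding 1 2
  proof
    assume e: "(\<beta> \<cdot> (Id Y \<otimes> l)) \<cdot> T = (\<beta> \<cdot> (\<rho> \<otimes> Id X)) \<cdot> T"
    show "\<beta> \<cdot> (Id Y \<otimes> l) = \<beta> \<cdot> (\<rho> \<otimes> Id X)"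
      by (rule iso_cancel_right[OF iT T _ _ e, where W = \<one>]) simp_all
  qed (simp only:)
qed

end

section \<open>Symmetric special Frobenius algebras\<close>

locale frobenius_algebra = strict_linear_ribbon_category C
  for C :: "('o, 'm, 'k::field) ribbon_structure" (structure) +
  fixes A :: "('o, 'm, 'z) frobenius_scheme"
  assumes frobenius: "sym_special_frobenius A"
begin

abbreviation "X \<equiv> alg_ob A"
abbreviation "m \<equiv> mult A"
abbreviation "\<eta> \<equiv> unit A"

definition \<kappa> :: 'm where "\<kappa> = counit A \<cdot> m"
definition q :: 'm where "q = comult A \<cdot> \<eta>"

lemma algebra_ty [simp]:
  "X \<in> Ob C" "ty m = (X \<odot> X) \<rightarrowtail> X" "ty \<eta> = \<one> \<rightarrowtail> X" "ty (comult A) = X \<rightarrowtail> (X \<odot> X)" "ty (counit A) = X \<rightarrowtail> \<one>"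
  using frobenius by (simp_all add: sym_special_frobenius_def Let_def)

lemma form_ty [simp]: "ty \<kappa> = (X \<odot> X) \<rightarrowtail> \<one>" "ty q = \<one> \<rightarrowtail> (X \<odot> X)"
  by (simp_all add: \<kappa>_def q_def)

lemma algebra_laws:
  "m \<cdot> (m \<otimes> Id X) = m \<cdot> (Id X \<otimes> m)"
  "m \<cdot> (\<eta> \<otimes> Id X) = Id X" "m \<cdot> (Id X \<otimes> \<eta>) = Id X"
  using frobenius by (simp_all add: sym_special_frobenius_def Let_def)

lemma mult_assoc [simp]:
  assumes "ty a = U \<rightarrowtail> X" "ty b = V \<rightarrowtail> X" "ty c = W \<rightarrowtail> X"
  shows "m \<cdot> ((m \<cdot> (a \<otimes> b)) \<otimes> c) = m \<cdot> (a \<otimes> (m \<cdot> (b \<otimes> c)))"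
  using precomp[OF algebra_laws(1), of "a \<otimes> b \<otimes> c"] assms by simp

lemma mult_unit [simp]:
  assumes "ty a = U \<rightarrowtail> X"
  shows "m \<cdot> (\<eta> \<otimes> a) = a" "m \<cdot> (a \<otimes> \<eta>) = a"
proof -
  have "m \<cdot> (\<eta> \<otimes> a) = (m \<cdot> (\<eta> \<otimes> Id X)) \<cdot> a"
    using coscalar_tensor(1)[of \<eta> X a U X] assms by simp
  then show "m \<cdot> (\<eta> \<otimes> a) = a"
    using assms by (simp only: algebra_laws ident_rules)
  have "m \<cdot> (a \<otimes> \<eta>) = (m \<cdot> (Id X \<otimes> \<eta>)) \<cdot> a"
    using coscalar_tensor(2)[of \<eta> X a U X] assms by simp
  then show "m \<cdot> (a \<otimes> \<eta>) = a"
    using assms by (simp only: algebra_laws ident_rules)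
qed

text \<open>With \<open>q\<close> written as q1 \<otimes> q2, the Frobenius law says a q1 \<otimes>
  q2 = q1 \<otimes> q2 a. This is why tensoring over the algebra can be described by an
  idempotent.\<close>

lemma q_central: "(m \<otimes> Id X) \<cdot> (Id X \<otimes> q) = comult A" "(Id X \<otimes> m) \<cdot> (q \<otimes> Id X) = comult A"
proof -
  have f: "(Id X \<otimes> m) \<cdot> (comult A \<otimes> Id X) = comult A \<cdot> m" "comult A \<cdot> m = (m \<otimes> Id X) \<cdot> (Id X \<otimes> comult A)"
    using frobenius by (simp_all add: sym_special_frobenius_def Let_def)
  have "(m \<otimes> Id X) \<cdot> (Id X \<otimes> q) = ((m \<otimes> Id X) \<cdot> (Id X \<otimes> comult A)) \<cdot> (Id X \<otimes> \<eta>)"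
    by (simp add: q_def)
  also have "\<dots> = comult A" by (simp add: f(2)[symmetric])
  finally show "(m \<otimes> Id X) \<cdot> (Id X \<otimes> q) = comult A" .
  have "(Id X \<otimes> m) \<cdot> (q \<otimes> Id X) = ((Id X \<otimes> m) \<cdot> (comult A \<otimes> Id X)) \<cdot> (\<eta> \<otimes> Id X)"
    by (simp add: q_def)
  also have "\<dots> = comult A" by (simp add: f(1))
  finally show "(Id X \<otimes> m) \<cdot> (q \<otimes> Id X) = comult A" .
qed

lemma mult_q: "m \<cdot> q = \<eta>"
proof -
  have "m \<cdot> comult A = Id X"
    using frobenius by (simp add: sym_special_frobenius_def Let_def)
  then have "(m \<cdot> comult A) \<cdot> \<eta> = \<eta>" by simp
  then show ?thesis by (simp add: q_def)
qed

text \<open>By \<open>q_central\<close> both zigzags reduce to the counit laws, so the algebra is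
  its own dual.\<close>

lemma form_dual_pair: "dual_pair X X \<kappa> q"
proof -
  have f: "(counit A \<otimes> Id X) \<cdot> comult A = Id X" "(Id X \<otimes> counit A) \<cdot> comult A = Id X"
    using frobenius by (simp_all add: sym_special_frobenius_def Let_def)
  have "(\<kappa> \<otimes> Id X) \<cdot> (Id X \<otimes> q) = (counit A \<otimes> Id X) \<cdot> ((m \<otimes> Id X) \<cdot> (Id X \<otimes> q))"
    by (simp add: \<kappa>_def tensor_ident_comp(2) del: ich)
  moreover have "(Id X \<otimes> \<kappa>) \<cdot> (q \<otimes> Id X) = (Id X \<otimes> counit A) \<cdot> ((Id X \<otimes> m) \<cdot> (q \<otimes> Id X))"
    by (simp add: \<kappa>_def tensor_ident_comp(1) del: ich)
  ultimately show ?thesis by (simp add: dual_pair_def q_central f)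
qed

lemma form_assoc [simp]:
  assumes "ty a = U \<rightarrowtail> X" "ty b = V \<rightarrowtail> X" "ty c = W \<rightarrowtail> X"
  shows "\<kappa> \<cdot> ((m \<cdot> (a \<otimes> b)) \<otimes> c) = \<kappa> \<cdot> (a \<otimes> (m \<cdot> (b \<otimes> c)))"
  using assms by (simp add: \<kappa>_def)

text \<open>The symmetry axiom equates the two transposes \<Phi> of the form into
  \<open>du X\<close>. Evaluating them with the left and with the right duality, which differ by
  braiding and twist, gives a symmetry without duals.\<close>

lemma form_symmetric: "\<kappa> = \<kappa> \<cdot> (Id X \<otimes> tw X) \<cdot> br X X"
proof -
  let ?Y = "du X"
  define \<Phi> where "\<Phi> = (\<kappa> \<otimes> Id ?Y) \<cdot> (Id X \<otimes> cv X)"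
  have [simp]: "ty \<Phi> = X \<rightarrowtail> ?Y" by (simp add: \<Phi>_def)
  have \<Phi>2: "\<Phi> = (Id ?Y \<otimes> \<kappa>) \<cdot> (right_coev X \<otimes> Id X)"
    using frobenius by (simp add: sym_special_frobenius_def Let_def \<Phi>_def \<kappa>_def)
  have 1: "ev X \<cdot> (\<Phi> \<otimes> Id X) = \<kappa>"
    unfolding \<Phi>_def by (rule dual_pair_curry_left[OF left_dual_pair]) simp_all
  have "\<kappa> = right_ev X \<cdot> (Id X \<otimes> \<Phi>)"
    unfolding \<Phi>2 by (rule dual_pair_curry_right[OF right_dual_pair, symmetric]) simp_all
  also have "\<dots> = ev X \<cdot> (Id ?Y \<otimes> tw X) \<cdot> (br X ?Y \<cdot> (Id X \<otimes> \<Phi>))"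
    by (simp add: right_ev_eq)
  also have "br X ?Y \<cdot> (Id X \<otimes> \<Phi>) = (\<Phi> \<otimes> Id X) \<cdot> br X X"
    by (rule br_nat) simp_all
  also have "ev X \<cdot> (Id ?Y \<otimes> tw X) \<cdot> \<dots> = (ev X \<cdot> (\<Phi> \<otimes> Id X)) \<cdot> (Id X \<otimes> tw X) \<cdot> br X X"
    by simp
  finally show ?thesis unfolding 1 .
qed

text \<open>
  A form \<open>\<epsilon>'\<close> is \<open>\<kappa> \<cdot> (z \<otimes> _)\<close> for a central \<open>z\<close>, and specialness of the dual basis of \<open>\<epsilon>'\<close>
  forces \<open>z = \<eta>\<close>.
\<close>

lemma counit_unique:
  assumes [simp]: "ty \<epsilon>' = X \<rightarrowtail> \<one>" "ty q' = \<one> \<rightarrowtail> (X \<odot> X)"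
    and dual: "((\<epsilon>' \<cdot> m) \<otimes> Id X) \<cdot> (Id X \<otimes> q') = Id X" and special: "m \<cdot> q' = \<eta>"
    and sym: "\<epsilon>' \<cdot> m = \<epsilon>' \<cdot> m \<cdot> (Id X \<otimes> tw X) \<cdot> br X X"
  shows "\<epsilon>' = counit A"
proof -
  define z where "z = (\<epsilon>' \<otimes> Id X) \<cdot> q"
  have [simp]: "ty z = \<one> \<rightarrowtail> X" by (simp add: z_def)
  have "\<kappa> \<cdot> (((\<epsilon>' \<otimes> Id X) \<cdot> (Id \<one> \<otimes> q)) \<otimes> Id X) = \<epsilon>'"
    by (rule dual_pair_curry_left[OF form_dual_pair]) simp_all
  then have z1: "\<kappa> \<cdot> (z \<otimes> Id X) = \<epsilon>'" by (simp add: z_def)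
  have z: "\<epsilon>' \<cdot> a = \<kappa> \<cdot> (z \<otimes> a)" if "ty a = U \<rightarrowtail> X" for a U
    using z1[symmetric] that coscalar_tensor(1)[of z X a U X] by simp
  have "\<kappa> \<cdot> ((m \<cdot> (z \<otimes> Id X)) \<otimes> Id X) = \<epsilon>' \<cdot> m"
    using z[of m "X \<odot> X"] by simp
  also have "\<dots> = (\<epsilon>' \<cdot> m) \<cdot> (Id X \<otimes> tw X) \<cdot> br X X"
    by (fact sym)
  also have "\<epsilon>' \<cdot> m = \<kappa> \<cdot> ((m \<cdot> (z \<otimes> Id X)) \<otimes> Id X)"
    using z[of m "X \<odot> X"] by simp
  also have "\<dots> \<cdot> (Id X \<otimes> tw X) \<cdot> br X X = \<kappa> \<cdot> (Id X \<otimes> tw X) \<cdot> (((m \<cdot> (z \<otimes> Id X)) \<otimes> Id X) \<cdot> br X X)"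
    by (simp del: form_assoc mult_assoc)
  also have "((m \<cdot> (z \<otimes> Id X)) \<otimes> Id X) \<cdot> br X X = br X X \<cdot> (Id X \<otimes> (m \<cdot> (z \<otimes> Id X)))"
    by (rule br_nat[symmetric]) simp_all
  also have "\<kappa> \<cdot> (Id X \<otimes> tw X) \<cdot> \<dots> = (\<kappa> \<cdot> (Id X \<otimes> tw X) \<cdot> br X X) \<cdot> (Id X \<otimes> (m \<cdot> (z \<otimes> Id X)))"
    by simp
  also have "\<dots> = \<kappa> \<cdot> (Id X \<otimes> (m \<cdot> (z \<otimes> Id X)))"
    unfolding form_symmetric[symmetric] ..
  also have "\<dots> = \<kappa> \<cdot> ((m \<cdot> (Id X \<otimes> z)) \<otimes> Id X)"
    by (simp del: interchange)
  finally have t: "\<kappa> \<cdot> ((m \<cdot> (z \<otimes> Id X)) \<otimes> Id X) = \<kappa> \<cdot> ((m \<cdot> (Id X \<otimes> z)) \<otimes> Id X)" .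
  have zc0: "m \<cdot> (z \<otimes> Id X) = m \<cdot> (Id X \<otimes> z)"
    by (rule dual_pair_test_left[OF form_dual_pair _ _ t, of X]) simp_all
  \<comment> \<open>The zigzag for \<epsilon>' says that \<open>q'\<close> with its first leg
    multiplied by \<open>z\<close> is a copairing for \<kappa>. Copairings are unique, so it equals
    \<open>q\<close>; multiplying its two legs together then gives \<eta> =
    \<open>z\<close>.\<close>
  have "Id X = ((\<kappa> \<cdot> (m \<otimes> Id X) \<cdot> (Id X \<otimes> z \<otimes> Id X)) \<otimes> Id X) \<cdot> (Id X \<otimes> q')"
  proof -
    have "\<epsilon>' \<cdot> m = \<kappa> \<cdot> (z \<otimes> m)" by (rule z) simp
    also have "\<dots> = \<kappa> \<cdot> ((m \<cdot> (z \<otimes> Id X)) \<otimes> Id X)" by simp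
    also have "m \<cdot> (z \<otimes> Id X) = m \<cdot> (Id X \<otimes> z)" by (fact zc0)
    finally show ?thesis using dual by simp
  qed
  also have "\<dots> = ((\<kappa> \<cdot> (Id X \<otimes> (m \<cdot> (z \<otimes> Id X)))) \<otimes> Id X) \<cdot> (Id X \<otimes> q')"
    by simp
  also have "\<dots> = (\<kappa> \<otimes> Id X) \<cdot> (Id X \<otimes> (((m \<cdot> (z \<otimes> Id X)) \<otimes> Id X) \<cdot> q'))"
    by (simp add: tensor_ident_comp del: ich)
  finally have "(Id X \<otimes> Id X) \<cdot> q = (Id X \<otimes> ((\<kappa> \<otimes> Id X) \<cdot> (Id X \<otimes> (((m \<cdot> (z \<otimes> Id X)) \<otimes> Id X) \<cdot> q')))) \<cdot> q"
    by (simp only:)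
  also have "\<dots> = (Id X \<otimes> \<kappa> \<otimes> Id X) \<cdot> ((Id X \<otimes> Id X \<otimes> (((m \<cdot> (z \<otimes> Id X)) \<otimes> Id X) \<cdot> q')) \<cdot> q)"
    by (simp add: tensor_ident_comp(1) del: ich tensor_rules(4))
  also have "(Id X \<otimes> Id X \<otimes> (((m \<cdot> (z \<otimes> Id X)) \<otimes> Id X) \<cdot> q')) \<cdot> q = q \<otimes> (((m \<cdot> (z \<otimes> Id X)) \<otimes> Id X) \<cdot> q')"
    using coscalar_tensor(2)[of "((m \<cdot> (z \<otimes> Id X)) \<otimes> Id X) \<cdot> q'" "X \<odot> X" q \<one> "X \<odot> X"] by (simp add: ident_tensor_split)
  also have "(Id X \<otimes> \<kappa> \<otimes> Id X) \<cdot> \<dots> = ((((Id X \<otimes> \<kappa>) \<cdot> (q \<otimes> Id X))) \<otimes> Id X) \<cdot> (((m \<cdot> (z \<otimes> Id X)) \<otimes> Id X) \<cdot> q')"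
    using coscalar_tensor(1)[of q "X \<odot> X" "((m \<cdot> (z \<otimes> Id X)) \<otimes> Id X) \<cdot> q'" \<one> "X \<odot> X"]
    by (simp add: ident_tensor_split split_ident del: tensor_rules(4))
  also have "\<dots> = ((m \<cdot> (z \<otimes> Id X)) \<otimes> Id X) \<cdot> q'"
    using form_dual_pair by (simp add: dual_pair_def)
  finally have "m \<cdot> q = m \<cdot> (((m \<cdot> (z \<otimes> Id X)) \<otimes> Id X) \<cdot> q')" by simp
  also have "\<dots> = (m \<cdot> (z \<otimes> Id X)) \<cdot> (m \<cdot> q')"
  proof -
    have "m \<cdot> ((m \<cdot> (z \<otimes> Id X)) \<otimes> Id X) = (m \<cdot> (z \<otimes> Id X)) \<cdot> m"
      using coscalar_tensor(1)[of z X m "X \<odot> X" X, symmetric] by simp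
    then have "m \<cdot> (((m \<cdot> (z \<otimes> Id X)) \<otimes> Id X) \<cdot> q') = ((m \<cdot> (z \<otimes> Id X)) \<cdot> m) \<cdot> q'"
      by (rule comp_eq_tail) simp_all
    then show ?thesis by simp
  qed
  finally have "\<eta> = z"
    unfolding special mult_q using coscalar_tensor(1)[of z X \<eta> \<one> X, symmetric] by simp
  then have "z = \<eta>" by (rule HOL.sym)
  then show ?thesis using z1 by (simp add: \<kappa>_def)
qed

section \<open>Tensor products over a Frobenius algebra\<close>

lemma tensor_over_ty [simp]:
  assumes "ty \<rho> = (N \<odot> X) \<rightarrowtail> N" "ty l = (X \<odot> M) \<rightarrowtail> M" "N \<in> Ob C" "M \<in> Ob C"
  shows "ty (tensor_over A N \<rho> M l) = (N \<odot> M) \<rightarrowtail> (N \<odot> M)"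
  using assms by (simp add: tensor_over_def)

lemma tensor_over_q: "tensor_over A N \<rho> M l = (\<rho> \<otimes> l) \<cdot> (Id N \<otimes> q \<otimes> Id M)"
  by (simp add: tensor_over_def q_def)

text \<open>In elements f(n q1 \<otimes> q2 x) = f(n q1 q2 \<otimes> x), and q1 q2 is the unit by
  specialness. The spectator strands \<open>V\<close> and \<open>W\<close> serve products of several
  factors, where the idempotent sits in the middle.\<close>

lemma balanced_tensor_over_whisker:
  assumes N: "right_module A N \<rho>" and M: "left_module A M l"
    and [simp]: "ty f = (V \<odot> N \<odot> M \<odot> W) \<rightarrowtail> Z" "V \<in> Ob C" "W \<in> Ob C"
    and bal: "f \<cdot> (Id V \<otimes> \<rho> \<otimes> Id M \<otimes> Id W) = f \<cdot> (Id V \<otimes> Id N \<otimes> l \<otimes> Id W)"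
  shows "f \<cdot> (Id V \<otimes> tensor_over A N \<rho> M l \<otimes> Id W) = f"
proof -
  have [simp]: "N \<in> Ob C" "M \<in> Ob C" "ty \<rho> = (N \<odot> X) \<rightarrowtail> N" "ty l = (X \<odot> M) \<rightarrowtail> M"
    using N M by (simp_all add: left_module_def right_module_def)
  have "f \<cdot> (Id V \<otimes> \<rho> \<otimes> l \<otimes> Id W) = (f \<cdot> (Id V \<otimes> Id N \<otimes> l \<otimes> Id W)) \<cdot> (Id V \<otimes> \<rho> \<otimes> Id X \<otimes> Id M \<otimes> Id W)"
    by (simp del: tensor_rules(4)) simp
  also have "\<dots> = f \<cdot> (Id V \<otimes> (\<rho> \<cdot> (\<rho> \<otimes> Id X)) \<otimes> Id M \<otimes> Id W)"
    unfolding bal[symmetric] by (simp del: tensor_rules(4))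
  also have "\<rho> \<cdot> (\<rho> \<otimes> Id X) = \<rho> \<cdot> (Id N \<otimes> m)"
    using N by (simp add: right_module_def)
  finally have 1: "f \<cdot> (Id V \<otimes> \<rho> \<otimes> l \<otimes> Id W) = f \<cdot> (Id V \<otimes> (\<rho> \<cdot> (Id N \<otimes> m)) \<otimes> Id M \<otimes> Id W)" .
  have "Id V \<otimes> tensor_over A N \<rho> M l \<otimes> Id W = (Id V \<otimes> \<rho> \<otimes> l \<otimes> Id W) \<cdot> (Id V \<otimes> Id N \<otimes> q \<otimes> Id M \<otimes> Id W)"
    by (simp add: tensor_over_q del: tensor_rules(4))
  then have "f \<cdot> (Id V \<otimes> tensor_over A N \<rho> M l \<otimes> Id W) =
      (f \<cdot> (Id V \<otimes> \<rho> \<otimes> l \<otimes> Id W)) \<cdot> (Id V \<otimes> Id N \<otimes> q \<otimes> Id M \<otimes> Id W)"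
    by (simp del: ich)
  also have "\<dots> = f \<cdot> (Id V \<otimes> (\<rho> \<cdot> (Id N \<otimes> (m \<cdot> q))) \<otimes> Id M \<otimes> Id W)"
    unfolding 1 by (simp del: tensor_rules(4))
  also have "\<rho> \<cdot> (Id N \<otimes> (m \<cdot> q)) = Id N"
    using N by (simp add: mult_q right_module_def)
  finally show ?thesis by simp
qed

lemma balanced_tensor_over:
  assumes "right_module A N \<rho>" "left_module A M l"
    and "ty f = (N \<odot> M) \<rightarrowtail> Z" and "f \<cdot> (\<rho> \<otimes> Id M) = f \<cdot> (Id N \<otimes> l)"
  shows "f \<cdot> tensor_over A N \<rho> M l = f"
proof -
  have "N \<in> Ob C" "M \<in> Ob C" "ty \<rho> = (N \<odot> X) \<rightarrowtail> N" "ty l = (X \<odot> M) \<rightarrowtail> M"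
    using assms by (simp_all add: left_module_def right_module_def)
  then show ?thesis
    using balanced_tensor_over_whisker[OF assms(1,2), of f \<one> \<one> Z] assms(3,4) by simp
qed

text \<open>An algebra element passes through the idempotent: n a q1 \<otimes> q2 x = n q1 \<otimes>
  q2 a x by \<open>q_central\<close>.\<close>

lemma tensor_over_balanced:
  assumes N: "right_module A N \<rho>" and M: "left_module A M l"
  shows "tensor_over A N \<rho> M l \<cdot> (\<rho> \<otimes> Id M) = tensor_over A N \<rho> M l \<cdot> (Id N \<otimes> l)"
proof -
  have [simp]: "N \<in> Ob C" "M \<in> Ob C" "ty \<rho> = (N \<odot> X) \<rightarrowtail> N" "ty l = (X \<odot> M) \<rightarrowtail> M"
    using N M by (simp_all add: left_module_def right_module_def)
  have q1: "(Id N \<otimes> q \<otimes> Id M) \<cdot> (\<rho> \<otimes> Id M) = (\<rho> \<otimes> Id X \<otimes> Id X \<otimes> Id M) \<cdot> (Id N \<otimes> Id X \<otimes> q \<otimes> Id M)"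
    using coscalar_tensor(2)[of q "X \<odot> X" \<rho> "N \<odot> X" N, symmetric] by simp
  have q2: "(Id N \<otimes> q \<otimes> Id M) \<cdot> (Id N \<otimes> l) = (Id N \<otimes> Id X \<otimes> Id X \<otimes> l) \<cdot> (Id N \<otimes> q \<otimes> Id X \<otimes> Id M)"
    using coscalar_tensor(1)[of q "X \<odot> X" l "X \<odot> M" M, symmetric] by simp
  have "tensor_over A N \<rho> M l \<cdot> (\<rho> \<otimes> Id M) = (\<rho> \<otimes> l) \<cdot> ((Id N \<otimes> q \<otimes> Id M) \<cdot> (\<rho> \<otimes> Id M))"
    unfolding tensor_over_q by (simp del: ich)
  also have "\<dots> = ((\<rho> \<cdot> (\<rho> \<otimes> Id X)) \<otimes> l) \<cdot> (Id N \<otimes> Id X \<otimes> q \<otimes> Id M)"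
  proof -
    have "(\<rho> \<otimes> l) \<cdot> (\<rho> \<otimes> Id X \<otimes> Id X \<otimes> Id M) = (\<rho> \<cdot> (\<rho> \<otimes> Id X)) \<otimes> l"
      by (simp del: tensor_rules(4)) simp
    then show ?thesis unfolding q1 by (rule comp_eq_tail) simp_all
  qed
  also have "\<rho> \<cdot> (\<rho> \<otimes> Id X) = \<rho> \<cdot> (Id N \<otimes> m)"
    using N by (simp add: right_module_def)
  also have "((\<rho> \<cdot> (Id N \<otimes> m)) \<otimes> l) \<cdot> (Id N \<otimes> Id X \<otimes> q \<otimes> Id M) =
      (\<rho> \<otimes> l) \<cdot> (Id N \<otimes> ((m \<otimes> Id X) \<cdot> (Id X \<otimes> q)) \<otimes> Id M)"
  proof -
    have e: "Id N \<otimes> ((m \<otimes> Id X) \<cdot> (Id X \<otimes> q)) \<otimes> Id M = (Id N \<otimes> m \<otimes> Id X \<otimes> Id M) \<cdot> (Id N \<otimes> Id X \<otimes> q \<otimes> Id M)"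
      by (simp del: tensor_rules(4))
    have "(\<rho> \<otimes> l) \<cdot> (Id N \<otimes> m \<otimes> Id X \<otimes> Id M) = (\<rho> \<cdot> (Id N \<otimes> m)) \<otimes> l"
      by (simp del: tensor_rules(4)) simp
    then show ?thesis unfolding e by (intro comp_eq_tail[symmetric]) simp_all
  qed
  also have "(m \<otimes> Id X) \<cdot> (Id X \<otimes> q) = (Id X \<otimes> m) \<cdot> (q \<otimes> Id X)"
    by (simp only: q_central)
  also have "(\<rho> \<otimes> l) \<cdot> (Id N \<otimes> ((Id X \<otimes> m) \<cdot> (q \<otimes> Id X)) \<otimes> Id M)
      = (\<rho> \<otimes> (l \<cdot> (m \<otimes> Id M))) \<cdot> (Id N \<otimes> q \<otimes> Id X \<otimes> Id M)"
  proof -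
    have e: "Id N \<otimes> ((Id X \<otimes> m) \<cdot> (q \<otimes> Id X)) \<otimes> Id M = (Id N \<otimes> Id X \<otimes> m \<otimes> Id M) \<cdot> (Id N \<otimes> q \<otimes> Id X \<otimes> Id M)"
      by (simp del: tensor_rules(4))
    have "(\<rho> \<otimes> l) \<cdot> (Id N \<otimes> Id X \<otimes> m \<otimes> Id M) = \<rho> \<otimes> (l \<cdot> (m \<otimes> Id M))"
      by (simp del: tensor_rules(4)) simp
    then show ?thesis unfolding e by (intro comp_eq_tail) simp_all
  qed
  also have "l \<cdot> (m \<otimes> Id M) = l \<cdot> (Id X \<otimes> l)"
    using M by (simp add: left_module_def)
  also have "(\<rho> \<otimes> (l \<cdot> (Id X \<otimes> l))) \<cdot> (Id N \<otimes> q \<otimes> Id X \<otimes> Id M) = (\<rho> \<otimes> l) \<cdot> ((Id N \<otimes> Id X \<otimes> Id X \<otimes> l) \<cdot> (Id N \<otimes> q \<otimes> Id X \<otimes> Id M))"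
  proof -
    have "(\<rho> \<otimes> l) \<cdot> (Id N \<otimes> Id X \<otimes> Id X \<otimes> l) = \<rho> \<otimes> (l \<cdot> (Id X \<otimes> l))"
      by (simp del: tensor_rules(4)) simp
    then show ?thesis by (intro comp_eq_tail[symmetric]) simp_all
  qed
  also have "\<dots> = tensor_over A N \<rho> M l \<cdot> (Id N \<otimes> l)"
    unfolding q2[symmetric] tensor_over_q by (simp del: ich)
  finally show ?thesis .
qed

lemma splits_balanced:
  assumes N: "right_module A N \<rho>" and M: "left_module A M l"
    and s: "splits (N \<odot> M) (tensor_over A N \<rho> M l) E e r"
  shows "r \<cdot> tensor_over A N \<rho> M l = r" "r \<cdot> (\<rho> \<otimes> Id M) = r \<cdot> (Id N \<otimes> l)"
proof -
  have [simp]: "N \<in> Ob C" "M \<in> Ob C" "ty \<rho> = (N \<odot> X) \<rightarrowtail> N" "ty l = (X \<odot> M) \<rightarrowtail> M"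
    using N M by (simp_all add: left_module_def right_module_def)
  have [simp]: "ty e = E \<rightarrowtail> (N \<odot> M)" "ty r = (N \<odot> M) \<rightarrowtail> E" and
    re: "r \<cdot> e = Id E" and er: "e \<cdot> r = tensor_over A N \<rho> M l"
    using s by (simp_all add: splits_def)
  have "r \<cdot> (e \<cdot> r) = Id E \<cdot> r"
    by (rule comp_eq_tail[OF re]) simp_all
  then show rP: "r \<cdot> tensor_over A N \<rho> M l = r" by (simp add: er)
  have "r \<cdot> (\<rho> \<otimes> Id M) = r \<cdot> (tensor_over A N \<rho> M l \<cdot> (\<rho> \<otimes> Id M))"
    by (rule comp_eq_tail[OF rP, symmetric]) simp_all
  also have "\<dots> = r \<cdot> (tensor_over A N \<rho> M l \<cdot> (Id N \<otimes> l))"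
    by (simp only: tensor_over_balanced[OF N M])
  also have "\<dots> = r \<cdot> (Id N \<otimes> l)"
    by (rule comp_eq_tail[OF rP]) simp_all
  finally show "r \<cdot> (\<rho> \<otimes> Id M) = r \<cdot> (Id N \<otimes> l)" .
qed

text \<open>The universal property of the tensor product: a balanced arrow factors through
  \<open>r\<close>, with \<open>f \<cdot> e\<close> as the induced arrow.\<close>

lemma balanced_factor:
  assumes N: "right_module A N \<rho>" and M: "left_module A M l"
    and s: "splits (N \<odot> M) (tensor_over A N \<rho> M l) E e r"
    and f: "ty f = (N \<odot> M) \<rightarrowtail> Z" and bal: "f \<cdot> (\<rho> \<otimes> Id M) = f \<cdot> (Id N \<otimes> l)"
  shows "f \<cdot> (e \<cdot> r) = f"
  using balanced_tensor_over[OF N M f bal] s by (simp add: splits_def)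

text \<open>If \<open>h\<close> is the algebra-valued lift of the scalar form \<beta>, contracting
  the idempotent with \<beta> gives \<kappa>(h(x, n), q1) q2 y = h(x, n) y, because \<open>q\<close>
  is the copairing of \<kappa>. So the scalar pairing on representatives computes the action through
  \<open>h\<close>.\<close>

lemma tensor_over_pairing:
  assumes N: "right_module A N \<rho>" and M: "left_module A M l"
    and [simp]: "ty \<beta> = (M \<odot> N) \<rightarrowtail> \<one>" "ty h = (M \<odot> N) \<rightarrowtail> X"
  shows "\<kappa> \<cdot> (h \<otimes> Id X) = \<beta> \<cdot> (Id M \<otimes> \<rho>) \<Longrightarrow>
      (\<beta> \<otimes> Id M) \<cdot> (Id M \<otimes> tensor_over A N \<rho> M l) = l \<cdot> (h \<otimes> Id M)"
    and "\<kappa> \<cdot> (Id X \<otimes> h) = \<beta> \<cdot> (l \<otimes> Id N) \<Longrightarrow>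
      (Id N \<otimes> \<beta>) \<cdot> (tensor_over A N \<rho> M l \<otimes> Id N) = \<rho> \<cdot> (Id N \<otimes> h)"
proof -
  have [simp]: "N \<in> Ob C" "M \<in> Ob C" "ty \<rho> = (N \<odot> X) \<rightarrowtail> N" "ty l = (X \<odot> M) \<rightarrowtail> M"
    using N M by (simp_all add: left_module_def right_module_def)
  show "(\<beta> \<otimes> Id M) \<cdot> (Id M \<otimes> tensor_over A N \<rho> M l) = l \<cdot> (h \<otimes> Id M)"
    if h: "\<kappa> \<cdot> (h \<otimes> Id X) = \<beta> \<cdot> (Id M \<otimes> \<rho>)"
  proof -
    have e: "Id M \<otimes> tensor_over A N \<rho> M l = (Id M \<otimes> \<rho> \<otimes> l) \<cdot> (Id M \<otimes> Id N \<otimes> q \<otimes> Id M)"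
      by (simp add: tensor_over_q del: tensor_rules(4))
    have "(\<beta> \<otimes> Id M) \<cdot> (Id M \<otimes> tensor_over A N \<rho> M l) = ((\<beta> \<cdot> (Id M \<otimes> \<rho>)) \<otimes> l) \<cdot> (Id M \<otimes> Id N \<otimes> q \<otimes> Id M)"
      unfolding e by (rule comp_eq_tail) simp_all
    also have "\<dots> = l \<cdot> (((((\<kappa> \<cdot> (h \<otimes> Id X)) \<otimes> Id X) \<cdot> (Id M \<otimes> Id N \<otimes> q))) \<otimes> Id M)"
      using scalar_tensor(1)[of "\<beta> \<cdot> (Id M \<otimes> \<rho>)" "M \<odot> N \<odot> X" l "X \<odot> M" M]
      by (simp add: h split_ident del: tensor_rules(4))
    also have "((\<kappa> \<cdot> (h \<otimes> Id X)) \<otimes> Id X) \<cdot> (Id M \<otimes> Id N \<otimes> q) = h"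
      using dual_pair_transpose_left[OF form_dual_pair, of h "M \<odot> N"] by (simp add: ident_tensor_split)
    finally show ?thesis .
  qed
  show "(Id N \<otimes> \<beta>) \<cdot> (tensor_over A N \<rho> M l \<otimes> Id N) = \<rho> \<cdot> (Id N \<otimes> h)"
    if h: "\<kappa> \<cdot> (Id X \<otimes> h) = \<beta> \<cdot> (l \<otimes> Id N)"
  proof -
    have e: "tensor_over A N \<rho> M l \<otimes> Id N = (\<rho> \<otimes> l \<otimes> Id N) \<cdot> (Id N \<otimes> q \<otimes> Id M \<otimes> Id N)"
      by (simp add: tensor_over_q del: tensor_rules(4))
    have "(Id N \<otimes> \<beta>) \<cdot> (tensor_over A N \<rho> M l \<otimes> Id N) = (\<rho> \<otimes> (\<beta> \<cdot> (l \<otimes> Id N))) \<cdot> (Id N \<otimes> q \<otimes> Id M \<otimes> Id N)"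
      unfolding e by (rule comp_eq_tail) simp_all
    also have "\<dots> = \<rho> \<cdot> (Id N \<otimes> ((Id X \<otimes> (\<kappa> \<cdot> (Id X \<otimes> h))) \<cdot> (q \<otimes> Id M \<otimes> Id N)))"
      using scalar_tensor(2)[of "\<beta> \<cdot> (l \<otimes> Id N)" "X \<odot> M \<odot> N" \<rho> "N \<odot> X" N]
      by (simp add: h split_ident del: tensor_rules(4))
    also have "(Id X \<otimes> (\<kappa> \<cdot> (Id X \<otimes> h))) \<cdot> (q \<otimes> Id M \<otimes> Id N) = h"
      using dual_pair_transpose_right[OF form_dual_pair, of h "M \<odot> N"] by (simp add: ident_tensor_split)
    finally show ?thesis .
  qed
qed

end

section \<open>Reversions\<close>

locale jandl = frobenius_algebra C A
  for C :: "('o, 'm, 'k::field) ribbon_structure" (structure) and A :: "('o, 'm) jandl" +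
  assumes jandl: "jandl_algebra A"
begin

abbreviation "\<sigma> \<equiv> reversion A"

lemma reversion_ty [simp]: "ty \<sigma> = X \<rightarrowtail> X"
  using jandl by (simp add: jandl_algebra_def Let_def)

lemma reversion_laws:
  "\<sigma> \<cdot> \<eta> = \<eta>" "\<sigma> \<cdot> m = m \<cdot> br X X \<cdot> (\<sigma> \<otimes> \<sigma>)" "\<sigma> \<cdot> \<sigma> = tw X"
  using jandl by (simp_all add: jandl_algebra_def Let_def)

lemma reversion_iso: "iso \<sigma>"
proof -
  obtain t where t: "ty t = X \<rightarrowtail> X" "t \<cdot> tw X = Id X" "tw X \<cdot> t = Id X"
    using isoE[OF twist_iso[of X]] ob_arrow_ty(2)[of X] by (metis algebra_ty(1) ty_inject)
  have "\<sigma> \<cdot> t = t \<cdot> \<sigma>"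
  proof -
    have "\<sigma> \<cdot> t = (t \<cdot> tw X) \<cdot> (\<sigma> \<cdot> t)" using t by simp
    also have "\<dots> = t \<cdot> ((tw X \<cdot> \<sigma>) \<cdot> t)" using t(1) by simp
    also have "tw X \<cdot> \<sigma> = \<sigma> \<cdot> tw X" by (rule tw_nat) simp
    also have "t \<cdot> ((\<sigma> \<cdot> tw X) \<cdot> t) = t \<cdot> \<sigma>" using t by simp
    finally show ?thesis .
  qed
  moreover have "\<sigma> \<cdot> (\<sigma> \<cdot> t) = tw X \<cdot> t"
    by (rule comp_eq_tail[OF reversion_laws(3)]) (use t in simp_all)
  ultimately show ?thesis
    using t reversion_laws(3) by (intro isoI[of _ X X "\<sigma> \<cdot> t"]) simp_all
qed

text \<open>The form of the counit composed with \<sigma> is the given form read in the opposite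
  order. It is again symmetric, with a special copairing, so \<open>counit_unique\<close>
  applies.\<close>

lemma counit_reversion: "counit A \<cdot> \<sigma> = counit A"
proof -
  obtain s where s [simp]: "ty s = X \<rightarrowtail> X" "s \<cdot> \<sigma> = Id X" "\<sigma> \<cdot> s = Id X"
    using isoE[OF reversion_iso] by (metis reversion_ty ty_inject)
  obtain b where [simp]: "ty b = (X \<odot> X) \<rightarrowtail> (X \<odot> X)" and b: "b \<cdot> br X X = Id (X \<odot> X)" "br X X \<cdot> b = Id (X \<odot> X)"
    using isoE[OF braiding_iso[of X X]] by (metis algebra_ty(1) br_ty ty_inject)
  \<comment> \<open>\<open>p\<close> is the copairing for the form read in the opposite order;
    applying the inverse of \<sigma> to both of its legs gives the copairing needed for the counit
    composed with \<sigma>.\<close>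
  define p where "p = b \<cdot> q"
  have [simp]: "ty p = \<one> \<rightarrowtail> (X \<odot> X)" by (simp add: p_def)
  have p: "br X X \<cdot> p = q"
    unfolding p_def using comp_eq_tail[OF b(2), of q \<one> "X \<odot> X" "X \<odot> X"] by simp
  have \<kappa>': "(counit A \<cdot> \<sigma>) \<cdot> m = \<kappa> \<cdot> br X X \<cdot> (\<sigma> \<otimes> \<sigma>)"
    by (simp add: \<kappa>_def reversion_laws(2))
  have F: "((\<kappa> \<cdot> br X X) \<otimes> Id X) \<cdot> (Id X \<otimes> p) = Id X"
  proof -
    have "((\<kappa> \<cdot> br X X) \<otimes> Id X) \<cdot> (Id X \<otimes> p) = (\<kappa> \<otimes> Id X) \<cdot> ((br X X \<otimes> Id X) \<cdot> (Id X \<otimes> p))"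
      by (simp add: tensor_ident_comp(2) del: ich)
    also have "\<kappa> \<otimes> Id X = (Id X \<otimes> \<kappa>) \<cdot> br (X \<odot> X) X"
      using slide_scalar(1)[of \<kappa> "X \<odot> X" X] by simp
    also have "\<dots> \<cdot> ((br X X \<otimes> Id X) \<cdot> (Id X \<otimes> p)) = (Id X \<otimes> \<kappa>) \<cdot> ((br (X \<odot> X) X \<cdot> (br X X \<otimes> Id X)) \<cdot> (Id X \<otimes> p))"
      by (simp del: ich)
    also have "br (X \<odot> X) X \<cdot> (br X X \<otimes> Id X) = (Id X \<otimes> br X X) \<cdot> br (X \<odot> X) X"
      by (rule br_nat) simp_all
    also have "\<dots> = br X (X \<odot> X) \<cdot> (Id X \<otimes> br X X)"
      by (simp add: braiding_tensor_left braiding_tensor_right)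
    also have "\<dots> \<cdot> (Id X \<otimes> p) = br X (X \<odot> X) \<cdot> (Id X \<otimes> q)"
      by (simp add: p)
    also have "\<dots> = q \<otimes> Id X"
      by (rule slide_coscalar) simp_all
    finally show ?thesis using form_dual_pair by (simp add: dual_pair_def)
  qed
  show ?thesis
  proof (rule counit_unique[where q' = "(s \<otimes> s) \<cdot> p"])
    have "(((counit A \<cdot> \<sigma>) \<cdot> m) \<otimes> Id X) \<cdot> (Id X \<otimes> ((s \<otimes> s) \<cdot> p))
        = ((\<kappa> \<cdot> br X X) \<otimes> Id X) \<cdot> ((\<sigma> \<otimes> \<sigma> \<otimes> Id X) \<cdot> (Id X \<otimes> s \<otimes> s)) \<cdot> (Id X \<otimes> p)"
      unfolding \<kappa>' by (simp add: tensor_ident_comp del: ich) 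
    also have "(\<sigma> \<otimes> \<sigma> \<otimes> Id X) \<cdot> (Id X \<otimes> s \<otimes> s) = (Id X \<otimes> Id X \<otimes> s) \<cdot> (\<sigma> \<otimes> Id X \<otimes> Id X)"
      by (simp del: tensor_rules(4))
    also have "((\<kappa> \<cdot> br X X) \<otimes> Id X) \<cdot> \<dots> \<cdot> (Id X \<otimes> p) = s \<cdot> (((\<kappa> \<cdot> br X X) \<otimes> Id X) \<cdot> (Id X \<otimes> p)) \<cdot> \<sigma>"
      using scalar_tensor(1)[of "\<kappa> \<cdot> br X X" "X \<odot> X" s X X] coscalar_tensor(2)[of p "X \<odot> X" \<sigma> X X]
      by simp
    finally show "(((counit A \<cdot> \<sigma>) \<cdot> m) \<otimes> Id X) \<cdot> (Id X \<otimes> ((s \<otimes> s) \<cdot> p)) = Id X"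
      unfolding F by simp
    have "\<sigma> \<cdot> (m \<cdot> ((s \<otimes> s) \<cdot> p)) = (\<sigma> \<cdot> m) \<cdot> ((s \<otimes> s) \<cdot> p)"
      by simp
    also have "\<dots> = m \<cdot> (br X X \<cdot> p)"
      unfolding reversion_laws(2) by simp
    also have "\<dots> = \<sigma> \<cdot> \<eta>" by (simp add: p mult_q reversion_laws(1))
    finally show "m \<cdot> ((s \<otimes> s) \<cdot> p) = \<eta>"
      using iso_cancel_left[OF reversion_iso reversion_ty, of "m \<cdot> ((s \<otimes> s) \<cdot> p)" \<one> \<eta>] by simp
    have "(\<kappa> \<cdot> br X X \<cdot> (\<sigma> \<otimes> \<sigma>)) \<cdot> (Id X \<otimes> tw X) \<cdot> br X X = \<kappa> \<cdot> br X X \<cdot> ((\<sigma> \<otimes> (\<sigma> \<cdot> tw X)) \<cdot> br X X)"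
      by simp
    also have "\<sigma> \<cdot> tw X = tw X \<cdot> \<sigma>" by (rule tw_nat[symmetric]) simp
    also have "(\<sigma> \<otimes> (tw X \<cdot> \<sigma>)) \<cdot> br X X = (Id X \<otimes> tw X) \<cdot> ((\<sigma> \<otimes> \<sigma>) \<cdot> br X X)"
      by simp
    also have "(\<sigma> \<otimes> \<sigma>) \<cdot> br X X = br X X \<cdot> (\<sigma> \<otimes> \<sigma>)"
      by (rule br_nat[symmetric]) simp_all
    also have "\<kappa> \<cdot> br X X \<cdot> ((Id X \<otimes> tw X) \<cdot> \<dots>) = \<kappa> \<cdot> ((br X X \<cdot> (Id X \<otimes> tw X)) \<cdot> (br X X \<cdot> (\<sigma> \<otimes> \<sigma>)))"
      by (simp del: ich)
    also have "br X X \<cdot> (Id X \<otimes> tw X) = (tw X \<otimes> Id X) \<cdot> br X X"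
      by (rule br_nat) simp_all
    also have "\<kappa> \<cdot> (\<dots> \<cdot> (br X X \<cdot> (\<sigma> \<otimes> \<sigma>))) = (\<kappa> \<cdot> (tw X \<otimes> Id X)) \<cdot> (br X X \<cdot> (br X X \<cdot> (\<sigma> \<otimes> \<sigma>)))"
      by (simp del: ich)
    also have "\<kappa> \<cdot> (tw X \<otimes> Id X) = \<kappa> \<cdot> (Id X \<otimes> tw X)"
      by (rule pairing_tw) simp_all
    also have "\<dots> \<cdot> (br X X \<cdot> (br X X \<cdot> (\<sigma> \<otimes> \<sigma>))) = (\<kappa> \<cdot> (Id X \<otimes> tw X) \<cdot> br X X) \<cdot> (br X X \<cdot> (\<sigma> \<otimes> \<sigma>))"
      by (simp del: ich)
    also have "\<dots> = \<kappa> \<cdot> br X X \<cdot> (\<sigma> \<otimes> \<sigma>)"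
      unfolding form_symmetric[symmetric] by simp
    finally show "(counit A \<cdot> \<sigma>) \<cdot> m = ((counit A \<cdot> \<sigma>) \<cdot> m) \<cdot> (Id X \<otimes> tw X) \<cdot> br X X"
      unfolding \<kappa>' by simp
  qed simp_all
qed

end

section \<open>Braid identities and the notion of a linking\<close>

context strict_linear_ribbon_category
begin

lemma yang_baxter:
  assumes [simp]: "U \<in> Ob C" "V \<in> Ob C" "W \<in> Ob C"
  shows "(Id W \<otimes> br U V) \<cdot> br (U \<odot> V) W = (br V W \<otimes> Id U) \<cdot> br U (V \<odot> W)"
proof -
  have "(Id W \<otimes> br U V) \<cdot> br (U \<odot> V) W = br (V \<odot> U) W \<cdot> (br U V \<otimes> Id W)"
    by (rule br_nat[symmetric]) simp_all
  then show ?thesis by (simp add: braiding_tensor_left braiding_tensor_right)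
qed

text \<open>Both sides are the half twist on four strands. It occurs when the anti-involution is
  applied to a product of two pairs.\<close>

lemma half_twist:
  assumes [simp]: "U \<in> Ob C" "V \<in> Ob C" "W \<in> Ob C" "Z \<in> Ob C"
  shows "(Id Z \<otimes> ((br V W \<otimes> Id U) \<cdot> br U (V \<odot> W))) \<cdot> br (U \<odot> V \<odot> W) Z = (br W Z \<otimes> br U V) \<cdot> br (U \<odot> V) (W \<odot> Z)"
proof -
  have "(Id Z \<otimes> ((br V W \<otimes> Id U) \<cdot> br U (V \<odot> W))) \<cdot> br (U \<odot> V \<odot> W) Z
      = (Id Z \<otimes> Id W \<otimes> br U V) \<cdot> ((Id Z \<otimes> br (U \<odot> V) W) \<cdot> br ((U \<odot> V) \<odot> W) Z)"
    unfolding yang_baxter[OF assms(1-3), symmetric] by (simp add: tensor_ident_comp del: ich tensor_rules(4))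
  also have "\<dots> = (Id Z \<otimes> Id W \<otimes> br U V) \<cdot> ((br W Z \<otimes> Id (U \<odot> V)) \<cdot> br (U \<odot> V) (W \<odot> Z))"
    by (subst yang_baxter) simp_all
  also have "\<dots> = (br W Z \<otimes> br U V) \<cdot> br (U \<odot> V) (W \<odot> Z)"
    by (rule comp_eq_tail) simp_all
  finally show ?thesis .
qed

lemma split_epi_cancel:
  assumes "r \<cdot> e = Id E" "ty e = E \<rightarrowtail> W" "ty r = W \<rightarrowtail> E" "ty f = E \<rightarrowtail> Z" "ty g = E \<rightarrowtail> Z"
    and eq: "f \<cdot> r = g \<cdot> r"
  shows "f = g"
proof -
  have "f = (f \<cdot> r) \<cdot> e" using assms(1-5) by simp
  also have "\<dots> = (g \<cdot> r) \<cdot> e" by (simp only: eq)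
  also have "\<dots> = g" using assms(1-5) by simp
  finally show ?thesis .
qed

text \<open>Indexing by \<open>bool\<close> makes the laws of both algebras, of the bimodules and of
  the pairings instances of one law each. The last clause replaces invertibility of the pairings by
  a preimage of each unit.\<close>

definition linking ::
  "(bool \<Rightarrow> bool \<Rightarrow> 'o) \<Rightarrow> (bool \<Rightarrow> bool \<Rightarrow> bool \<Rightarrow> 'm) \<Rightarrow> (bool \<Rightarrow> 'm) \<Rightarrow> (bool \<Rightarrow> bool \<Rightarrow> 'm) \<Rightarrow> bool" where
  "linking P m u s \<longleftrightarrow>
     (\<forall>i j. P i j \<in> Ob C) \<and>
     (\<forall>i j k. ty (m i j k) = (P i j \<odot> P j k) \<rightarrowtail> P i k) \<and>
     (\<forall>i. ty (u i) = \<one> \<rightarrowtail> P i i) \<and>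
     (\<forall>i j. ty (s i j) = P i j \<rightarrowtail> P j i) \<and>
     (\<forall>i j k l. m i k l \<cdot> (m i j k \<otimes> Id (P k l)) = m i j l \<cdot> (Id (P i j) \<otimes> m j k l)) \<and>
     (\<forall>i j. m i i j \<cdot> (u i \<otimes> Id (P i j)) = Id (P i j) \<and> m i j j \<cdot> (Id (P i j) \<otimes> u j) = Id (P i j)) \<and>
     (\<forall>i j k. s i k \<cdot> m i j k = m k j i \<cdot> (s j k \<otimes> s i j) \<cdot> br (P i j) (P j k)) \<and>
     (\<forall>i j. s j i \<cdot> s i j = tw (P i j)) \<and>
     (\<forall>i j. \<exists>w. ty w = \<one> \<rightarrowtail> (P i j \<odot> P j i) \<and> m i j i \<cdot> w = u i)"

definition corner ::
  "(bool \<Rightarrow> bool \<Rightarrow> 'o) \<Rightarrow> (bool \<Rightarrow> bool \<Rightarrow> bool \<Rightarrow> 'm) \<Rightarrow> (bool \<Rightarrow> 'm) \<Rightarrow> (bool \<Rightarrow> bool \<Rightarrow> 'm) \<Rightarrow>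
    bool \<Rightarrow> ('o, 'm) jandl \<Rightarrow> bool" where
  "corner P m u s i A \<longleftrightarrow>
     P i i = alg_ob A \<and> m i i i = mult A \<and> u i = unit A \<and> s i i = reversion A"

definition linked :: "('o, 'm) jandl \<Rightarrow> ('o, 'm) jandl \<Rightarrow> bool" where
  "linked A B \<longleftrightarrow> (\<exists>P m u s. linking P m u s \<and> corner P m u s False A \<and> corner P m u s True B)"

end

section \<open>Hermitian modules and their tensor products\<close>

context jandl
begin

text \<open>What a linking becomes when seen from a single corner: a column \<open>R\<close> and a
  row \<open>K\<close> with an algebra-valued pairing \<open>p\<close>, for which \<open>w\<close>
  is a dual basis. The arrows \<open>s\<close> and \<open>t\<close> are the off-diagonal parts of
  the anti-involution. Dual basis and preimage of the unit under \<open>p\<close> account for the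
  units of the two opposite corners.\<close>

definition hermitian ::
  "'o \<Rightarrow> 'o \<Rightarrow> 'm \<Rightarrow> 'm \<Rightarrow> 'm \<Rightarrow> 'm \<Rightarrow> 'm \<Rightarrow> 'm \<Rightarrow> bool" where
  "hermitian R K \<rho> l p s t w \<longleftrightarrow>
     right_module A R \<rho> \<and> left_module A K l \<and>
     ty p = (K \<odot> R) \<rightarrowtail> X \<and> p \<cdot> (l \<otimes> Id R) = m \<cdot> (Id X \<otimes> p) \<and> p \<cdot> (Id K \<otimes> \<rho>) = m \<cdot> (p \<otimes> Id X) \<and>
     ty s = R \<rightarrowtail> K \<and> ty t = K \<rightarrowtail> R \<and> t \<cdot> s = tw R \<and> s \<cdot> t = tw K \<and>
     s \<cdot> \<rho> = l \<cdot> (\<sigma> \<otimes> s) \<cdot> br R X \<and> t \<cdot> l = \<rho> \<cdot> (t \<otimes> \<sigma>) \<cdot> br X K \<and>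
     \<sigma> \<cdot> p = p \<cdot> (s \<otimes> t) \<cdot> br K R \<and>
     ty w = \<one> \<rightarrowtail> (R \<odot> K) \<and> \<rho> \<cdot> (Id R \<otimes> p) \<cdot> (w \<otimes> Id R) = Id R \<and> l \<cdot> (p \<otimes> Id K) \<cdot> (Id K \<otimes> w) = Id K \<and>
     (\<exists>v. ty v = \<one> \<rightarrowtail> (K \<odot> R) \<and> p \<cdot> v = \<eta>)"

end

text \<open>Two hermitian modules over the same algebra suffice: the objects \<open>E i j\<close>
  represent \<open>R i\<close> tensored over \<open>A\<close> with \<open>K j\<close>, and they are
  the entries of a new linking. The retracts are parameters so that the diagonal ones can be
  prescribed.\<close>

locale hermitian_family = jandl C A
  for C :: "('o, 'm, 'k::field) ribbon_structure" (structure) and A :: "('o, 'm) jandl" +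
  fixes R K :: "bool \<Rightarrow> 'o" and \<rho> l p s t w :: "bool \<Rightarrow> 'm"
    and E :: "bool \<Rightarrow> bool \<Rightarrow> 'o" and e r :: "bool \<Rightarrow> bool \<Rightarrow> 'm"
  assumes herm: "\<And>i. hermitian (R i) (K i) (\<rho> i) (l i) (p i) (s i) (t i) (w i)"
    and spl: "\<And>i j. splits (R i \<odot> K j) (tensor_over A (R i) (\<rho> i) (K j) (l j)) (E i j) (e i j) (r i j)"
begin

definition mul :: "bool \<Rightarrow> bool \<Rightarrow> bool \<Rightarrow> 'm" where
  "mul i j k = r i k \<cdot> ((\<rho> i \<cdot> (Id (R i) \<otimes> p j)) \<otimes> Id (K k)) \<cdot> (e i j \<otimes> e j k)"

definition un :: "bool \<Rightarrow> 'm" where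
  "un i = r i i \<cdot> w i"

definition inv :: "bool \<Rightarrow> bool \<Rightarrow> 'm" where
  "inv i j = r j i \<cdot> (t j \<otimes> s i) \<cdot> br (R i) (K j) \<cdot> e i j"

lemma modules: "right_module A (R i) (\<rho> i)" "left_module A (K i) (l i)"
  using herm[of i] by (simp_all add: hermitian_def)

lemma tys [simp]:
  "R i \<in> Ob C" "K i \<in> Ob C" "E i j \<in> Ob C"
  "ty (\<rho> i) = (R i \<odot> X) \<rightarrowtail> R i" "ty (l i) = (X \<odot> K i) \<rightarrowtail> K i"
  "ty (p i) = (K i \<odot> R i) \<rightarrowtail> X" "ty (s i) = R i \<rightarrowtail> K i" "ty (t i) = K i \<rightarrowtail> R i"
  "ty (w i) = \<one> \<rightarrowtail> (R i \<odot> K i)"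
  "ty (e i j) = E i j \<rightarrowtail> (R i \<odot> K j)" "ty (r i j) = (R i \<odot> K j) \<rightarrowtail> E i j"
  using herm[of i] modules[of i] spl[of i j]
  by (simp_all add: hermitian_def right_module_def left_module_def splits_def)

lemma r_e: "r i j \<cdot> e i j = Id (E i j)"
  using spl[of i j] by (simp add: splits_def)

lemma laws:
  "\<rho> i \<cdot> (\<rho> i \<otimes> Id X) = \<rho> i \<cdot> (Id (R i) \<otimes> m)"
  "l i \<cdot> (Id X \<otimes> l i) = l i \<cdot> (m \<otimes> Id (K i))"
  "p i \<cdot> (l i \<otimes> Id (R i)) = m \<cdot> (Id X \<otimes> p i)" "p i \<cdot> (Id (K i) \<otimes> \<rho> i) = m \<cdot> (p i \<otimes> Id X)"
  "r i j \<cdot> (\<rho> i \<otimes> Id (K j)) = r i j \<cdot> (Id (R i) \<otimes> l j)"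
  using herm[of i] modules[of i] splits_balanced(2)[OF modules(1)[of i] modules(2)[of j] spl[of i j]]
  by (simp_all add: hermitian_def right_module_def left_module_def)

lemma right_action_assoc [simp]:
  assumes "ty x = U \<rightarrowtail> R i" "ty a = V \<rightarrowtail> X" "ty b = V' \<rightarrowtail> X"
  shows "\<rho> i \<cdot> ((\<rho> i \<cdot> (x \<otimes> a)) \<otimes> b) = \<rho> i \<cdot> (x \<otimes> (m \<cdot> (a \<otimes> b)))"
  using precomp[OF laws(1)[of i], of "x \<otimes> a \<otimes> b"] assms by simp

lemma left_action_assoc [simp]:
  assumes "ty a = V \<rightarrowtail> X" "ty b = V' \<rightarrowtail> X" "ty y = W \<rightarrowtail> K i"
  shows "l i \<cdot> (a \<otimes> (l i \<cdot> (b \<otimes> y))) = l i \<cdot> ((m \<cdot> (a \<otimes> b)) \<otimes> y)"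
  using precomp[OF laws(2)[of i], of "a \<otimes> b \<otimes> y"] assms by simp

lemma pairing_left_linear [simp]:
  assumes "ty a = V \<rightarrowtail> X" "ty y = W \<rightarrowtail> K i" "ty x = U \<rightarrowtail> R i"
  shows "p i \<cdot> ((l i \<cdot> (a \<otimes> y)) \<otimes> x) = m \<cdot> (a \<otimes> (p i \<cdot> (y \<otimes> x)))"
  using precomp[OF laws(3)[of i], of "a \<otimes> y \<otimes> x"] assms by simp

lemma pairing_right_linear [simp]:
  assumes "ty y = W \<rightarrowtail> K i" "ty x = U \<rightarrowtail> R i" "ty a = V \<rightarrowtail> X"
  shows "p i \<cdot> (y \<otimes> (\<rho> i \<cdot> (x \<otimes> a))) = m \<cdot> ((p i \<cdot> (y \<otimes> x)) \<otimes> a)"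
  using precomp[OF laws(4)[of i], of "y \<otimes> x \<otimes> a"] assms by simp

lemma restriction_balanced [simp]:
  assumes "ty x = U \<rightarrowtail> R i" "ty a = V \<rightarrowtail> X" "ty y = W \<rightarrowtail> K j"
  shows "r i j \<cdot> ((\<rho> i \<cdot> (x \<otimes> a)) \<otimes> y) = r i j \<cdot> (x \<otimes> (l j \<cdot> (a \<otimes> y)))"
  using precomp[OF laws(5)[of i j], of "x \<otimes> a \<otimes> y"] assms by simp

lemma mul_ty [simp]: "ty (mul i j k) = (E i j \<odot> E j k) \<rightarrowtail> E i k"
  by (simp add: mul_def)

text \<open>The formula is balanced in both inner tensor products, so it absorbs both idempotents
  and the product can be computed on representatives.\<close>

lemma mul_arrow: "mul i j k \<cdot> (r i j \<otimes> r j k) = r i k \<cdot> ((\<rho> i \<cdot> (Id (R i) \<otimes> p j)) \<otimes> Id (K k))"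
proof -
  let ?F = "r i k \<cdot> ((\<rho> i \<cdot> (Id (R i) \<otimes> p j)) \<otimes> Id (K k))"
  have F: "ty ?F = (R i \<odot> K j \<odot> R j \<odot> K k) \<rightarrowtail> E i k" by simp
  have F1: "?F \<cdot> (x \<otimes> y \<otimes> z \<otimes> v) = r i k \<cdot> (x \<otimes> (l k \<cdot> ((p j \<cdot> (y \<otimes> z)) \<otimes> v)))"
    if "ty x = U1 \<rightarrowtail> R i" "ty y = U2 \<rightarrowtail> K j" "ty z = U3 \<rightarrowtail> R j" "ty v = U4 \<rightarrowtail> K k" for x y z v U1 U2 U3 U4
    using that by simp
  have b1: "?F \<cdot> ((\<rho> i \<cdot> (x \<otimes> a)) \<otimes> y \<otimes> z \<otimes> v) = ?F \<cdot> (x \<otimes> (l j \<cdot> (a \<otimes> y)) \<otimes> z \<otimes> v)"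
    and b2: "?F \<cdot> (x \<otimes> y \<otimes> (\<rho> j \<cdot> (z \<otimes> a)) \<otimes> v) = ?F \<cdot> (x \<otimes> y \<otimes> z \<otimes> (l k \<cdot> (a \<otimes> v)))"
    if [simp]: "ty x = U1 \<rightarrowtail> R i" "ty y = U2 \<rightarrowtail> K j" "ty z = U3 \<rightarrowtail> R j" "ty v = U4 \<rightarrowtail> K k" "ty a = U5 \<rightarrowtail> X" for x y z v a U1 U2 U3 U4 U5
    by (subst F1; simp)+
  have i: "\<rho> n \<cdot> (Id (R n) \<otimes> Id X) = \<rho> n" "l n \<cdot> (Id X \<otimes> Id (K n)) = l n" for n
    by simp_all
  have b1': "?F \<cdot> (\<rho> i \<otimes> Id (K j) \<otimes> Id (R j) \<otimes> Id (K k)) = ?F \<cdot> (Id (R i) \<otimes> l j \<otimes> Id (R j) \<otimes> Id (K k))"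
    using b1[of "Id (R i)" "R i" "Id (K j)" "K j" "Id (R j)" "R j" "Id (K k)" "K k" "Id X" X]
    by (simp only: i ob_arrow_ty tys algebra_ty simp_thms)
  have b2': "?F \<cdot> (Id (R i) \<otimes> Id (K j) \<otimes> \<rho> j \<otimes> Id (K k)) = ?F \<cdot> (Id (R i) \<otimes> Id (K j) \<otimes> Id (R j) \<otimes> l k)"
    using b2[of "Id (R i)" "R i" "Id (K j)" "K j" "Id (R j)" "R j" "Id (K k)" "K k" "Id X" X]
    by (simp only: i ob_arrow_ty tys algebra_ty simp_thms)
  have n: "Id \<one> \<otimes> \<rho> i \<otimes> Id (K j) \<otimes> Id (R j \<odot> K k) = \<rho> i \<otimes> Id (K j) \<otimes> Id (R j) \<otimes> Id (K k)"
    "Id \<one> \<otimes> Id (R i) \<otimes> l j \<otimes> Id (R j \<odot> K k) = Id (R i) \<otimes> l j \<otimes> Id (R j) \<otimes> Id (K k)"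
    "Id (R i \<odot> K j) \<otimes> \<rho> j \<otimes> Id (K k) \<otimes> Id \<one> = Id (R i) \<otimes> Id (K j) \<otimes> \<rho> j \<otimes> Id (K k)"
    "Id (R i \<odot> K j) \<otimes> Id (R j) \<otimes> l k \<otimes> Id \<one> = Id (R i) \<otimes> Id (K j) \<otimes> Id (R j) \<otimes> l k"
    by (simp_all add: ident_tensor_split)
  have "?F \<cdot> (Id \<one> \<otimes> tensor_over A (R i) (\<rho> i) (K j) (l j) \<otimes> Id (R j \<odot> K k)) = ?F"
    by (rule balanced_tensor_over_whisker[OF modules(1) modules(2), where Z = "E i k"])
      (simp_all only: n b1', simp_all)
  then have P1: "?F \<cdot> ((e i j \<cdot> r i j) \<otimes> Id (R j \<odot> K k)) = ?F"
    using spl[of i j] by (simp add: splits_def)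
  have "?F \<cdot> (Id (R i \<odot> K j) \<otimes> tensor_over A (R j) (\<rho> j) (K k) (l k) \<otimes> Id \<one>) = ?F"
    by (rule balanced_tensor_over_whisker[OF modules(1) modules(2), where Z = "E i k"])
      (simp_all only: n b2', simp_all)
  then have P2: "?F \<cdot> (Id (R i \<odot> K j) \<otimes> (e j k \<cdot> r j k)) = ?F"
    using spl[of j k] by (simp add: splits_def)
  have "mul i j k \<cdot> (r i j \<otimes> r j k) = (?F \<cdot> ((e i j \<cdot> r i j) \<otimes> Id (R j \<odot> K k))) \<cdot> (Id (R i \<odot> K j) \<otimes> (e j k \<cdot> r j k))"
    by (simp add: mul_def)
  then show ?thesis by (simp only: P1 P2)
qed

lemma mul_elem:
  assumes "ty x = U1 \<rightarrowtail> R i" "ty y = U2 \<rightarrowtail> K j" "ty z = U3 \<rightarrowtail> R j" "ty v = U4 \<rightarrowtail> K k"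
  shows "mul i j k \<cdot> ((r i j \<cdot> (x \<otimes> y)) \<otimes> (r j k \<cdot> (z \<otimes> v))) = r i k \<cdot> (x \<otimes> (l k \<cdot> ((p j \<cdot> (y \<otimes> z)) \<otimes> v)))"
  using precomp[OF mul_arrow[of i j k], of "x \<otimes> y \<otimes> z \<otimes> v"] assms by simp

lemma un_ty [simp]: "ty (un i) = \<one> \<rightarrowtail> E i i"
  by (simp add: un_def)

lemma inv_ty [simp]: "ty (inv i j) = E i j \<rightarrowtail> E j i"
  by (simp add: inv_def)

text \<open>The swap x \<otimes> y to t(y) \<otimes> s(x) is balanced: \<open>s\<close> and
  \<open>t\<close> exchange left and right action up to \<sigma>, and Yang-Baxter moves the algebra
  strand between the two factors.\<close>

lemma inv_arrow: "inv i j \<cdot> r i j = r j i \<cdot> (t j \<otimes> s i) \<cdot> br (R i) (K j)"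
proof -
  let ?G = "r j i \<cdot> (t j \<otimes> s i) \<cdot> br (R i) (K j)"
  have s: "s i \<cdot> \<rho> i = l i \<cdot> (\<sigma> \<otimes> s i) \<cdot> br (R i) X" and t: "t j \<cdot> l j = \<rho> j \<cdot> (t j \<otimes> \<sigma>) \<cdot> br X (K j)"
    using herm[of i] herm[of j] by (simp_all add: hermitian_def)
  have "?G \<cdot> (\<rho> i \<otimes> Id (K j)) = r j i \<cdot> (t j \<otimes> s i) \<cdot> ((Id (K j) \<otimes> \<rho> i) \<cdot> br (R i \<odot> X) (K j))"
    using br_nat[of "\<rho> i" "R i \<odot> X" "R i" "Id (K j)" "K j" "K j"] by (simp del: ich)
  also have "\<dots> = r j i \<cdot> (t j \<otimes> (s i \<cdot> \<rho> i)) \<cdot> br (R i \<odot> X) (K j)"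
    by simp
  also have "\<dots> = r j i \<cdot> (t j \<otimes> (l i \<cdot> (\<sigma> \<otimes> s i))) \<cdot> ((Id (K j) \<otimes> br (R i) X) \<cdot> br (R i \<odot> X) (K j))"
    unfolding s by simp
  also have "(Id (K j) \<otimes> br (R i) X) \<cdot> br (R i \<odot> X) (K j) = (br X (K j) \<otimes> Id (R i)) \<cdot> br (R i) (X \<odot> K j)"
    by (rule yang_baxter) simp_all
  also have "r j i \<cdot> (t j \<otimes> (l i \<cdot> (\<sigma> \<otimes> s i))) = r j i \<cdot> ((\<rho> j \<cdot> (t j \<otimes> \<sigma>)) \<otimes> s i)"
    by simp
  also have "\<dots> \<cdot> ((br X (K j) \<otimes> Id (R i)) \<cdot> br (R i) (X \<odot> K j)) =
      r j i \<cdot> ((\<rho> j \<cdot> (t j \<otimes> \<sigma>) \<cdot> br X (K j)) \<otimes> s i) \<cdot> br (R i) (X \<odot> K j)"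
    by (simp del: restriction_balanced)
  also have "\<dots> = r j i \<cdot> (t j \<otimes> s i) \<cdot> ((l j \<otimes> Id (R i)) \<cdot> br (R i) (X \<odot> K j))"
    unfolding t[symmetric] by simp
  also have "(l j \<otimes> Id (R i)) \<cdot> br (R i) (X \<odot> K j) = br (R i) (K j) \<cdot> (Id (R i) \<otimes> l j)"
    by (rule br_nat[symmetric]) simp_all
  finally have b: "?G \<cdot> (\<rho> i \<otimes> Id (K j)) = ?G \<cdot> (Id (R i) \<otimes> l j)"
    by (simp del: ich)
  have "?G \<cdot> (e i j \<cdot> r i j) = ?G"
    by (rule balanced_factor[OF modules(1) modules(2) spl _ b, where Z = "E j i"]) simp
  then show ?thesis by (simp add: inv_def)
qed

lemma mul_assoc: "mul i k n \<cdot> (mul i j k \<otimes> Id (E k n)) = mul i j n \<cdot> (Id (E i j) \<otimes> mul j k n)"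
proof -
  have 1: "mul i k n \<cdot> ((mul i j k \<cdot> ((r i j \<cdot> (x \<otimes> y)) \<otimes> (r j k \<cdot> (z \<otimes> v)))) \<otimes> (r k n \<cdot> (c \<otimes> d)))
      = mul i j n \<cdot> ((r i j \<cdot> (x \<otimes> y)) \<otimes> (mul j k n \<cdot> ((r j k \<cdot> (z \<otimes> v)) \<otimes> (r k n \<cdot> (c \<otimes> d)))))"
    if [simp]: "ty x = U1 \<rightarrowtail> R i" "ty y = U2 \<rightarrowtail> K j" "ty z = U3 \<rightarrowtail> R j" "ty v = U4 \<rightarrowtail> K k"
      "ty c = U5 \<rightarrowtail> R k" "ty d = U6 \<rightarrowtail> K n"
    for x y z v c d U1 U2 U3 U4 U5 U6
    by (simp add: mul_elem)
  have "mul i k n \<cdot> ((mul i j k \<cdot> (r i j \<otimes> r j k)) \<otimes> r k n) = mul i j n \<cdot> (r i j \<otimes> (mul j k n \<cdot> (r j k \<otimes> r k n)))"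
    using 1[of "Id (R i)" "R i" "Id (K j)" "K j" "Id (R j)" "R j" "Id (K k)" "K k" "Id (R k)" "R k" "Id (K n)" "K n"]
    by simp
  then have "(mul i k n \<cdot> (mul i j k \<otimes> Id (E k n))) \<cdot> (r i j \<otimes> r j k \<otimes> r k n)
      = (mul i j n \<cdot> (Id (E i j) \<otimes> mul j k n)) \<cdot> (r i j \<otimes> r j k \<otimes> r k n)"
    by simp
  then show ?thesis
    by (rule split_epi_cancel[where e = "e i j \<otimes> e j k \<otimes> e k n" and E = "E i j \<odot> E j k \<odot> E k n"
          and W = "(R i \<odot> K j) \<odot> (R j \<odot> K k) \<odot> (R k \<odot> K n)" and Z = "E i n", rotated -1]) (simp_all add: r_e)
qed

text \<open>Multiplying by the class of \<open>w\<close> is expansion in the dual basis.\<close>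

lemma mul_unit: "mul i i j \<cdot> (un i \<otimes> Id (E i j)) = Id (E i j)" "mul i j j \<cdot> (Id (E i j) \<otimes> un j) = Id (E i j)"
proof -
  have w: "\<rho> i \<cdot> (Id (R i) \<otimes> p i) \<cdot> (w i \<otimes> Id (R i)) = Id (R i)" "l j \<cdot> (p j \<otimes> Id (K j)) \<cdot> (Id (K j) \<otimes> w j) = Id (K j)"
    using herm[of i] herm[of j] by (simp_all add: hermitian_def)
  have "(mul i i j \<cdot> (un i \<otimes> Id (E i j))) \<cdot> r i j = (mul i i j \<cdot> (r i i \<otimes> r i j)) \<cdot> (w i \<otimes> Id (R i \<odot> K j))"
    using coscalar_tensor(1)[of "un i" "E i i" "r i j" "R i \<odot> K j" "E i j", symmetric] by (simp add: un_def)
  also have "\<dots> = r i j \<cdot> ((\<rho> i \<cdot> (Id (R i) \<otimes> p i) \<cdot> (w i \<otimes> Id (R i))) \<otimes> Id (K j))"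
    unfolding mul_arrow by (simp del: tensor_rules(4) restriction_balanced add: split_ident)
  finally have 1: "(mul i i j \<cdot> (un i \<otimes> Id (E i j))) \<cdot> r i j = Id (E i j) \<cdot> r i j"
    unfolding w by simp
  show "mul i i j \<cdot> (un i \<otimes> Id (E i j)) = Id (E i j)"
    by (rule split_epi_cancel[OF r_e _ _ _ _ 1]) simp_all
  have m2: "mul i j j \<cdot> (r i j \<otimes> r j j) = r i j \<cdot> (Id (R i) \<otimes> (l j \<cdot> (p j \<otimes> Id (K j))))"
    unfolding mul_arrow
    using restriction_balanced[of "Id (R i)" "R i" i "p j" "K j \<odot> R j" "Id (K j)" "K j" j] by simp
  have "(mul i j j \<cdot> (Id (E i j) \<otimes> un j)) \<cdot> r i j = (mul i j j \<cdot> (r i j \<otimes> r j j)) \<cdot> (Id (R i \<odot> K j) \<otimes> w j)"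
    using coscalar_tensor(2)[of "un j" "E j j" "r i j" "R i \<odot> K j" "E i j", symmetric] by (simp add: un_def)
  also have "\<dots> = r i j \<cdot> (Id (R i) \<otimes> (l j \<cdot> (p j \<otimes> Id (K j)) \<cdot> (Id (K j) \<otimes> w j)))"
    unfolding m2 by (simp del: tensor_rules(4) add: split_ident)
  finally have 2: "(mul i j j \<cdot> (Id (E i j) \<otimes> un j)) \<cdot> r i j = Id (E i j) \<cdot> r i j"
    unfolding w by simp
  show "mul i j j \<cdot> (Id (E i j) \<otimes> un j) = Id (E i j)"
    by (rule split_epi_cancel[OF r_e _ _ _ _ 2]) simp_all
qed

lemma inv_mul: "inv i k \<cdot> mul i j k = mul k j i \<cdot> (inv j k \<otimes> inv i j) \<cdot> br (E i j) (E j k)"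
proof -
  have s: "s i \<cdot> \<rho> i = l i \<cdot> (\<sigma> \<otimes> s i) \<cdot> br (R i) X" and p: "\<sigma> \<cdot> p j = p j \<cdot> (s j \<otimes> t j) \<cdot> br (K j) (R j)"
    using herm[of i] herm[of j] by (simp_all add: hermitian_def)
  let ?T = "r k i \<cdot> (t k \<otimes> (l i \<cdot> ((p j \<cdot> (s j \<otimes> t j)) \<otimes> s i)))"
  have "(inv i k \<cdot> mul i j k) \<cdot> (r i j \<otimes> r j k) = (inv i k \<cdot> r i k) \<cdot> ((\<rho> i \<cdot> (Id (R i) \<otimes> p j)) \<otimes> Id (K k))"
    using mul_arrow[of i j k] by simp
  also have "\<dots> = r k i \<cdot> (t k \<otimes> s i) \<cdot> (br (R i) (K k) \<cdot> ((\<rho> i \<cdot> (Id (R i) \<otimes> p j)) \<otimes> Id (K k)))"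
    unfolding inv_arrow by (simp del: ich)
  also have "br (R i) (K k) \<cdot> ((\<rho> i \<cdot> (Id (R i) \<otimes> p j)) \<otimes> Id (K k)) = (Id (K k) \<otimes> (\<rho> i \<cdot> (Id (R i) \<otimes> p j))) \<cdot> br (R i \<odot> K j \<odot> R j) (K k)"
    by (rule br_nat) simp_all
  also have "r k i \<cdot> (t k \<otimes> s i) \<cdot> \<dots> = r k i \<cdot> (t k \<otimes> ((s i \<cdot> \<rho> i) \<cdot> (Id (R i) \<otimes> p j))) \<cdot> br (R i \<odot> K j \<odot> R j) (K k)"
    by simp
  also have "(s i \<cdot> \<rho> i) \<cdot> (Id (R i) \<otimes> p j) = l i \<cdot> (\<sigma> \<otimes> s i) \<cdot> (br (R i) X \<cdot> (Id (R i) \<otimes> p j))"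
    unfolding s by simp
  also have "br (R i) X \<cdot> (Id (R i) \<otimes> p j) = (p j \<otimes> Id (R i)) \<cdot> br (R i) (K j \<odot> R j)"
    by (rule br_nat) simp_all
  also have "l i \<cdot> (\<sigma> \<otimes> s i) \<cdot> \<dots> = l i \<cdot> ((\<sigma> \<cdot> p j) \<otimes> s i) \<cdot> br (R i) (K j \<odot> R j)"
    by simp
  also have "\<dots> = (l i \<cdot> ((p j \<cdot> (s j \<otimes> t j)) \<otimes> s i)) \<cdot> ((br (K j) (R j) \<otimes> Id (R i)) \<cdot> br (R i) (K j \<odot> R j))"
    unfolding p by simp
  also have "r k i \<cdot> (t k \<otimes> \<dots>) \<cdot> br (R i \<odot> K j \<odot> R j) (K k) =
      ?T \<cdot> ((Id (K k) \<otimes> ((br (K j) (R j) \<otimes> Id (R i)) \<cdot> br (R i) (K j \<odot> R j))) \<cdot> br (R i \<odot> K j \<odot> R j) (K k))"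
  proof -
    have "t k \<otimes> ((l i \<cdot> ((p j \<cdot> (s j \<otimes> t j)) \<otimes> s i)) \<cdot> ((br (K j) (R j) \<otimes> Id (R i)) \<cdot> br (R i) (K j \<odot> R j)))
      = (t k \<otimes> (l i \<cdot> ((p j \<cdot> (s j \<otimes> t j)) \<otimes> s i))) \<cdot> (Id (K k) \<otimes> ((br (K j) (R j) \<otimes> Id (R i)) \<cdot> br (R i) (K j \<odot> R j)))"
      by simp
    then show ?thesis by (simp del: ich)
  qed
  \<comment> \<open>All crossings have now been collected next to the arguments. The other side of
    the claim performs the same half twist pair by pair.\<close>
  also have "(Id (K k) \<otimes> ((br (K j) (R j) \<otimes> Id (R i)) \<cdot> br (R i) (K j \<odot> R j))) \<cdot> br (R i \<odot> K j \<odot> R j) (K k) =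
      (br (R j) (K k) \<otimes> br (R i) (K j)) \<cdot> br (R i \<odot> K j) (R j \<odot> K k)"
    by (rule half_twist) simp_all
  finally have 1: "(inv i k \<cdot> mul i j k) \<cdot> (r i j \<otimes> r j k) =
      ?T \<cdot> ((br (R j) (K k) \<otimes> br (R i) (K j)) \<cdot> br (R i \<odot> K j) (R j \<odot> K k))" .
  have "(mul k j i \<cdot> (inv j k \<otimes> inv i j) \<cdot> br (E i j) (E j k)) \<cdot> (r i j \<otimes> r j k) =
      mul k j i \<cdot> (inv j k \<otimes> inv i j) \<cdot> ((r j k \<otimes> r i j) \<cdot> br (R i \<odot> K j) (R j \<odot> K k))"
    using br_nat[of "r i j" "R i \<odot> K j" "E i j" "r j k" "R j \<odot> K k" "E j k"] by (simp del: ich)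
  also have "\<dots> = mul k j i \<cdot> ((inv j k \<cdot> r j k) \<otimes> (inv i j \<cdot> r i j)) \<cdot> br (R i \<odot> K j) (R j \<odot> K k)"
    by simp
  also have "\<dots> = (mul k j i \<cdot> ((r k j \<cdot> (t k \<otimes> s j)) \<otimes> (r j i \<cdot> (t j \<otimes> s i)))) \<cdot>
      ((br (R j) (K k) \<otimes> br (R i) (K j)) \<cdot> br (R i \<odot> K j) (R j \<odot> K k))"
    unfolding inv_arrow by simp
  also have "mul k j i \<cdot> ((r k j \<cdot> (t k \<otimes> s j)) \<otimes> (r j i \<cdot> (t j \<otimes> s i))) = ?T"
    by (rule mul_elem) simp_all
  finally have "(inv i k \<cdot> mul i j k) \<cdot> (r i j \<otimes> r j k) =
      (mul k j i \<cdot> (inv j k \<otimes> inv i j) \<cdot> br (E i j) (E j k)) \<cdot> (r i j \<otimes> r j k)"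
    using 1 by (simp only:)
  then show ?thesis
    by (rule split_epi_cancel[where e = "e i j \<otimes> e j k" and E = "E i j \<odot> E j k"
          and W = "(R i \<odot> K j) \<odot> (R j \<odot> K k)" and Z = "E k i", rotated -1]) (simp_all add: r_e)
qed

text \<open>The composites of \<open>s\<close> and \<open>t\<close> contribute the twists of both
  factors and the two swaps a double braiding; together they form the twist of the tensor
  product.\<close>

lemma inv_inv: "inv j i \<cdot> inv i j = tw (E i j)"
proof -
  have ts: "t n \<cdot> s n = tw (R n)" "s n \<cdot> t n = tw (K n)" for n
    using herm[of n] by (simp_all add: hermitian_def)
  have "(inv j i \<cdot> inv i j) \<cdot> r i j = (inv j i \<cdot> r j i) \<cdot> ((t j \<otimes> s i) \<cdot> br (R i) (K j))"
    using inv_arrow[of i j] by simp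
  also have "\<dots> = r i j \<cdot> (t i \<otimes> s j) \<cdot> ((br (R j) (K i) \<cdot> (t j \<otimes> s i)) \<cdot> br (R i) (K j))"
    unfolding inv_arrow by (simp del: ich)
  also have "br (R j) (K i) \<cdot> (t j \<otimes> s i) = (s i \<otimes> t j) \<cdot> br (K j) (R i)"
    by (rule br_nat) simp_all
  also have "r i j \<cdot> (t i \<otimes> s j) \<cdot> (\<dots> \<cdot> br (R i) (K j)) = r i j \<cdot> ((tw (R i) \<otimes> tw (K j)) \<cdot> br (K j) (R i)) \<cdot> br (R i) (K j)"
    by (simp add: ts)
  also have "(tw (R i) \<otimes> tw (K j)) \<cdot> br (K j) (R i) = br (K j) (R i) \<cdot> (tw (K j) \<otimes> tw (R i))"
    by (rule br_nat[symmetric]) simp_all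
  also have "r i j \<cdot> \<dots> \<cdot> br (R i) (K j) = r i j \<cdot> br (K j) (R i) \<cdot> ((tw (K j) \<otimes> tw (R i)) \<cdot> br (R i) (K j))"
    by (simp del: ich)
  also have "(tw (K j) \<otimes> tw (R i)) \<cdot> br (R i) (K j) = br (R i) (K j) \<cdot> (tw (R i) \<otimes> tw (K j))"
    by (rule br_nat[symmetric]) simp_all
  also have "r i j \<cdot> br (K j) (R i) \<cdot> \<dots> = r i j \<cdot> tw (R i \<odot> K j)"
    by (simp add: twist_tensor)
  also have "\<dots> = tw (E i j) \<cdot> r i j"
    by (rule tw_nat[symmetric]) simp
  finally have 1: "(inv j i \<cdot> inv i j) \<cdot> r i j = tw (E i j) \<cdot> r i j" .
  show ?thesis by (rule split_epi_cancel[OF r_e _ _ _ _ 1]) simp_all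
qed

lemma mul_full: "\<exists>x. ty x = \<one> \<rightarrowtail> (E i j \<odot> E j i) \<and> mul i j i \<cdot> x = un i"
proof -
  obtain v where [simp]: "ty v = \<one> \<rightarrowtail> (K j \<odot> R j)" and v: "p j \<cdot> v = \<eta>"
    using herm[of j] by (auto simp: hermitian_def)
  have unit: "\<rho> i \<cdot> (Id (R i) \<otimes> \<eta>) = Id (R i)"
    using modules(1)[of i] by (simp add: right_module_def)
  \<comment> \<open>The preimage \<open>v\<close> of the unit is inserted between the two legs of
    \<open>w\<close>; the inner pairing then returns \<eta> and leaves \<open>w i\<close>, which
    represents the unit.\<close>
  let ?x = "(r i j \<otimes> r j i) \<cdot> ((Id (R i) \<otimes> v \<otimes> Id (K i)) \<cdot> w i)"
  have "mul i j i \<cdot> ?x = (mul i j i \<cdot> (r i j \<otimes> r j i)) \<cdot> ((Id (R i) \<otimes> v \<otimes> Id (K i)) \<cdot> w i)"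
    by (simp del: ich)
  also have "\<dots> = r i i \<cdot> (((\<rho> i \<cdot> (Id (R i) \<otimes> (p j \<cdot> v))) \<otimes> Id (K i)) \<cdot> w i)"
    unfolding mul_arrow by (simp del: restriction_balanced)
  also have "\<dots> = un i" unfolding v unit by (simp add: un_def)
  finally show ?thesis by (intro exI[of _ ?x]) simp
qed

theorem linking_of_hermitian: "linking E mul un inv"
  unfolding linking_def
  using mul_assoc mul_unit inv_mul inv_inv mul_full by simp

end

section \<open>Calculus of linkings, symmetry and reflexivity\<close>

context strict_linear_ribbon_category
begin

lemma linking_ty:
  assumes "linking P m u s"
  shows "P i j \<in> Ob C" "ty (m i j k) = (P i j \<odot> P j k) \<rightarrowtail> P i k" "ty (u i) = \<one> \<rightarrowtail> P i i"
    "ty (s i j) = P i j \<rightarrowtail> P j i"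
  using assms by (simp_all add: linking_def)

lemma linking_laws:
  assumes "linking P m u s"
  shows "m i k l \<cdot> (m i j k \<otimes> Id (P k l)) = m i j l \<cdot> (Id (P i j) \<otimes> m j k l)"
    "m i i j \<cdot> (u i \<otimes> Id (P i j)) = Id (P i j)" "m i j j \<cdot> (Id (P i j) \<otimes> u j) = Id (P i j)"
    "s i k \<cdot> m i j k = m k j i \<cdot> (s j k \<otimes> s i j) \<cdot> br (P i j) (P j k)"
    "s j i \<cdot> s i j = tw (P i j)"
    "\<exists>w. ty w = \<one> \<rightarrowtail> (P i j \<odot> P j i) \<and> m i j i \<cdot> w = u i"
  using assms unfolding linking_def by blast+

lemma linking_assoc:
  assumes L: "linking P m u s" and "ty x = U \<rightarrowtail> P i j" "ty y = V \<rightarrowtail> P j k" "ty z = W \<rightarrowtail> P k l"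
  shows "m i k l \<cdot> ((m i j k \<cdot> (x \<otimes> y)) \<otimes> z) = m i j l \<cdot> (x \<otimes> (m j k l \<cdot> (y \<otimes> z)))"
  using precomp[OF linking_laws(1)[OF L, of i k l j], of "x \<otimes> y \<otimes> z"] assms(2-) linking_ty[OF L] by simp

lemma linking_unit:
  assumes L: "linking P m u s" and x: "ty x = U \<rightarrowtail> P i j"
  shows "m i i j \<cdot> (u i \<otimes> x) = x" "m i j j \<cdot> (x \<otimes> u j) = x"
proof -
  note [simp] = x linking_ty[OF L]
  have "m i i j \<cdot> (u i \<otimes> x) = (m i i j \<cdot> (u i \<otimes> Id (P i j))) \<cdot> x"
    using coscalar_tensor(1)[of "u i" "P i i" x U "P i j"] by simp
  then show "m i i j \<cdot> (u i \<otimes> x) = x" unfolding linking_laws(2)[OF L] by simp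
  have "m i j j \<cdot> (x \<otimes> u j) = (m i j j \<cdot> (Id (P i j) \<otimes> u j)) \<cdot> x"
    using coscalar_tensor(2)[of "u j" "P j j" x U "P i j"] by simp
  then show "m i j j \<cdot> (x \<otimes> u j) = x" unfolding linking_laws(3)[OF L] by simp
qed

lemma linking_swap:
  "linking P m u s \<Longrightarrow>
    linking (\<lambda>i j. P (\<not> i) (\<not> j)) (\<lambda>i j k. m (\<not> i) (\<not> j) (\<not> k)) (\<lambda>i. u (\<not> i)) (\<lambda>i j. s (\<not> i) (\<not> j))"
  by (simp add: linking_def)

lemma linked_sym: "linked A B \<Longrightarrow> linked B A"
  unfolding linked_def corner_def using linking_swap by force

lemma linking_transport:
  assumes L: "linking P m u s"
    and f: "\<And>i j. ty (f i j) = P i j \<rightarrowtail> Q i j" "\<And>i j. ty (f' i j) = Q i j \<rightarrowtail> P i j"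
    and inv: "\<And>i j. f' i j \<cdot> f i j = Id (P i j)" "\<And>i j. f i j \<cdot> f' i j = Id (Q i j)"
  shows "linking Q (\<lambda>i j k. f i k \<cdot> m i j k \<cdot> (f' i j \<otimes> f' j k)) (\<lambda>i. f i i \<cdot> u i) (\<lambda>i j. f j i \<cdot> s i j \<cdot> f' i j)"
proof -
  note [simp] = linking_ty[OF L] f inv linking_assoc[OF L] linking_unit[OF L]
  have [simp]: "Q i j \<in> Ob C" for i j
    using ty_Ob(2)[OF f(1)] .
  have [simp]: "f' i j \<cdot> (f i j \<cdot> x) = x" if "ty x = U \<rightarrowtail> P i j" for x U i j
    using comp_eq_tail[OF inv(1), of x U] that by simp
  have anti: "(f k i \<cdot> s i k \<cdot> f' i k) \<cdot> (f i k \<cdot> m i j k \<cdot> (f' i j \<otimes> f' j k)) =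
      (f k i \<cdot> m k j i \<cdot> (f' k j \<otimes> f' j i)) \<cdot> ((f k j \<cdot> s j k \<cdot> f' j k) \<otimes> (f j i \<cdot> s i j \<cdot> f' i j)) \<cdot> br (Q i j) (Q j k)"
    for i j k
  proof -
    have "(f k i \<cdot> s i k \<cdot> f' i k) \<cdot> (f i k \<cdot> m i j k \<cdot> (f' i j \<otimes> f' j k)) = f k i \<cdot> (s i k \<cdot> m i j k) \<cdot> (f' i j \<otimes> f' j k)"
      by simp
    also have "\<dots> = f k i \<cdot> m k j i \<cdot> (s j k \<otimes> s i j) \<cdot> (br (P i j) (P j k) \<cdot> (f' i j \<otimes> f' j k))"
      unfolding linking_laws(4)[OF L, of i k j] by simp
    also have "br (P i j) (P j k) \<cdot> (f' i j \<otimes> f' j k) = (f' j k \<otimes> f' i j) \<cdot> br (Q i j) (Q j k)"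
      by (rule br_nat) simp_all
    finally show ?thesis by simp
  qed
  have tws: "(f i j \<cdot> s j i \<cdot> f' j i) \<cdot> (f j i \<cdot> s i j \<cdot> f' i j) = tw (Q i j)" for i j
  proof -
    have "(f i j \<cdot> s j i \<cdot> f' j i) \<cdot> (f j i \<cdot> s i j \<cdot> f' i j) = f i j \<cdot> (s j i \<cdot> s i j) \<cdot> f' i j"
      by simp
    also have "s j i \<cdot> s i j = tw (P i j)" by (rule linking_laws(5)[OF L])
    also have "f i j \<cdot> tw (P i j) = tw (Q i j) \<cdot> f i j" by (rule tw_nat[symmetric]) simp
    finally show ?thesis by simp
  qed
  have full: "\<exists>w. ty w = \<one> \<rightarrowtail> (Q i j \<odot> Q j i) \<and> (f i i \<cdot> m i j i \<cdot> (f' i j \<otimes> f' j i)) \<cdot> w = f i i \<cdot> u i" for i j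
  proof -
    obtain w where w: "ty w = \<one> \<rightarrowtail> (P i j \<odot> P j i)" "m i j i \<cdot> w = u i"
      using linking_laws(6)[OF L, of i j] by blast
    show ?thesis
      by (rule exI[of _ "(f i j \<otimes> f j i) \<cdot> w"]) (simp add: w)
  qed
  show ?thesis
    unfolding linking_def using anti tws full by simp
qed

text \<open>A corner must be the given algebra itself, whereas constructions only yield it up to
  isomorphism. Transport of structure closes this gap.\<close>

lemma linkedI:
  assumes L: "linking P m u s"
    and \<phi>: "\<And>i. ty (\<phi> i) = P i i \<rightarrowtail> alg_ob (A i)" "\<And>i. iso (\<phi> i)"
      "\<And>i. \<phi> i \<cdot> m i i i = mult (A i) \<cdot> (\<phi> i \<otimes> \<phi> i)" "\<And>i. \<phi> i \<cdot> u i = unit (A i)"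
      "\<And>i. \<phi> i \<cdot> s i i = reversion (A i) \<cdot> \<phi> i"
    and A: "\<And>i. ty (mult (A i)) = (alg_ob (A i) \<odot> alg_ob (A i)) \<rightarrowtail> alg_ob (A i)"
      "\<And>i. ty (reversion (A i)) = alg_ob (A i) \<rightarrowtail> alg_ob (A i)"
  shows "linked (A False) (A True)"
proof -
  note [simp] = linking_ty[OF L] \<phi>(1) A
  have [simp]: "alg_ob (A i) \<in> Ob C" for i
    using ty_Ob(2)[OF \<phi>(1)] .
  have "\<exists>\<phi>'. ty \<phi>' = alg_ob (A i) \<rightarrowtail> P i i \<and> \<phi>' \<cdot> \<phi> i = Id (P i i) \<and> \<phi> i \<cdot> \<phi>' = Id (alg_ob (A i))" for i
    using isoE[OF \<phi>(2)[of i]] \<phi>(1)[of i] by (metis ty_inject)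
  then obtain \<phi>' where \<phi>' [simp]: "\<And>i. ty (\<phi>' i) = alg_ob (A i) \<rightarrowtail> P i i" "\<And>i. \<phi>' i \<cdot> \<phi> i = Id (P i i)"
    "\<And>i. \<phi> i \<cdot> \<phi>' i = Id (alg_ob (A i))"
    by metis
  \<comment> \<open>Only the diagonal entries are replaced; the transporting isomorphisms are
    identities off the diagonal.\<close>
  define Q where "Q i j = (if i = j then alg_ob (A i) else P i j)" for i j
  define f where "f i j = (if i = j then \<phi> i else Id (P i j))" for i j
  define f' where "f' i j = (if i = j then \<phi>' i else Id (P i j))" for i j
  have M: "linking Q (\<lambda>i j k. f i k \<cdot> m i j k \<cdot> (f' i j \<otimes> f' j k)) (\<lambda>i. f i i \<cdot> u i) (\<lambda>i j. f j i \<cdot> s i j \<cdot> f' i j)"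
    by (rule linking_transport[OF L]) (simp_all add: Q_def f_def f'_def)
  have c: "corner Q (\<lambda>i j k. f i k \<cdot> m i j k \<cdot> (f' i j \<otimes> f' j k)) (\<lambda>i. f i i \<cdot> u i) (\<lambda>i j. f j i \<cdot> s i j \<cdot> f' i j) i (A i)" for i
  proof -
    have "\<phi> i \<cdot> (m i i i \<cdot> (\<phi>' i \<otimes> \<phi>' i)) = (mult (A i) \<cdot> (\<phi> i \<otimes> \<phi> i)) \<cdot> (\<phi>' i \<otimes> \<phi>' i)"
      by (rule comp_eq_tail[OF \<phi>(3)]) simp_all
    moreover have "\<phi> i \<cdot> (s i i \<cdot> \<phi>' i) = (reversion (A i) \<cdot> \<phi> i) \<cdot> \<phi>' i"
      by (rule comp_eq_tail[OF \<phi>(5)]) simp_all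
    ultimately show ?thesis
      by (simp add: corner_def Q_def f_def f'_def \<phi>(4))
  qed
  show ?thesis
    unfolding linked_def using M c by blast
qed

end

context jandl
begin

lemma linking_regular: "linking (\<lambda>i j. X) (\<lambda>i j k. m) (\<lambda>i. \<eta>) (\<lambda>i j. \<sigma>)"
  unfolding linking_def
  using algebra_laws reversion_laws br_nat[of \<sigma> X X \<sigma> X X] by (auto intro!: exI[of _ "\<eta> \<otimes> \<eta>"])

lemma linked_refl: "linked A A"
  unfolding linked_def corner_def using linking_regular by (intro exI conjI) simp_all

lemma tensor_over_splits:
  assumes complete: idempotent_complete and mods: "right_module A N \<rho>" "left_module A M l"
  shows "\<exists>E e r. splits (N \<odot> M) (tensor_over A N \<rho> M l) E e r"
proof -
  have [simp]: "N \<in> Ob C" "M \<in> Ob C" "ty \<rho> = (N \<odot> X) \<rightarrowtail> N" "ty l = (X \<odot> M) \<rightarrowtail> M"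
    using mods by (simp_all add: right_module_def left_module_def)
  let ?T = "tensor_over A N \<rho> M l"
  have "?T \<cdot> ?T = ?T"
    by (rule balanced_tensor_over[OF mods _ tensor_over_balanced[OF mods]]) simp
  moreover have "?T \<in> Hom (N \<odot> M) (N \<odot> M)" by simp
  moreover have "N \<odot> M \<in> Ob C" by simp
  ultimately show ?thesis
    using complete unfolding idempotent_complete_def by blast
qed

text \<open>A preimage \<open>w\<close> of the unit at \<open>i\<close> is a dual basis: by
  associativity both expansions in \<open>w\<close> are multiplication by that unit.\<close>

lemma hermitian_of_linking:
  assumes L: "linking P m' u s" and c: "corner P m' u s True A"
    and w: "ty w = \<one> \<rightarrowtail> (P i True \<odot> P True i)" "m' i True i \<cdot> w = u i"
  shows "hermitian (P i True) (P True i) (m' i True True) (m' True True i) (m' True i True) (s i True) (s True i) w"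
proof -
  note [simp] = linking_ty[OF L]
  have c': "P True True = X" "m' True True True = m" "u True = \<eta>" "s True True = \<sigma>"
    using c by (simp_all add: corner_def)
  have a: "m' i True True \<cdot> (Id (P i True) \<otimes> m' True i True) \<cdot> (w \<otimes> Id (P i True)) = Id (P i True)"
  proof -
    have "m' i True True \<cdot> (Id (P i True) \<otimes> m' True i True) \<cdot> (w \<otimes> Id (P i True)) =
        m' i i True \<cdot> ((m' i True i \<cdot> w) \<otimes> Id (P i True))"
      unfolding linking_laws(1)[OF L, symmetric] using w(1) by simp
    then show ?thesis using linking_laws(2)[OF L] by (simp add: w(2))
  qed
  have b: "m' True True i \<cdot> (m' True i True \<otimes> Id (P True i)) \<cdot> (Id (P True i) \<otimes> w) = Id (P True i)"
  proof -
    have "m' True True i \<cdot> (m' True i True \<otimes> Id (P True i)) \<cdot> (Id (P True i) \<otimes> w) =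
        m' True i i \<cdot> (Id (P True i) \<otimes> (m' i True i \<cdot> w))"
      unfolding linking_laws(1)[OF L] using w(1) by simp
    then show ?thesis using linking_laws(3)[OF L] by (simp add: w(2))
  qed
  show ?thesis
    unfolding hermitian_def right_module_def left_module_def c'[symmetric]
    using linking_laws(1-5)[OF L] linking_laws(6)[OF L, of True i] w(1) a b by simp
qed

end

section \<open>Transitivity\<close>

locale linking_pair = jandl C B
  for C :: "('o, 'm, 'k::field) ribbon_structure" (structure) and B :: "('o, 'm) jandl" +
  fixes P :: "bool \<Rightarrow> bool \<Rightarrow> bool \<Rightarrow> 'o" and m' :: "bool \<Rightarrow> bool \<Rightarrow> bool \<Rightarrow> bool \<Rightarrow> 'm"
    and u' :: "bool \<Rightarrow> bool \<Rightarrow> 'm" and s' :: "bool \<Rightarrow> bool \<Rightarrow> bool \<Rightarrow> 'm" and A :: "bool \<Rightarrow> ('o, 'm) jandl"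
  assumes L: "\<And>i. linking (P i) (m' i) (u' i) (s' i)"
    and corner_B: "\<And>i. corner (P i) (m' i) (u' i) (s' i) True B"
    and corner_A: "\<And>i. corner (P i) (m' i) (u' i) (s' i) False (A i)"
    and complete: idempotent_complete
begin

text \<open>The first index of \<open>P\<close> selects one of two linkings that share the corner
  \<open>B\<close>. In the linking built over \<open>B\<close>, each diagonal entry is
  \<open>P i False True\<close> tensored over \<open>B\<close> with \<open>P i True False\<close>,
  and the pairing \<phi> maps it isomorphically onto \<open>A i\<close>.\<close>

lemma linked_composite: "linked (A False) (A True)"
proof -
  note tys [simp] = linking_ty[OF L]
  have "\<exists>w. ty w = \<one> \<rightarrowtail> (P i False True \<odot> P i True False) \<and> m' i False True False \<cdot> w = u' i False" for i
    by (rule linking_laws(6)[OF L])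
  then obtain w where w: "\<And>i. ty (w i) = \<one> \<rightarrowtail> (P i False True \<odot> P i True False)"
    "\<And>i. m' i False True False \<cdot> w i = u' i False"
    by metis
  define \<rho> where "\<rho> i = m' i False True True" for i
  define l where "l i = m' i True True False" for i
  define p where "p i = m' i True False True" for i
  define s where "s i = s' i False True" for i
  define t where "t i = s' i True False" for i
  define R where "R i = P i False True" for i
  define K where "K i = P i True False" for i
  note defs = \<rho>_def l_def p_def s_def t_def R_def K_def
  have h: "hermitian (R i) (K i) (\<rho> i) (l i) (p i) (s i) (t i) (w i)" for i
    unfolding defs by (rule hermitian_of_linking[OF L corner_B w])
  have mods: "right_module B (R i) (\<rho> i)" "left_module B (K i) (l i)" for i
    using h[of i] by (simp_all add: hermitian_def)
  have "\<exists>E e r. splits (R i \<odot> K j) (tensor_over B (R i) (\<rho> i) (K j) (l j)) E e r" for i j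
    by (rule tensor_over_splits[OF complete mods])
  then obtain E e r where spl: "\<And>i j. splits (R i \<odot> K j) (tensor_over B (R i) (\<rho> i) (K j) (l j)) (E i j) (e i j) (r i j)"
    by metis
  interpret F: hermitian_family C B R K \<rho> l p s t w E e r
    by unfold_locales (rule h spl)+
  have assoc [simp]: "m' n i k l \<cdot> ((m' n i j k \<cdot> (x \<otimes> y)) \<otimes> z) = m' n i j l \<cdot> (x \<otimes> (m' n j k l \<cdot> (y \<otimes> z)))"
    if "ty x = U \<rightarrowtail> P n i j" "ty y = V \<rightarrowtail> P n j k" "ty z = W \<rightarrowtail> P n k l" for n i j k l x y z U V W
    by (rule linking_assoc[OF L that])
  define \<phi> where "\<phi> i = m' i False True False \<cdot> e i i" for i
  note [simp del] = F.tys
  have e_ty [simp]: "ty (e i j) = E i j \<rightarrowtail> (P i False True \<odot> P j True False)"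
    "ty (r i j) = (P i False True \<odot> P j True False) \<rightarrowtail> E i j" "E i j \<in> Ob C" for i j
    using F.tys(10,11,3)[of i j] unfolding R_def K_def by simp_all
  have [simp]: "ty (w i) = \<one> \<rightarrowtail> (P i False True \<odot> P i True False)" for i by (rule w)
  have [simp]: "ty (\<phi> i) = E i i \<rightarrowtail> P i False False" for i by (simp add: \<phi>_def)
  have cB: "P i True True = X" for i using corner_B[of i] by (simp add: corner_def)
  have \<phi>r: "\<phi> i \<cdot> r i i = m' i False True False" for i
  proof -
    have "m' i False True False \<cdot> (e i i \<cdot> r i i) = m' i False True False"
      by (rule balanced_factor[OF mods spl, where Z = "P i False False"])
        (simp_all add: defs linking_laws(1)[OF L])
    then show ?thesis by (simp add: \<phi>_def)
  qed
  \<comment> \<open>The inverse of \<phi>: an element a goes to the class of a w1 \<otimes> w2,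
    where w1 \<otimes> w2 is the chosen preimage \<open>w i\<close> of the unit.\<close>
  define \<psi> where "\<psi> i = r i i \<cdot> ((m' i False False True \<otimes> Id (P i True False)) \<cdot> (Id (P i False False) \<otimes> w i))" for i
  have [simp]: "ty (\<psi> i) = P i False False \<rightarrowtail> E i i" for i by (simp add: \<psi>_def)
  have \<phi>\<psi>: "\<phi> i \<cdot> \<psi> i = Id (P i False False)" for i
  proof -
    have "\<phi> i \<cdot> \<psi> i = (\<phi> i \<cdot> r i i) \<cdot> ((m' i False False True \<otimes> Id (P i True False)) \<cdot> (Id (P i False False) \<otimes> w i))"
      unfolding \<psi>_def by simp
    also have "\<dots> = (m' i False True False \<cdot> (m' i False False True \<otimes> Id (P i True False))) \<cdot> (Id (P i False False) \<otimes> w i)"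
      unfolding \<phi>r by (simp del: ich)
    also have "\<dots> = Id (P i False False)"
      unfolding linking_laws(1)[OF L] using w(2)[of i] linking_laws(3)[OF L, of i False False] by simp
    finally show ?thesis .
  qed
  \<comment> \<open>In elements (x y) w1 \<otimes> w2 = x (y w1) \<otimes> w2 = x \<otimes> (y w1)
    w2 = x \<otimes> y, where the second equation is balancing over \<open>B\<close>.\<close>
  have \<psi>\<phi>: "\<psi> i \<cdot> \<phi> i = Id (E i i)" for i
  proof -
    let ?R = "P i False True" and ?K = "P i True False"
    have "(\<psi> i \<cdot> \<phi> i) \<cdot> r i i = \<psi> i \<cdot> m' i False True False" by (simp add: \<phi>r)
    also have "\<dots> = r i i \<cdot> ((m' i False False True \<otimes> Id ?K) \<cdot> ((m' i False True False \<otimes> Id ?R \<otimes> Id ?K) \<cdot> (Id ?R \<otimes> Id ?K \<otimes> w i)))"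
      using coscalar_tensor(2)[of "w i" "?R \<odot> ?K" "m' i False True False" "?R \<odot> ?K" "P i False False", symmetric]
      unfolding \<psi>_def by simp
    also have "(m' i False False True \<otimes> Id ?K) \<cdot> ((m' i False True False \<otimes> Id ?R \<otimes> Id ?K) \<cdot> (Id ?R \<otimes> Id ?K \<otimes> w i))
        = ((m' i False False True \<cdot> (m' i False True False \<otimes> Id ?R)) \<otimes> Id ?K) \<cdot> (Id ?R \<otimes> Id ?K \<otimes> w i)"
      by (rule comp_eq_tail) (simp_all del: tensor_rules(4) assoc)
    also have "r i i \<cdot> \<dots> = r i i \<cdot> ((m' i False False True \<cdot> (m' i False True False \<otimes> Id ?R)) \<otimes> Id ?K) \<cdot> (Id ?R \<otimes> Id ?K \<otimes> w i)"
      by (simp del: ich assoc)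
    also have "m' i False False True \<cdot> (m' i False True False \<otimes> Id ?R) = \<rho> i \<cdot> (Id ?R \<otimes> p i)"
      unfolding linking_laws(1)[OF L] defs ..
    also have "r i i \<cdot> ((\<rho> i \<cdot> (Id ?R \<otimes> p i)) \<otimes> Id ?K) = r i i \<cdot> (Id ?R \<otimes> (l i \<cdot> (p i \<otimes> Id ?K)))"
      using F.restriction_balanced[of "Id ?R" ?R i "p i" "?K \<odot> ?R" "Id ?K" ?K i] by (simp add: defs cB)
    also have "l i \<cdot> (p i \<otimes> Id ?K) = m' i True False False \<cdot> (Id ?K \<otimes> m' i False True False)"
      unfolding defs by (rule linking_laws(1)[OF L])
    also have "r i i \<cdot> (Id ?R \<otimes> \<dots>) \<cdot> (Id ?R \<otimes> Id ?K \<otimes> w i) = r i i \<cdot> (Id ?R \<otimes> (m' i True False False \<cdot> (Id ?K \<otimes> (m' i False True False \<cdot> w i))))"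
      by (simp del: tensor_rules(4))
    also have "\<dots> = Id (E i i) \<cdot> r i i"
      using linking_laws(3)[OF L, of i True False] by (simp add: w(2))
    finally have 1: "(\<psi> i \<cdot> \<phi> i) \<cdot> r i i = Id (E i i) \<cdot> r i i" .
    show ?thesis by (rule split_epi_cancel[OF F.r_e _ _ _ _ 1, where Z = "E i i"]) simp_all
  qed
  have mult: "\<phi> i \<cdot> F.mul i i i = m' i False False False \<cdot> (\<phi> i \<otimes> \<phi> i)" for i
  proof -
    let ?R = "P i False True" and ?K = "P i True False"
    have "(\<phi> i \<cdot> F.mul i i i) \<cdot> (r i i \<otimes> r i i) = \<phi> i \<cdot> (F.mul i i i \<cdot> (r i i \<otimes> r i i))"
      using F.mul_ty[of i i i] by simp
    also have "\<dots> = (\<phi> i \<cdot> r i i) \<cdot> ((\<rho> i \<cdot> (Id ?R \<otimes> p i)) \<otimes> Id ?K)"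
      unfolding F.mul_arrow by (simp add: defs)
    also have "\<dots> = m' i False True False \<cdot> ((m' i False True True \<cdot> (Id ?R \<otimes> m' i True False True)) \<otimes> Id ?K)"
      unfolding \<phi>r by (simp add: defs)
    also have "m' i False True True \<cdot> (Id ?R \<otimes> m' i True False True) = m' i False False True \<cdot> (m' i False True False \<otimes> Id ?R)"
      by (rule linking_laws(1)[OF L, symmetric])
    also have "m' i False True False \<cdot> (\<dots> \<otimes> Id ?K) = (m' i False True False \<cdot> (m' i False False True \<otimes> Id ?K)) \<cdot> (m' i False True False \<otimes> Id ?R \<otimes> Id ?K)"
      by (simp del: assoc tensor_rules(4))
    also have "m' i False True False \<cdot> (m' i False False True \<otimes> Id ?K) = m' i False False False \<cdot> (Id (P i False False) \<otimes> m' i False True False)"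
      by (rule linking_laws(1)[OF L])
    also have "\<dots> \<cdot> (m' i False True False \<otimes> Id ?R \<otimes> Id ?K) = m' i False False False \<cdot> ((\<phi> i \<cdot> r i i) \<otimes> (\<phi> i \<cdot> r i i))"
      unfolding \<phi>r by simp
    finally have 1: "(\<phi> i \<cdot> F.mul i i i) \<cdot> (r i i \<otimes> r i i) = (m' i False False False \<cdot> (\<phi> i \<otimes> \<phi> i)) \<cdot> (r i i \<otimes> r i i)"
      by simp
    show ?thesis
      by (rule split_epi_cancel[OF _ _ _ _ _ 1, where e = "e i i \<otimes> e i i" and E = "E i i \<odot> E i i"
            and W = "(?R \<odot> ?K) \<odot> (?R \<odot> ?K)" and Z = "P i False False"]) (simp_all add: F.r_e)
  qed
  have un: "\<phi> i \<cdot> F.un i = u' i False" for i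
    using comp_eq_tail[OF \<phi>r, of "w i"] by (simp add: F.un_def w(2))
  have inv: "\<phi> i \<cdot> F.inv i i = s' i False False \<cdot> \<phi> i" for i
  proof -
    let ?R = "P i False True" and ?K = "P i True False"
    have "(\<phi> i \<cdot> F.inv i i) \<cdot> r i i = \<phi> i \<cdot> (F.inv i i \<cdot> r i i)"
      using F.inv_ty[of i i] by simp
    also have "\<dots> = (\<phi> i \<cdot> r i i) \<cdot> ((t i \<otimes> s i) \<cdot> br (R i) (K i))"
      unfolding F.inv_arrow by (simp add: defs)
    also have "\<dots> = s' i False False \<cdot> m' i False True False"
      unfolding \<phi>r linking_laws(4)[OF L] by (simp add: defs)
    also have "\<dots> = (s' i False False \<cdot> \<phi> i) \<cdot> r i i"
      by (simp add: \<phi>r)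
    finally have 1: "(\<phi> i \<cdot> F.inv i i) \<cdot> r i i = (s' i False False \<cdot> \<phi> i) \<cdot> r i i" .
    show ?thesis by (rule split_epi_cancel[OF F.r_e _ _ _ _ 1, where Z = "P i False False"]) simp_all
  qed
  have A: "alg_ob (A i) = P i False False" "mult (A i) = m' i False False False" "unit (A i) = u' i False"
    "reversion (A i) = s' i False False" for i
    using corner_A[of i] by (simp_all add: corner_def)
  have "iso (\<phi> i)" for i
    by (rule isoI[OF _ _ \<psi>\<phi> \<phi>\<psi>]) simp_all
  then show ?thesis
    by (intro linkedI[OF F.linking_of_hermitian, of \<phi> A]) (simp_all add: A mult un inv)
qed

end

context jandl
begin

lemma linked_trans:
  assumes "linked D A" "linked E A" idempotent_complete
  shows "linked D E"
proof -
  obtain P m' u s where D: "linking P m' u s" "corner P m' u s False D" "corner P m' u s True A"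
    using assms(1) unfolding linked_def by blast
  obtain P' m'' u' s' where E: "linking P' m'' u' s'" "corner P' m'' u' s' False E" "corner P' m'' u' s' True A"
    using assms(2) unfolding linked_def by blast
  interpret linking_pair C A "\<lambda>i. if i then P' else P" "\<lambda>i. if i then m'' else m'" "\<lambda>i. if i then u' else u"
    "\<lambda>i. if i then s' else s" "\<lambda>i. if i then E else D"
    by unfold_locales (simp_all add: D E assms(3))
  show ?thesis using linked_composite by simp
qed

end

section \<open>From a linking to a module\<close>

context strict_linear_ribbon_category
begin

lemma dual_pair_compare:
  assumes d: "dual_pair X Y \<beta> \<gamma>" and d': "dual_pair X Y' \<beta>' \<gamma>'"
  obtains j j' where "ty j = Y \<rightarrowtail> Y'" "ty j' = Y' \<rightarrowtail> Y" "j \<cdot> j' = Id Y'" "j' \<cdot> j = Id Y"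
    "\<beta>' \<cdot> (Id X \<otimes> j) = \<beta>" "(j \<otimes> Id X) \<cdot> \<gamma> = \<gamma>'"
proof -
  note [simp] = dual_pair_typing[OF d] dual_pair_typing[OF d']
  define j where "j = (Id Y' \<otimes> \<beta>) \<cdot> (\<gamma>' \<otimes> Id Y)"
  define j' where "j' = (Id Y \<otimes> \<beta>') \<cdot> (\<gamma> \<otimes> Id Y')"
  have [simp]: "ty j = Y \<rightarrowtail> Y'" "ty j' = Y' \<rightarrowtail> Y" by (simp_all add: j_def j'_def)
  have j: "\<beta>' \<cdot> (Id X \<otimes> j) = \<beta>"
    unfolding j_def by (rule dual_pair_curry_right[OF d']) simp_all
  have j': "\<beta> \<cdot> (Id X \<otimes> j') = \<beta>'"
    unfolding j'_def by (rule dual_pair_curry_right[OF d]) simp_all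
  have "\<beta>' \<cdot> (Id X \<otimes> (j \<cdot> j')) = (\<beta>' \<cdot> (Id X \<otimes> j)) \<cdot> (Id X \<otimes> j')" by simp
  also have "\<dots> = \<beta>' \<cdot> (Id X \<otimes> Id Y')" unfolding j j' by simp
  finally have 1: "\<beta>' \<cdot> (Id X \<otimes> (j \<cdot> j')) = \<beta>' \<cdot> (Id X \<otimes> Id Y')" .
  have "\<beta> \<cdot> (Id X \<otimes> (j' \<cdot> j)) = (\<beta> \<cdot> (Id X \<otimes> j')) \<cdot> (Id X \<otimes> j)" by simp
  also have "\<dots> = \<beta> \<cdot> (Id X \<otimes> Id Y)" unfolding j j' by simp
  finally have 2: "\<beta> \<cdot> (Id X \<otimes> (j' \<cdot> j)) = \<beta> \<cdot> (Id X \<otimes> Id Y)" .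
  have "(j \<otimes> Id X) \<cdot> \<gamma> = (Id Y' \<otimes> \<beta> \<otimes> Id X) \<cdot> ((\<gamma>' \<otimes> Id Y \<otimes> Id X) \<cdot> \<gamma>)"
    by (simp add: j_def tensor_ident_comp(2) del: ich tensor_rules(4))
  also have "(\<gamma>' \<otimes> Id Y \<otimes> Id X) \<cdot> \<gamma> = (Id Y' \<otimes> Id X \<otimes> \<gamma>) \<cdot> \<gamma>'"
    using coscalar_tensor(1)[of \<gamma>' "Y' \<odot> X" \<gamma> \<one> "Y \<odot> X"] coscalar_tensor(2)[of \<gamma> "Y \<odot> X" \<gamma>' \<one> "Y' \<odot> X"]
    by (simp add: ident_tensor_split)
  also have "(Id Y' \<otimes> \<beta> \<otimes> Id X) \<cdot> \<dots> = (Id Y' \<otimes> ((\<beta> \<otimes> Id X) \<cdot> (Id X \<otimes> \<gamma>))) \<cdot> \<gamma>'"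
    by (rule comp_eq_tail) (simp_all del: tensor_rules(4))
  also have "\<dots> = \<gamma>'"
    using d by (simp add: dual_pair_def)
  finally show ?thesis
    using dual_pair_test_right[OF d' _ _ 1, of Y'] dual_pair_test_right[OF d _ _ 2, of Y] j that[of j j'] by simp
qed

lemma inv_arr_eq:
  assumes "ty f = U \<rightarrowtail> V" "ty h = V \<rightarrowtail> U" "h \<cdot> f = Id U" "f \<cdot> h = Id V"
  shows "inv_arr f = h"
  unfolding inv_arr_def
proof (rule the_equality)
  show "inverse_arrows f h" using assms by (simp add: inverse_arrows_def)
  fix h' assume "inverse_arrows f h'"
  then have h': "ty h' = V \<rightarrowtail> U" "f \<cdot> h' = Id V" using assms(1) by (simp_all add: inverse_arrows_def)
  have "h \<cdot> (f \<cdot> h') = Id U \<cdot> h'"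
    by (rule comp_eq_tail) (use assms h' in simp_all)
  then show "h' = h" using assms h' by simp
qed

text \<open>Both composites with \<open>s j i\<close> are twists, hence invertible, so
  \<open>s i j\<close> has a left and a right inverse; these coincide.\<close>

lemma linking_inv_iso:
  assumes L: "linking P m u s"
  shows "iso (s i j)"
proof -
  note [simp] = linking_ty[OF L]
  obtain a where a [simp]: "ty a = P i j \<rightarrowtail> P i j" "a \<cdot> tw (P i j) = Id (P i j)"
    using isoE[OF twist_iso[of "P i j"]] by (metis linking_ty(1)[OF L] ob_arrow_ty(2) ty_inject)
  obtain b where b [simp]: "ty b = P j i \<rightarrowtail> P j i" "tw (P j i) \<cdot> b = Id (P j i)"
    using isoE[OF twist_iso[of "P j i"]] by (metis linking_ty(1)[OF L] ob_arrow_ty(2) ty_inject)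
  have 1: "(a \<cdot> s j i) \<cdot> s i j = Id (P i j)"
    using linking_laws(5)[OF L, of j i] by simp
  have 2: "s i j \<cdot> (s j i \<cdot> b) = Id (P j i)"
    using comp_eq_tail[OF linking_laws(5)[OF L, of i j], of b] by simp
  have "a \<cdot> s j i = (a \<cdot> s j i) \<cdot> (s i j \<cdot> (s j i \<cdot> b))" unfolding 2 by simp
  also have "\<dots> = ((a \<cdot> s j i) \<cdot> s i j) \<cdot> (s j i \<cdot> b)" by simp
  also have "\<dots> = s j i \<cdot> b" unfolding 1 by simp
  finally have 3: "a \<cdot> s j i = s j i \<cdot> b" .
  show ?thesis
    by (rule isoI[of _ "P i j" "P j i" "s j i \<cdot> b"]) (use 1 2 3 in \<open>simp_all del: comp_reassoc\<close>)
qed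

end

context frobenius_algebra
begin

lemma linking_modules:
  assumes L: "linking P m' u s" and c: "P b b = X" "m' b b b = m" "u b = \<eta>"
  shows "right_module A (P i b) (m' i b b)" "left_module A (P b i) (m' b b i)"
  unfolding right_module_def left_module_def c[symmetric]
  using linking_ty[OF L] linking_laws(1-3)[OF L] by simp_all

text \<open>The corner \<open>P i i\<close> represents the tensor product over the corner at
  \<open>b\<close> with the pairing itself as restriction. Thus \<open>internal_end\<close> and
  \<open>interpolating\<close> can be met with the given algebras rather than with isomorphic
  copies.\<close>

lemma linking_splits:
  assumes L: "linking P m' u s" and c: "P b b = X" "m' b b b = m" "u b = \<eta>"
  obtains w where "ty w = P i i \<rightarrowtail> (P i b \<odot> P b i)" "m' i b i \<cdot> w = Id (P i i)"
    "splits (P i b \<odot> P b i) (tensor_over A (P i b) (m' i b b) (P b i) (m' b b i)) (P i i)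
       (tensor_over A (P i b) (m' i b b) (P b i) (m' b b i) \<cdot> w) (m' i b i)"
proof -
  note [simp] = linking_ty[OF L]
  note mods = linking_modules[OF L c]
  let ?T = "tensor_over A (P i b) (m' i b b) (P b i) (m' b b i)"
  obtain v where [simp]: "ty v = \<one> \<rightarrowtail> (P i b \<odot> P b i)" and v: "m' i b i \<cdot> v = u i"
    using linking_laws(6)[OF L, of i b] by blast
  \<comment> \<open>Multiplying the preimage \<open>v\<close> of the unit by elements of the corner
    gives a section of the pairing; composing it with the idempotent makes it the embedding.\<close>
  define w where "w = (Id (P i b) \<otimes> m' b i i) \<cdot> (v \<otimes> Id (P i i))"
  have w [simp]: "ty w = P i i \<rightarrowtail> (P i b \<odot> P b i)" by (simp add: w_def)
  have T [simp]: "ty ?T = (P i b \<odot> P b i) \<rightarrowtail> (P i b \<odot> P b i)"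
    by (rule tensor_over_ty) (simp_all add: c(1)[symmetric])
  have kT: "m' i b i \<cdot> ?T = m' i b i"
    by (rule balanced_tensor_over[OF mods]) (simp_all add: linking_laws(1)[OF L])
  have kw: "m' i b i \<cdot> w = Id (P i i)"
  proof -
    have "m' i b i \<cdot> w = (m' i b i \<cdot> (Id (P i b) \<otimes> m' b i i)) \<cdot> (v \<otimes> Id (P i i))" by (simp add: w_def)
    also have "\<dots> = Id (P i i)"
      unfolding linking_laws(1)[OF L, symmetric] using linking_laws(2)[OF L] by (simp add: v)
    finally show ?thesis .
  qed
  have "w \<cdot> m' i b i = (Id (P i b) \<otimes> (m' b i i \<cdot> (Id (P b i) \<otimes> m' i b i))) \<cdot> (v \<otimes> Id (P i b) \<otimes> Id (P b i))"
  proof -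
    have "(v \<otimes> Id (P i i)) \<cdot> m' i b i = (Id (P i b) \<otimes> Id (P b i) \<otimes> m' i b i) \<cdot> (v \<otimes> Id (P i b) \<otimes> Id (P b i))"
      using coscalar_tensor(1)[of v "P i b \<odot> P b i" "m' i b i" "P i b \<odot> P b i" "P i i", symmetric] by simp
    then have "w \<cdot> m' i b i = (Id (P i b) \<otimes> m' b i i) \<cdot> ((Id (P i b) \<otimes> Id (P b i) \<otimes> m' i b i) \<cdot> (v \<otimes> Id (P i b) \<otimes> Id (P b i)))"
      by (simp add: w_def del: ich)
    also have "\<dots> = (Id (P i b) \<otimes> (m' b i i \<cdot> (Id (P b i) \<otimes> m' i b i))) \<cdot> (v \<otimes> Id (P i b) \<otimes> Id (P b i))"
      by (rule comp_eq_tail) (simp_all del: tensor_rules(4))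
    finally show ?thesis .
  qed
  then have "?T \<cdot> (w \<cdot> m' i b i) = ?T \<cdot> ((Id (P i b) \<otimes> (m' b i i \<cdot> (Id (P b i) \<otimes> m' i b i))) \<cdot> (v \<otimes> Id (P i b) \<otimes> Id (P b i)))"
    by (simp only:)
  also have "m' b i i \<cdot> (Id (P b i) \<otimes> m' i b i) = m' b b i \<cdot> (m' b i b \<otimes> Id (P b i))"
    by (rule linking_laws(1)[OF L, symmetric])
  also have "?T \<cdot> ((Id (P i b) \<otimes> \<dots>) \<cdot> (v \<otimes> Id (P i b) \<otimes> Id (P b i))) =
      (?T \<cdot> (Id (P i b) \<otimes> m' b b i)) \<cdot> ((Id (P i b) \<otimes> m' b i b \<otimes> Id (P b i)) \<cdot> (v \<otimes> Id (P i b) \<otimes> Id (P b i)))"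
    by (simp add: tensor_ident_comp del: ich tensor_rules(4))
  also have "?T \<cdot> (Id (P i b) \<otimes> m' b b i) = ?T \<cdot> (m' i b b \<otimes> Id (P b i))"
    by (rule tensor_over_balanced[OF mods, symmetric])
  also have "\<dots> \<cdot> ((Id (P i b) \<otimes> m' b i b \<otimes> Id (P b i)) \<cdot> (v \<otimes> Id (P i b) \<otimes> Id (P b i))) =
      ?T \<cdot> ((m' i b b \<cdot> (Id (P i b) \<otimes> m' b i b) \<cdot> (v \<otimes> Id (P i b))) \<otimes> Id (P b i))"
    by (simp add: tensor_ident_comp del: ich tensor_rules(4))
  also have "m' i b b \<cdot> (Id (P i b) \<otimes> m' b i b) = m' i i b \<cdot> (m' i b i \<otimes> Id (P i b))"
    by (rule linking_laws(1)[OF L, symmetric])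
  also have "\<dots> \<cdot> (v \<otimes> Id (P i b)) = Id (P i b)"
    using linking_laws(2)[OF L, of i b] by (simp add: v)
  finally have "?T \<cdot> (w \<cdot> m' i b i) = ?T" by simp
  moreover have "m' i b i \<cdot> (?T \<cdot> w) = m' i b i \<cdot> w"
    by (rule comp_eq_tail[OF kT]) simp_all
  ultimately have "splits (P i b \<odot> P b i) ?T (P i i) (?T \<cdot> w) (m' i b i)"
    by (simp add: splits_def kw)
  then show ?thesis using that[OF w kw] by simp
qed

end

context strict_linear_ribbon_category
begin

lemma scale_one: "ty f = U \<rightarrowtail> V \<Longrightarrow> scale_arr C 1 f = f"
  using Hom_vector_space[of U V] ty_Ob[of f U V] by (simp add: fin_dim_vector_space_def)

lemma frobenius_iso_ident: "sym_special_frobenius A \<Longrightarrow> frobenius_iso A A (Id (alg_ob A))"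
  by (simp add: sym_special_frobenius_def Let_def frobenius_iso_def iso_ident)

text \<open>The module is the entry \<open>P False True\<close> and \<open>E\<close> is
  \<open>B\<close> itself, with \<nu> = 1. What has to be found is an identification of
  \<open>P True False\<close> with the dual of the module that respects actions, splittings and the
  anti-involution.\<close>

lemma jandl_related_of_linked:
  assumes "jandl_algebra A" "jandl_algebra B" "linked A B"
  shows "jandl_related A B"
proof -
  interpret A: jandl C A
    using assms(1) by unfold_locales (simp_all add: jandl_algebra_def)
  interpret B: jandl C B
    using assms(2) by unfold_locales (simp_all add: jandl_algebra_def)
  obtain P mm u s where L: "linking P mm u s" and cA: "corner P mm u s False A" and cB: "corner P mm u s True B"
    using assms(3) unfolding linked_def by blast
  have A: "P False False = alg_ob A" "mm False False False = mult A" "u False = unit A" "s False False = reversion A"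
    and B: "P True True = alg_ob B" "mm True True True = mult B" "u True = unit B" "s True True = reversion B"
    using cA cB by (simp_all add: corner_def)
  define X Y l h k \<rho> \<xi> \<mu> where "X = P False True" and "Y = P True False" and "l = mm False False True"
    and "h = mm False True False" and "k = mm True False True" and "\<rho> = mm True False False"
    and "\<xi> = mm False True True" and "\<mu> = mm True True False"
  define s1 t where "s1 = s False True" and "t = s True False"
  note defs = X_def Y_def l_def h_def k_def \<rho>_def \<xi>_def \<mu>_def s1_def t_def A[symmetric] B[symmetric]
  have tys [simp]: "X \<in> Ob C" "Y \<in> Ob C" "ty l = (alg_ob A \<odot> X) \<rightarrowtail> X" "ty h = (X \<odot> Y) \<rightarrowtail> alg_ob A"
    "ty k = (Y \<odot> X) \<rightarrowtail> alg_ob B" "ty \<rho> = (Y \<odot> alg_ob A) \<rightarrowtail> Y" "ty \<xi> = (X \<odot> alg_ob B) \<rightarrowtail> X"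
    "ty \<mu> = (alg_ob B \<odot> Y) \<rightarrowtail> Y" "ty s1 = X \<rightarrowtail> Y" "ty t = Y \<rightarrowtail> X"
    unfolding defs using linking_ty[OF L] by simp_all
  have laws: "l \<cdot> (h \<otimes> Id X) = \<xi> \<cdot> (Id X \<otimes> k)" "\<rho> \<cdot> (Id Y \<otimes> h) = \<mu> \<cdot> (k \<otimes> Id Y)"
    "h \<cdot> (Id X \<otimes> \<rho>) = mult A \<cdot> (h \<otimes> Id (alg_ob A))" "h \<cdot> (l \<otimes> Id Y) = mult A \<cdot> (Id (alg_ob A) \<otimes> h)"
    "k \<cdot> (Id Y \<otimes> \<xi>) = mult B \<cdot> (k \<otimes> Id (alg_ob B))" "\<xi> \<cdot> (Id X \<otimes> unit B) = Id X" "\<mu> \<cdot> (unit B \<otimes> Id Y) = Id Y"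
    unfolding defs using linking_laws(1-3)[OF L] by simp_all
  have anti: "reversion A \<cdot> h = h \<cdot> (t \<otimes> s1) \<cdot> br X Y" "reversion B \<cdot> k = k \<cdot> (s1 \<otimes> t) \<cdot> br Y X"
    "t \<cdot> \<rho> = l \<cdot> (reversion A \<otimes> t) \<cdot> br Y (alg_ob A)" "t \<cdot> s1 = tw X"
    unfolding defs using linking_laws(4,5)[OF L] by simp_all
  have modA: "right_module A Y \<rho>" "left_module A X l"
    unfolding X_def Y_def l_def \<rho>_def using A.linking_modules[OF L A(1-3)] by simp_all
  define T where "T = tensor_over A Y \<rho> X l"
  have [simp]: "ty T = (Y \<odot> X) \<rightarrowtail> (Y \<odot> X)" by (simp add: T_def)
  obtain wB where [simp]: "ty wB = alg_ob B \<rightarrowtail> (Y \<odot> X)" and wB: "k \<cdot> wB = Id (alg_ob B)"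
    and sB: "splits (Y \<odot> X) T (alg_ob B) (T \<cdot> wB) k"
    using A.linking_splits[OF L A(1-3), of True] unfolding defs T_def by metis
  define Q where "Q = tensor_over B X \<xi> Y \<mu>"
  have [simp]: "ty Q = (X \<odot> Y) \<rightarrowtail> (X \<odot> Y)" by (simp add: Q_def)
  obtain wA where [simp]: "ty wA = alg_ob A \<rightarrowtail> (X \<odot> Y)" and wA: "h \<cdot> wA = Id (alg_ob A)"
    and sA: "splits (X \<odot> Y) Q (alg_ob A) (Q \<cdot> wA) h"
    using B.linking_splits[OF L B(1-3), of False] unfolding defs Q_def by metis
  define eB where "eB = T \<cdot> wB"
  define eA where "eA = Q \<cdot> wA"
  have [simp]: "ty eB = alg_ob B \<rightarrowtail> (Y \<odot> X)" "ty eA = alg_ob A \<rightarrowtail> (X \<odot> Y)"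
    by (simp_all add: eB_def eA_def)
  have eBk: "k \<cdot> eB = Id (alg_ob B)" "eB \<cdot> k = T" and eAh: "h \<cdot> eA = Id (alg_ob A)" "eA \<cdot> h = Q"
    using sA sB by (simp_all add: splits_def eA_def eB_def)
  define \<beta> where "\<beta> = counit A \<cdot> h"
  have [simp]: "ty \<beta> = (X \<odot> Y) \<rightarrowtail> \<one>" by (simp add: \<beta>_def)
  have \<beta>h: "A.\<kappa> \<cdot> (h \<otimes> Id (alg_ob A)) = \<beta> \<cdot> (Id X \<otimes> \<rho>)" "A.\<kappa> \<cdot> (Id (alg_ob A) \<otimes> h) = \<beta> \<cdot> (l \<otimes> Id Y)"
    using laws(3,4) by (simp_all add: A.\<kappa>_def \<beta>_def)
  have T1: "(\<beta> \<otimes> Id X) \<cdot> (Id X \<otimes> T) = \<xi> \<cdot> (Id X \<otimes> k)" and T2: "(Id Y \<otimes> \<beta>) \<cdot> (T \<otimes> Id Y) = \<mu> \<cdot> (k \<otimes> Id Y)"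
    using A.tensor_over_pairing[OF modA, of \<beta> h] \<beta>h laws(1,2) by (simp_all add: T_def)
  have \<xi>e: "(\<beta> \<otimes> Id X) \<cdot> (Id X \<otimes> eB) = \<xi>"
  proof -
    have "(\<beta> \<otimes> Id X) \<cdot> (Id X \<otimes> eB) = ((\<beta> \<otimes> Id X) \<cdot> (Id X \<otimes> T)) \<cdot> (Id X \<otimes> wB)"
      by (simp add: eB_def)
    also have "\<dots> = \<xi>" unfolding T1 by (simp add: wB)
    finally show ?thesis .
  qed
  have \<mu>e: "(Id Y \<otimes> \<beta>) \<cdot> (eB \<otimes> Id Y) = \<mu>"
  proof -
    have "(Id Y \<otimes> \<beta>) \<cdot> (eB \<otimes> Id Y) = ((Id Y \<otimes> \<beta>) \<cdot> (T \<otimes> Id Y)) \<cdot> (wB \<otimes> Id Y)"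
      by (simp add: eB_def)
    also have "\<dots> = \<mu>" unfolding T2 by (simp add: wB)
    finally show ?thesis .
  qed
  \<comment> \<open>The copairing of \<beta> is the embedded unit of \<open>B\<close>: by
    \<open>\<xi>e\<close> and \<open>\<mu>e\<close> the zigzags become the unit laws for the actions
    of \<open>B\<close> on \<open>X\<close> and \<open>Y\<close>.\<close>
  define \<gamma> where "\<gamma> = eB \<cdot> unit B"
  have [simp]: "ty \<gamma> = \<one> \<rightarrowtail> (Y \<odot> X)" by (simp add: \<gamma>_def)
  have dp: "dual_pair X Y \<beta> \<gamma>"
  proof -
    have "(\<beta> \<otimes> Id X) \<cdot> (Id X \<otimes> \<gamma>) = ((\<beta> \<otimes> Id X) \<cdot> (Id X \<otimes> eB)) \<cdot> (Id X \<otimes> unit B)"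
      "(Id Y \<otimes> \<beta>) \<cdot> (\<gamma> \<otimes> Id Y) = ((Id Y \<otimes> \<beta>) \<cdot> (eB \<otimes> Id Y)) \<cdot> (unit B \<otimes> Id Y)"
      by (simp_all add: \<gamma>_def)
    then show ?thesis unfolding \<xi>e \<mu>e laws(6,7) by (simp add: dual_pair_def)
  qed
  obtain j j' where [simp]: "ty j = Y \<rightarrowtail> du X" "ty j' = du X \<rightarrowtail> Y" and jj: "j \<cdot> j' = Id (du X)" "j' \<cdot> j = Id Y"
    and j: "right_ev X \<cdot> (Id X \<otimes> j) = \<beta>" "(j \<otimes> Id X) \<cdot> \<gamma> = right_coev X"
    using dual_pair_compare[OF dp right_dual_pair[of X]] by auto
  have jx [simp]: "j' \<cdot> (j \<cdot> x) = x" if "ty x = U \<rightarrowtail> Y" for x U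
    using comp_eq_tail[OF jj(2), of x] that by simp
  have jx' [simp]: "j \<cdot> (j' \<cdot> x) = x" if "ty x = U \<rightarrowtail> du X" for x U
    using comp_eq_tail[OF jj(1), of x] that by simp
  note jj [simp]
  define da where "da = dual_action A X l"
  have [simp]: "ty da = (du X \<odot> alg_ob A) \<rightarrowtail> du X" by (simp add: da_def)
  have ev_da: "ev X \<cdot> (da \<otimes> Id X) = ev X \<cdot> (Id (du X) \<otimes> l)"
    unfolding da_def by (rule ev_dual_action) simp_all
  \<comment> \<open>The dual action is characterized through \<open>ev X\<close>, with the dual on
    the left, while \<beta> has \<open>X\<close> on the left. \<open>twisted_pairing_action\<close>
    translates between \<beta>0 and \<beta>, so that \<open>j\<close> can be shown to respect the
    right actions.\<close>
  define \<beta>0 where "\<beta>0 = ev X \<cdot> (j \<otimes> Id X)"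
  have [simp]: "ty \<beta>0 = (Y \<odot> X) \<rightarrowtail> \<one>" by (simp add: \<beta>0_def)
  have \<beta>0: "\<beta> = \<beta>0 \<cdot> (Id Y \<otimes> tw X) \<cdot> br X Y"
  proof -
    have "\<beta> = ev X \<cdot> (Id (du X) \<otimes> tw X) \<cdot> (br X (du X) \<cdot> (Id X \<otimes> j))"
      unfolding j(1)[symmetric] by (simp add: right_ev_eq)
    also have "br X (du X) \<cdot> (Id X \<otimes> j) = (j \<otimes> Id X) \<cdot> br X Y"
      by (rule br_nat) simp_all
    finally show ?thesis by (simp add: \<beta>0_def)
  qed
  have daj: "da \<cdot> (j \<otimes> Id (alg_ob A)) = j \<cdot> \<rho>"
  proof -
    have "(\<beta> \<cdot> (Id X \<otimes> (\<rho> \<cdot> (Id Y \<otimes> tw (alg_ob A))))) \<cdot> br (alg_ob A) (X \<odot> Y)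
        = (\<beta> \<cdot> (Id X \<otimes> \<rho>)) \<cdot> ((Id X \<otimes> Id Y \<otimes> tw (alg_ob A)) \<cdot> br (alg_ob A) (X \<odot> Y))"
      by (simp add: tensor_ident_comp(1) del: ich tensor_rules(4))
    also have "\<dots> = A.\<kappa> \<cdot> (Id (alg_ob A) \<otimes> tw (alg_ob A)) \<cdot> ((h \<otimes> Id (alg_ob A)) \<cdot> br (alg_ob A) (X \<odot> Y))"
      unfolding \<beta>h(1)[symmetric] by simp
    also have "(h \<otimes> Id (alg_ob A)) \<cdot> br (alg_ob A) (X \<odot> Y) = br (alg_ob A) (alg_ob A) \<cdot> (Id (alg_ob A) \<otimes> h)"
      by (rule br_nat[symmetric]) simp_all
    also have "A.\<kappa> \<cdot> (Id (alg_ob A) \<otimes> tw (alg_ob A)) \<cdot> \<dots> = A.\<kappa> \<cdot> (Id (alg_ob A) \<otimes> h)"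
      by (subst (2) A.form_symmetric) simp
    finally have "\<beta> \<cdot> (l \<otimes> Id Y) = (\<beta> \<cdot> (Id X \<otimes> (\<rho> \<cdot> (Id Y \<otimes> tw (alg_ob A))))) \<cdot> br (alg_ob A) (X \<odot> Y)"
      unfolding \<beta>h(2) by (simp only:)
    then have "\<beta>0 \<cdot> (Id Y \<otimes> l) = \<beta>0 \<cdot> (\<rho> \<otimes> Id X)"
      by (subst (asm) twisted_pairing_action[OF _ _ _ _ _ _ \<beta>0]) simp_all
    then have 1: "ev X \<cdot> (j \<otimes> l) = ev X \<cdot> ((j \<cdot> \<rho>) \<otimes> Id X)" by (simp add: \<beta>0_def)
    have "ev X \<cdot> ((da \<cdot> (j \<otimes> Id (alg_ob A))) \<otimes> Id X) = (ev X \<cdot> (da \<otimes> Id X)) \<cdot> (j \<otimes> Id (alg_ob A) \<otimes> Id X)"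
      by (simp del: tensor_rules(4))
    also have "\<dots> = ev X \<cdot> ((j \<cdot> \<rho>) \<otimes> Id X)" unfolding ev_da 1[symmetric] by simp
    finally have 2: "ev X \<cdot> ((da \<cdot> (j \<otimes> Id (alg_ob A))) \<otimes> Id X) = ev X \<cdot> ((j \<cdot> \<rho>) \<otimes> Id X)" .
    show ?thesis
      by (rule dual_pair_test_left[OF left_dual_pair _ _ 2, where Z = "Y \<odot> alg_ob A"]) simp_all
  qed
  have Tj: "tensor_over A (du X) da X l = (j \<otimes> Id X) \<cdot> T \<cdot> (j' \<otimes> Id X)"
  proof -
    have "tensor_over A (du X) da X l = tensor_over A (du X) da X l \<cdot> ((j \<otimes> Id X) \<cdot> (j' \<otimes> Id X))" by simp
    also have "\<dots> = (da \<otimes> l) \<cdot> ((Id (du X) \<otimes> A.q \<otimes> Id X) \<cdot> (j \<otimes> Id X)) \<cdot> (j' \<otimes> Id X)"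
      by (simp add: A.tensor_over_q del: ich)
    also have "(Id (du X) \<otimes> A.q \<otimes> Id X) \<cdot> (j \<otimes> Id X) = (j \<otimes> Id (alg_ob A) \<otimes> Id (alg_ob A) \<otimes> Id X) \<cdot> (Id Y \<otimes> A.q \<otimes> Id X)"
      using coscalar_tensor(2)[of A.q "alg_ob A \<odot> alg_ob A" j Y "du X", symmetric] by simp
    also have "(da \<otimes> l) \<cdot> \<dots> = ((da \<cdot> (j \<otimes> Id (alg_ob A))) \<otimes> l) \<cdot> (Id Y \<otimes> A.q \<otimes> Id X)"
    proof -
      have "(da \<otimes> l) \<cdot> (j \<otimes> Id (alg_ob A) \<otimes> Id (alg_ob A) \<otimes> Id X) = (da \<cdot> (j \<otimes> Id (alg_ob A))) \<otimes> l"
        by (simp del: tensor_rules(4)) simp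
      then show ?thesis by (rule comp_eq_tail) simp_all
    qed
    also have "\<dots> = (j \<otimes> Id X) \<cdot> T"
      unfolding daj T_def A.tensor_over_q
      by (rule comp_eq_tail[symmetric]) simp_all
    finally show ?thesis .
  qed
  \<comment> \<open>The splitting of \<open>Y \<odot> X\<close> onto \<open>B\<close>, transported
    along \<open>j\<close> to \<open>du X \<odot> X\<close>.\<close>
  define e where "e = (j \<otimes> Id X) \<cdot> eB"
  define r where "r = k \<cdot> (j' \<otimes> Id X)"
  have er [simp]: "ty e = alg_ob B \<rightarrowtail> (du X \<odot> X)" "ty r = (du X \<odot> X) \<rightarrowtail> alg_ob B"
    by (simp_all add: e_def r_def)
  have rj: "r \<cdot> ((j \<otimes> Id X) \<cdot> x) = k \<cdot> x" if "ty x = U \<rightarrowtail> (Y \<odot> X)" for x U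
    using comp_eq_tail[of "j' \<otimes> Id X" "j \<otimes> Id X" "Id (Y \<odot> X)" x U "Y \<odot> X"] that by (simp add: r_def)
  have spl: "splits (du X \<odot> X) (tensor_over A (du X) da X l) (alg_ob B) e r"
  proof -
    have "e \<cdot> r = (j \<otimes> Id X) \<cdot> (eB \<cdot> k) \<cdot> (j' \<otimes> Id X)"
      by (simp add: e_def r_def del: ich)
    then show ?thesis
      using rj[of eB] by (simp add: splits_def Tj eBk) (simp add: e_def)
  qed
  have \<xi>r: "(right_ev X \<otimes> Id X) \<cdot> (Id X \<otimes> e) = \<xi>"
  proof -
    have "(right_ev X \<otimes> Id X) \<cdot> (Id X \<otimes> e) = ((right_ev X \<otimes> Id X) \<cdot> (Id X \<otimes> j \<otimes> Id X)) \<cdot> (Id X \<otimes> eB)"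
      by (simp add: e_def tensor_ident_comp(1) del: ich)
    also have "(right_ev X \<otimes> Id X) \<cdot> (Id X \<otimes> j \<otimes> Id X) = \<beta> \<otimes> Id X"
      unfolding j(1)[symmetric] by simp
    finally show ?thesis unfolding \<xi>e .
  qed
  define \<mu>' where "\<mu>' = (Id (du X) \<otimes> right_ev X) \<cdot> (e \<otimes> Id (du X))"
  have [simp]: "ty \<mu>' = (alg_ob B \<odot> du X) \<rightarrowtail> du X" by (simp add: \<mu>'_def)
  have \<mu>'j: "\<mu>' \<cdot> (Id (alg_ob B) \<otimes> j) = j \<cdot> \<mu>"
  proof -
    have "\<mu>' \<cdot> (Id (alg_ob B) \<otimes> j) = (Id (du X) \<otimes> right_ev X) \<cdot> ((j \<otimes> Id X \<otimes> j) \<cdot> (eB \<otimes> Id Y))"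
      by (simp add: \<mu>'_def e_def)
    also have "\<dots> = (j \<otimes> \<beta>) \<cdot> (eB \<otimes> Id Y)"
      by (rule comp_eq_tail) (simp_all add: j(1))
    also have "\<dots> = j \<cdot> ((Id Y \<otimes> \<beta>) \<cdot> (eB \<otimes> Id Y))"
      using scalar_tensor(2)[of \<beta> "X \<odot> Y" j Y "du X"] by simp
    finally show ?thesis unfolding \<mu>e .
  qed
  have internal: "internal_end A X l B e r"
  proof -
    have "r \<cdot> (Id (du X) \<otimes> right_ev X \<otimes> Id X) \<cdot> (e \<otimes> e) =
        r \<cdot> ((Id (du X) \<otimes> ((right_ev X \<otimes> Id X) \<cdot> (Id X \<otimes> e))) \<cdot> (e \<otimes> Id (alg_ob B)))"
    proof -
      have "e \<otimes> e = (Id (du X) \<otimes> Id X \<otimes> e) \<cdot> (e \<otimes> Id (alg_ob B))" by simp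
      moreover have "(Id (du X) \<otimes> right_ev X \<otimes> Id X) \<cdot> ((Id (du X) \<otimes> Id X \<otimes> e) \<cdot> (e \<otimes> Id (alg_ob B))) =
          (Id (du X) \<otimes> ((right_ev X \<otimes> Id X) \<cdot> (Id X \<otimes> e))) \<cdot> (e \<otimes> Id (alg_ob B))"
        by (rule comp_eq_tail) (simp_all del: tensor_rules(4))
      ultimately show ?thesis by (simp del: ich)
    qed
    also have "\<dots> = r \<cdot> ((j \<otimes> Id X) \<cdot> ((Id Y \<otimes> \<xi>) \<cdot> (eB \<otimes> Id (alg_ob B))))"
    proof -
      have "e \<otimes> Id (alg_ob B) = (j \<otimes> Id X \<otimes> Id (alg_ob B)) \<cdot> (eB \<otimes> Id (alg_ob B))"
        by (simp add: e_def del: tensor_rules(4))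
      moreover have "(Id (du X) \<otimes> \<xi>) \<cdot> ((j \<otimes> Id X \<otimes> Id (alg_ob B)) \<cdot> (eB \<otimes> Id (alg_ob B))) = (j \<otimes> \<xi>) \<cdot> (eB \<otimes> Id (alg_ob B))"
        by (rule comp_eq_tail) simp_all
      ultimately show ?thesis unfolding \<xi>r by simp
    qed
    also have "\<dots> = (k \<cdot> (Id Y \<otimes> \<xi>)) \<cdot> (eB \<otimes> Id (alg_ob B))"
      by (subst rj) simp_all
    also have "\<dots> = mult B"
      unfolding laws(5) by (simp add: eBk)
    finally have 1: "mult B = r \<cdot> (Id (du X) \<otimes> right_ev X \<otimes> Id X) \<cdot> (e \<otimes> e)" by simp
    have "r \<cdot> right_coev X = k \<cdot> \<gamma>" unfolding j(2)[symmetric] by (rule rj) simp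
    also have "\<dots> = unit B" using comp_eq_tail[OF eBk(1), of "unit B"] by (simp add: \<gamma>_def)
    finally show ?thesis using 1 spl by (simp add: internal_end_def da_def)
  qed
  have interp: "interpolating A X l B e"
  proof -
    let ?e = "(Id X \<otimes> j) \<cdot> eA" and ?r = "h \<cdot> (Id X \<otimes> j')"
    have Qj: "tensor_over B X \<xi> (du X) \<mu>' = (Id X \<otimes> j) \<cdot> Q \<cdot> (Id X \<otimes> j')"
    proof -
      have "tensor_over B X \<xi> (du X) \<mu>' = tensor_over B X \<xi> (du X) \<mu>' \<cdot> ((Id X \<otimes> j) \<cdot> (Id X \<otimes> j'))" by simp
      also have "\<dots> = (\<xi> \<otimes> \<mu>') \<cdot> ((Id X \<otimes> B.q \<otimes> Id (du X)) \<cdot> (Id X \<otimes> j)) \<cdot> (Id X \<otimes> j')"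
        by (simp add: B.tensor_over_q del: ich)
      also have "(Id X \<otimes> B.q \<otimes> Id (du X)) \<cdot> (Id X \<otimes> j) = (Id X \<otimes> Id (alg_ob B) \<otimes> Id (alg_ob B) \<otimes> j) \<cdot> (Id X \<otimes> B.q \<otimes> Id Y)"
        using coscalar_tensor(1)[of B.q "alg_ob B \<odot> alg_ob B" j Y "du X", symmetric] by simp
      also have "(\<xi> \<otimes> \<mu>') \<cdot> \<dots> = (\<xi> \<otimes> (\<mu>' \<cdot> (Id (alg_ob B) \<otimes> j))) \<cdot> (Id X \<otimes> B.q \<otimes> Id Y)"
      proof -
        have "(\<xi> \<otimes> \<mu>') \<cdot> (Id X \<otimes> Id (alg_ob B) \<otimes> Id (alg_ob B) \<otimes> j) = \<xi> \<otimes> (\<mu>' \<cdot> (Id (alg_ob B) \<otimes> j))"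
          by (simp del: tensor_rules(4)) simp
        then show ?thesis by (rule comp_eq_tail) simp_all
      qed
      also have "\<dots> = (Id X \<otimes> j) \<cdot> Q"
        unfolding \<mu>'j Q_def B.tensor_over_q
        by (rule comp_eq_tail[symmetric]) simp_all
      finally show ?thesis .
    qed
    have hj: "?r \<cdot> ((Id X \<otimes> j) \<cdot> x) = h \<cdot> x" if "ty x = U \<rightarrowtail> (X \<odot> Y)" for x U
      using comp_eq_tail[of "Id X \<otimes> j'" "Id X \<otimes> j" "Id (X \<odot> Y)" x U "X \<odot> Y"] that by simp
    have "?e \<cdot> ?r = (Id X \<otimes> j) \<cdot> (eA \<cdot> h) \<cdot> (Id X \<otimes> j')"
      by (simp del: ich)
    then have s: "splits (X \<odot> du X) (tensor_over B X \<xi> (du X) \<mu>') (alg_ob A) ?e ?r"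
      using hj[of eA] by (simp add: splits_def Qj eAh del: ich)
    have "?r \<cdot> (l \<otimes> Id (du X)) \<cdot> (Id (alg_ob A) \<otimes> ?e) = ?r \<cdot> ((Id X \<otimes> j) \<cdot> ((l \<otimes> Id Y) \<cdot> (Id (alg_ob A) \<otimes> eA)))"
    proof -
      have "Id (alg_ob A) \<otimes> ?e = (Id (alg_ob A) \<otimes> Id X \<otimes> j) \<cdot> (Id (alg_ob A) \<otimes> eA)"
        by (simp del: tensor_rules(4))
      moreover have "(l \<otimes> Id (du X)) \<cdot> ((Id (alg_ob A) \<otimes> Id X \<otimes> j) \<cdot> (Id (alg_ob A) \<otimes> eA)) =
          (Id X \<otimes> j) \<cdot> ((l \<otimes> Id Y) \<cdot> (Id (alg_ob A) \<otimes> eA))"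
        by (rule comp_eq_tail2) simp_all
      ultimately show ?thesis by (simp del: ich tensor_rules(4))
    qed
    also have "\<dots> = (h \<cdot> (l \<otimes> Id Y)) \<cdot> (Id (alg_ob A) \<otimes> eA)"
      by (subst hj) simp_all
    also have "\<dots> = mult A" unfolding laws(4) by (simp add: eAh)
    finally have 1: "?r \<cdot> (l \<otimes> Id (du X)) \<cdot> (Id (alg_ob A) \<otimes> ?e) = mult A" .
    have "?r \<cdot> (Id X \<otimes> da) \<cdot> (?e \<otimes> Id (alg_ob A)) = ?r \<cdot> ((Id X \<otimes> (da \<cdot> (j \<otimes> Id (alg_ob A)))) \<cdot> (eA \<otimes> Id (alg_ob A)))"
    proof -
      have "?e \<otimes> Id (alg_ob A) = (Id X \<otimes> j \<otimes> Id (alg_ob A)) \<cdot> (eA \<otimes> Id (alg_ob A))" by simp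
      moreover have "(Id X \<otimes> da) \<cdot> ((Id X \<otimes> j \<otimes> Id (alg_ob A)) \<cdot> (eA \<otimes> Id (alg_ob A))) = (Id X \<otimes> (da \<cdot> (j \<otimes> Id (alg_ob A)))) \<cdot> (eA \<otimes> Id (alg_ob A))"
        by (rule comp_eq_tail) simp_all
      ultimately show ?thesis by (simp del: ich)
    qed
    also have "\<dots> = ?r \<cdot> ((Id X \<otimes> j) \<cdot> ((Id X \<otimes> \<rho>) \<cdot> (eA \<otimes> Id (alg_ob A))))"
      unfolding daj by simp
    also have "\<dots> = (h \<cdot> (Id X \<otimes> \<rho>)) \<cdot> (eA \<otimes> Id (alg_ob A))"
      by (subst hj) simp_all
    also have "\<dots> = mult A" unfolding laws(3) by (simp add: eAh)
    finally have 2: "?r \<cdot> (Id X \<otimes> da) \<cdot> (?e \<otimes> Id (alg_ob A)) = mult A" .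
    show ?thesis
      unfolding interpolating_def \<xi>r \<mu>'_def[symmetric] da_def[symmetric]
      using s 1 2 by (intro exI[of _ "alg_ob A"] exI[of _ ?e] exI[of _ ?r] exI[of _ "Id (alg_ob A)"])
        (simp add: bimodule_hom_def iso_ident del: comp_reassoc ich)
  qed
  obtain t' where [simp]: "ty t' = X \<rightarrowtail> Y" and t': "t' \<cdot> t = Id Y" "t \<cdot> t' = Id X"
    using isoE[OF linking_inv_iso[OF L, of True False]] linking_ty(4)[OF L, of True False]
    unfolding t_def[symmetric] X_def[symmetric] Y_def[symmetric] by (metis ty_inject)
  have s1: "t' \<cdot> tw X = s1"
    using comp_eq_tail[OF t'(1), of s1] by (simp add: anti(4))
  \<comment> \<open>Since \<open>s1 = t' \<cdot> tw X\<close>, this choice gives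
    \<open>g \<cdot> tw X = j \<cdot> s1\<close>, while the inverse of \<open>g\<close> is
    \<open>t \<cdot> j'\<close>. These are the two legs of the anti-involution of the linking in
    \<open>induced_reversion\<close>.\<close>
  define g where "g = j \<cdot> t'"
  have [simp]: "ty g = X \<rightarrowtail> du X" by (simp add: g_def)
  have gi: "(t \<cdot> j') \<cdot> g = Id X" "g \<cdot> (t \<cdot> j') = Id (du X)"
    using comp_eq_tail[OF t'(1), of j'] by (simp_all add: g_def t')
  have inv_g: "inv_arr g = t \<cdot> j'"
    by (rule inv_arr_eq[OF _ _ gi]) simp_all
  have rev_B: "reversion B = induced_reversion X g e r"
  proof -
    have "induced_reversion X g e r = r \<cdot> ((g \<cdot> tw X) \<otimes> (t \<cdot> j')) \<cdot> (br (du X) X \<cdot> ((j \<otimes> Id X) \<cdot> eB))"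
      by (simp add: induced_reversion_def inv_g e_def)
    also have "br (du X) X \<cdot> ((j \<otimes> Id X) \<cdot> eB) = (Id X \<otimes> j) \<cdot> (br Y X \<cdot> eB)"
      by (rule comp_eq_tail2[OF br_nat]) simp_all
    also have "r \<cdot> ((g \<cdot> tw X) \<otimes> (t \<cdot> j')) \<cdot> \<dots> = r \<cdot> ((j \<otimes> Id X) \<cdot> ((s1 \<otimes> t) \<cdot> (br Y X \<cdot> eB)))"
      by (simp add: g_def s1[symmetric])
    also have "\<dots> = (k \<cdot> (s1 \<otimes> t) \<cdot> br Y X) \<cdot> eB"
      by (subst rj) simp_all
    also have "\<dots> = reversion B"
      unfolding anti(2)[symmetric] by (simp add: eBk)
    finally show ?thesis by simp
  qed
  \<comment> \<open>\<open>S\<close> is the braiding with twist by which the right evaluation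
    differs from the left one. \<open>G1\<close> rewrites the form of \<open>g\<close> by this
    comparison; \<open>G2\<close> says that the form is invariant under \<open>S\<close>, which
    comes from invariance of the counit under the reversion. Cancelling \<open>S\<close> gives the
    symmetry of \<open>g\<close>.\<close>
  define S where "S = (Id X \<otimes> tw X) \<cdot> br X X"
  have [simp]: "ty S = (X \<odot> X) \<rightarrowtail> (X \<odot> X)" by (simp add: S_def)
  have "iso S"
    unfolding S_def by (rule iso_comp[of _ _ "X \<odot> X" "X \<odot> X" "X \<odot> X"]) (simp_all add: iso_tensor iso_ident twist_iso braiding_iso)
  define G where "G = right_ev X \<cdot> (Id X \<otimes> g)"
  have [simp]: "ty G = (X \<odot> X) \<rightarrowtail> \<one>" by (simp add: G_def)
  have G: "G = \<beta> \<cdot> (Id X \<otimes> t')"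
    unfolding G_def g_def j(1)[symmetric] by simp
  have G1: "G = (ev X \<cdot> (g \<otimes> Id X)) \<cdot> S"
  proof -
    have "G = \<beta>0 \<cdot> (Id Y \<otimes> tw X) \<cdot> (br X Y \<cdot> (Id X \<otimes> t'))"
      unfolding G by (subst \<beta>0) simp
    also have "br X Y \<cdot> (Id X \<otimes> t') = (t' \<otimes> Id X) \<cdot> br X X"
      by (rule br_nat) simp_all
    finally show ?thesis by (simp add: \<beta>0_def S_def g_def)
  qed
  have G2: "G = G \<cdot> S"
  proof -
    have "\<beta> = counit A \<cdot> (reversion A \<cdot> h)"
      using comp_eq_tail[OF A.counit_reversion, of h] by (simp add: \<beta>_def)
    also have "\<dots> = \<beta> \<cdot> (t \<otimes> s1) \<cdot> br X Y"
      unfolding anti(1) by (simp add: \<beta>_def)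
    finally have b: "\<beta> = \<beta> \<cdot> (t \<otimes> s1) \<cdot> br X Y" .
    have "G = \<beta> \<cdot> (t \<otimes> s1) \<cdot> (br X Y \<cdot> (Id X \<otimes> t'))"
      unfolding G by (subst b) simp
    also have "br X Y \<cdot> (Id X \<otimes> t') = (t' \<otimes> Id X) \<cdot> br X X"
      by (rule br_nat) simp_all
    also have "\<beta> \<cdot> (t \<otimes> s1) \<cdot> \<dots> = \<beta> \<cdot> (Id X \<otimes> s1) \<cdot> br X X"
      by (simp add: t')
    also have "\<dots> = G \<cdot> S"
      unfolding G S_def s1[symmetric] by simp
    finally show ?thesis .
  qed
  have sym: "ev X \<cdot> (g \<otimes> Id X) = right_ev X \<cdot> (Id X \<otimes> g)"
  proof -
    have 1: "(ev X \<cdot> (g \<otimes> Id X)) \<cdot> S = G \<cdot> S"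
      by (rule trans[OF G1[symmetric] G2])
    show ?thesis
      unfolding G_def[symmetric] by (rule iso_cancel_right[OF \<open>iso S\<close> _ _ _ 1, where W = \<one>]) simp_all
  qed
  have g_dual: "g = scale_arr C 1 (left_dual_arr g \<cdot> \<delta> X)"
  proof -
    have [simp]: "ty (left_dual_arr g) = du (du X) \<rightarrowtail> du X" by (rule left_dual_arr_ty) simp
    have 1: "ev X \<cdot> (g \<otimes> Id X) = ev X \<cdot> ((left_dual_arr g \<cdot> \<delta> X) \<otimes> Id X)"
      unfolding sym by (rule ev_left_dual_\<delta>[symmetric]) simp_all
    have "g = left_dual_arr g \<cdot> \<delta> X"
      by (rule dual_pair_test_left[OF left_dual_pair _ _ 1, where Z = X]) simp_all
    then show ?thesis using scale_one[of "left_dual_arr g \<cdot> \<delta> X" X "du X"] by simp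
  qed
  have g_hom: "left_module_hom A X l (du X) (conj_action A X l) g"
  proof -
    have [simp]: "ty (conj_action A X l) = (alg_ob A \<odot> du X) \<rightarrowtail> du X"
      by (rule conj_action_ty) simp_all
    have "t \<cdot> (\<rho> \<cdot> (t' \<otimes> Id (alg_ob A))) = l \<cdot> (reversion A \<otimes> t) \<cdot> (br Y (alg_ob A) \<cdot> (t' \<otimes> Id (alg_ob A)))"
      using comp_eq_tail[OF anti(3), of "t' \<otimes> Id (alg_ob A)"] by simp
    also have "br Y (alg_ob A) \<cdot> (t' \<otimes> Id (alg_ob A)) = (Id (alg_ob A) \<otimes> t') \<cdot> br X (alg_ob A)"
      by (rule br_nat) simp_all
    also have "l \<cdot> (reversion A \<otimes> t) \<cdot> \<dots> = l \<cdot> ((reversion A \<otimes> Id X) \<cdot> br X (alg_ob A))"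
      by (simp add: t')
    also have "(reversion A \<otimes> Id X) \<cdot> br X (alg_ob A) = br X (alg_ob A) \<cdot> (Id X \<otimes> reversion A)"
      by (rule br_nat[symmetric]) simp_all
    finally have "t' \<cdot> (t \<cdot> (\<rho> \<cdot> (t' \<otimes> Id (alg_ob A)))) = t' \<cdot> (l \<cdot> (br X (alg_ob A) \<cdot> (Id X \<otimes> reversion A)))"
      by (simp only:)
    then have \<rho>t: "\<rho> \<cdot> (t' \<otimes> Id (alg_ob A)) = t' \<cdot> (l \<cdot> (br X (alg_ob A) \<cdot> (Id X \<otimes> reversion A)))"
      using comp_eq_tail[OF t'(1), of "\<rho> \<cdot> (t' \<otimes> Id (alg_ob A))"] by simp
    have "da \<cdot> ((j \<otimes> Id (alg_ob A)) \<cdot> (t' \<otimes> Id (alg_ob A))) = j \<cdot> (\<rho> \<cdot> (t' \<otimes> Id (alg_ob A)))"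
      by (rule comp_eq_tail2[OF daj]) simp_all
    then have dg: "da \<cdot> (g \<otimes> Id (alg_ob A)) = g \<cdot> l \<cdot> br X (alg_ob A) \<cdot> (Id X \<otimes> reversion A)"
      unfolding \<rho>t by (simp add: g_def)
    have "right_ev X \<cdot> (Id X \<otimes> (conj_action A X l \<cdot> (Id (alg_ob A) \<otimes> g)))
        = (right_ev X \<cdot> (Id X \<otimes> conj_action A X l)) \<cdot> (Id X \<otimes> Id (alg_ob A) \<otimes> g)"
      by (simp del: tensor_rules(4))
    also have "\<dots> = (right_ev X \<cdot> (Id X \<otimes> g)) \<cdot> ((l \<cdot> br X (alg_ob A) \<cdot> (Id X \<otimes> reversion A)) \<otimes> Id X)"
      by (subst right_ev_conj_action) simp_all
    also have "\<dots> = ev X \<cdot> ((da \<cdot> (g \<otimes> Id (alg_ob A))) \<otimes> Id X)"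
      unfolding sym[symmetric] dg by simp
    also have "\<dots> = (ev X \<cdot> (da \<otimes> Id X)) \<cdot> (g \<otimes> Id (alg_ob A) \<otimes> Id X)"
      by (simp del: tensor_rules(4))
    also have "\<dots> = (ev X \<cdot> (g \<otimes> Id X)) \<cdot> (Id X \<otimes> l)"
      unfolding ev_da by simp
    finally have 1: "right_ev X \<cdot> (Id X \<otimes> (g \<cdot> l)) = right_ev X \<cdot> (Id X \<otimes> (conj_action A X l \<cdot> (Id (alg_ob A) \<otimes> g)))"
      unfolding sym by simp
    show ?thesis
      unfolding left_module_hom_def
      using dual_pair_test_right[OF right_dual_pair _ _ 1, of "alg_ob A \<odot> X"] by simp
  qed
  have "jandl_isomorphic B B"
    unfolding jandl_isomorphic_def
    using assms(2) frobenius_iso_ident[OF B.frobenius] by (auto intro!: exI[of _ "Id (alg_ob B)"])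
  then show ?thesis
    unfolding jandl_related_def
    using modA(2) internal B.frobenius interp g_hom isoI[OF _ _ gi] g_dual rev_B
    by (intro exI[of _ X] exI[of _ l] exI[of _ B] exI[of _ e] exI[of _ r] exI[of _ g] exI[of _ 1]) simp
qed

lemma scale_ty [simp]: "ty f = U \<rightarrowtail> V \<Longrightarrow> ty (scale_arr C a f) = U \<rightarrowtail> V"
  using Hom_vector_space[of U V] ty_Ob[of f U V] by (simp add: fin_dim_vector_space_def)

lemma comp_scale:
  "ty f = U \<rightarrowtail> V \<Longrightarrow> ty g = V \<rightarrowtail> W \<Longrightarrow> scale_arr C a g \<cdot> f = scale_arr C a (g \<cdot> f)"
  "ty f = U \<rightarrowtail> V \<Longrightarrow> ty g = V \<rightarrowtail> W \<Longrightarrow> g \<cdot> scale_arr C a f = scale_arr C a (g \<cdot> f)"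
  using comp_scale_left[of f U V g W a] comp_scale_right[of f U V g W a] by simp_all

lemma tensor_scale:
  "ty f = U \<rightarrowtail> V \<Longrightarrow> ty g = W \<rightarrowtail> Z \<Longrightarrow> scale_arr C a f \<otimes> g = scale_arr C a (f \<otimes> g)"
  "ty f = U \<rightarrowtail> V \<Longrightarrow> ty g = W \<rightarrowtail> Z \<Longrightarrow> f \<otimes> scale_arr C a g = scale_arr C a (f \<otimes> g)"
  using tensor_scale_left[of f g a] tensor_scale_right[of f g a] by simp_all

end

section \<open>The context formed by a module and its dual\<close>

locale module_over = jandl C A
  for C :: "('o, 'm, 'k::field) ribbon_structure" (structure) and A :: "('o, 'm) jandl" +
  fixes M :: 'o and l :: 'm
  assumes module: "left_module A M l"
begin

definition N where "N = du M"
definition \<rho> where "\<rho> = dual_action A M l"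
definition d where "d = right_ev M"
definition b where "b = right_coev M"
text \<open>Made so that \<kappa>(h(x, y), a) = d(x, y a); the two legs of \<open>q\<close> undo the
  form.\<close>

definition h where "h = ((d \<cdot> (Id M \<otimes> \<rho>)) \<otimes> Id X) \<cdot> (Id M \<otimes> Id N \<otimes> q)"
definition T where "T = tensor_over A N \<rho> M l"

lemma module_ty [simp]: "M \<in> Ob C" "ty l = (X \<odot> M) \<rightarrowtail> M"
  using module by (simp_all add: left_module_def)

lemma tys [simp]:
  "N \<in> Ob C" "ty \<rho> = (N \<odot> X) \<rightarrowtail> N" "ty d = (M \<odot> N) \<rightarrowtail> \<one>" "ty b = \<one> \<rightarrowtail> (N \<odot> M)" "ty (ev M) = (N \<odot> M) \<rightarrowtail> \<one>"
  by (simp_all add: N_def \<rho>_def d_def b_def)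

lemma derived_tys [simp]: "ty h = (M \<odot> N) \<rightarrowtail> X" "ty T = (N \<odot> M) \<rightarrowtail> (N \<odot> M)"
  by (simp_all add: h_def T_def)

lemma pairs: "dual_pair N M (ev M) (cv M)" "dual_pair M N d b"
  using left_dual_pair[of M] right_dual_pair[of M] by (simp_all add: N_def d_def b_def)

lemma action_laws: "l \<cdot> (m \<otimes> Id M) = l \<cdot> (Id X \<otimes> l)" "l \<cdot> (\<eta> \<otimes> Id M) = Id M"
  using module by (simp_all add: left_module_def)

lemma action_assoc [simp]:
  assumes "ty a = U \<rightarrowtail> X" "ty c = V \<rightarrowtail> X" "ty x = W \<rightarrowtail> M"
  shows "l \<cdot> ((m \<cdot> (a \<otimes> c)) \<otimes> x) = l \<cdot> (a \<otimes> (l \<cdot> (c \<otimes> x)))"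
  using precomp[OF action_laws(1), of "a \<otimes> c \<otimes> x"] assms by simp

lemma ev_action: "ev M \<cdot> (\<rho> \<otimes> Id M) = ev M \<cdot> (Id N \<otimes> l)"
  unfolding \<rho>_def N_def by (rule ev_dual_action) simp_all

lemma ev_action_elem:
  assumes "ty y = U \<rightarrowtail> N" "ty a = V \<rightarrowtail> X" "ty x = W \<rightarrowtail> M"
  shows "ev M \<cdot> ((\<rho> \<cdot> (y \<otimes> a)) \<otimes> x) = ev M \<cdot> (y \<otimes> (l \<cdot> (a \<otimes> x)))"
  using precomp[OF ev_action, of "y \<otimes> a \<otimes> x"] assms by simp

lemma dual_module: "right_module A N \<rho>"
proof -
  have "ev M \<cdot> ((\<rho> \<cdot> (Id N \<otimes> m)) \<otimes> Id M) = ev M \<cdot> ((\<rho> \<cdot> (\<rho> \<otimes> Id X)) \<otimes> Id M)"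
  proof -
    have "ev M \<cdot> ((\<rho> \<cdot> (y \<otimes> (m \<cdot> (a \<otimes> c)))) \<otimes> x) = ev M \<cdot> ((\<rho> \<cdot> ((\<rho> \<cdot> (y \<otimes> a)) \<otimes> c)) \<otimes> x)"
      if "ty y = U \<rightarrowtail> N" "ty a = V \<rightarrowtail> X" "ty c = V' \<rightarrowtail> X" "ty x = W \<rightarrowtail> M" for y a c x U V V' W
      using that by (simp add: ev_action_elem)
    from this[of "Id N" N "Id X" X "Id X" X "Id M" M] show ?thesis by simp
  qed
  then have 1: "\<rho> \<cdot> (Id N \<otimes> m) = \<rho> \<cdot> (\<rho> \<otimes> Id X)"
    by (rule dual_pair_test_left[OF pairs(1), rotated -1]) simp_all
  have "ev M \<cdot> ((\<rho> \<cdot> (Id N \<otimes> \<eta>)) \<otimes> Id M) = ev M \<cdot> (Id N \<otimes> Id M)"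
    using ev_action_elem[of "Id N" N \<eta> \<one> "Id M" M] by (simp add: action_laws)
  then have 2: "\<rho> \<cdot> (Id N \<otimes> \<eta>) = Id N"
    by (rule dual_pair_test_left[OF pairs(1), rotated -1]) simp_all
  show ?thesis using 1 2 by (simp add: right_module_def)
qed

lemma dual_action_laws: "\<rho> \<cdot> (\<rho> \<otimes> Id X) = \<rho> \<cdot> (Id N \<otimes> m)" "\<rho> \<cdot> (Id N \<otimes> \<eta>) = Id N"
  using dual_module by (simp_all add: right_module_def)

lemma dual_action_assoc [simp]:
  assumes "ty y = U \<rightarrowtail> N" "ty a = V \<rightarrowtail> X" "ty c = W \<rightarrowtail> X"
  shows "\<rho> \<cdot> ((\<rho> \<cdot> (y \<otimes> a)) \<otimes> c) = \<rho> \<cdot> (y \<otimes> (m \<cdot> (a \<otimes> c)))"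
  using precomp[OF dual_action_laws(1), of "y \<otimes> a \<otimes> c"] assms by simp

text \<open>The first equation is the defining transposition. The second needs symmetry of \<kappa>
  to bring the algebra strand to the other side, and \<open>twisted_pairing_action\<close> to use
  that the dual action is adjoint for \<open>ev M\<close> although \<open>d\<close> is the right
  evaluation.\<close>

lemma form_h: "\<kappa> \<cdot> (h \<otimes> Id X) = d \<cdot> (Id M \<otimes> \<rho>)" "\<kappa> \<cdot> (Id X \<otimes> h) = d \<cdot> (l \<otimes> Id N)"
proof -
  show 1: "\<kappa> \<cdot> (h \<otimes> Id X) = d \<cdot> (Id M \<otimes> \<rho>)"
    unfolding h_def using dual_pair_curry_left[OF form_dual_pair, of "d \<cdot> (Id M \<otimes> \<rho>)" "M \<odot> N"]
    by (simp add: ident_tensor_split)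
  have "\<kappa> \<cdot> (Id X \<otimes> h) = \<kappa> \<cdot> (Id X \<otimes> tw X) \<cdot> (br X X \<cdot> (Id X \<otimes> h))"
    by (subst form_symmetric) simp
  also have "br X X \<cdot> (Id X \<otimes> h) = (h \<otimes> Id X) \<cdot> br X (M \<odot> N)"
    by (rule br_nat) simp_all
  also have "\<kappa> \<cdot> (Id X \<otimes> tw X) \<cdot> \<dots> = (\<kappa> \<cdot> (h \<otimes> Id X)) \<cdot> ((Id M \<otimes> Id N \<otimes> tw X) \<cdot> br X (M \<odot> N))"
    by simp
  also have "\<dots> = (d \<cdot> (Id M \<otimes> (\<rho> \<cdot> (Id N \<otimes> tw X)))) \<cdot> br X (M \<odot> N)"
    unfolding 1 by (simp add: tensor_ident_comp(1) del: ich tensor_rules(4))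
  also have "\<dots> = d \<cdot> (l \<otimes> Id N)"
    by (rule twisted_pairing_action[THEN iffD2, OF _ _ _ _ _ _ _ ev_action[symmetric], symmetric])
      (simp_all add: d_def N_def right_ev_eq)
  finally show "\<kappa> \<cdot> (Id X \<otimes> h) = d \<cdot> (l \<otimes> Id N)" .
qed

lemma form_h_elem:
  assumes "ty x = U \<rightarrowtail> M" "ty y = V \<rightarrowtail> N" "ty a = W \<rightarrowtail> X"
  shows "\<kappa> \<cdot> ((h \<cdot> (x \<otimes> y)) \<otimes> a) = d \<cdot> (x \<otimes> (\<rho> \<cdot> (y \<otimes> a)))"
    "\<kappa> \<cdot> (a \<otimes> (h \<cdot> (x \<otimes> y))) = d \<cdot> ((l \<cdot> (a \<otimes> x)) \<otimes> y)"
  using precomp[OF form_h(1), of "x \<otimes> y \<otimes> a"] precomp[OF form_h(2), of "a \<otimes> x \<otimes> y"] assms by simp_all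

text \<open>By nondegeneracy of \<kappa> it is enough to pair with a further algebra element, where
  \<open>form_h\<close> reduces the claim to associativity of the actions.\<close>

lemma h_linear: "h \<cdot> (l \<otimes> Id N) = m \<cdot> (Id X \<otimes> h)" "h \<cdot> (Id M \<otimes> \<rho>) = m \<cdot> (h \<otimes> Id X)"
proof -
  have "\<kappa> \<cdot> (c \<otimes> (h \<cdot> ((l \<cdot> (a \<otimes> x)) \<otimes> y))) = \<kappa> \<cdot> (c \<otimes> (m \<cdot> (a \<otimes> (h \<cdot> (x \<otimes> y)))))"
    "\<kappa> \<cdot> ((h \<cdot> (x \<otimes> (\<rho> \<cdot> (y \<otimes> a)))) \<otimes> c) = \<kappa> \<cdot> ((m \<cdot> ((h \<cdot> (x \<otimes> y)) \<otimes> a)) \<otimes> c)"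
    if [simp]: "ty x = U \<rightarrowtail> M" "ty y = V \<rightarrowtail> N" "ty a = W \<rightarrowtail> X" "ty c = Z \<rightarrowtail> X" for x y a c U V W Z
  proof -
    have "\<kappa> \<cdot> (c \<otimes> (m \<cdot> (a \<otimes> (h \<cdot> (x \<otimes> y))))) = \<kappa> \<cdot> ((m \<cdot> (c \<otimes> a)) \<otimes> (h \<cdot> (x \<otimes> y)))"
      by simp
    also have "\<dots> = d \<cdot> ((l \<cdot> ((m \<cdot> (c \<otimes> a)) \<otimes> x)) \<otimes> y)"
      by (rule form_h_elem) simp_all
    finally show "\<kappa> \<cdot> (c \<otimes> (h \<cdot> ((l \<cdot> (a \<otimes> x)) \<otimes> y))) = \<kappa> \<cdot> (c \<otimes> (m \<cdot> (a \<otimes> (h \<cdot> (x \<otimes> y)))))"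
      by (simp add: form_h_elem)
    show "\<kappa> \<cdot> ((h \<cdot> (x \<otimes> (\<rho> \<cdot> (y \<otimes> a)))) \<otimes> c) = \<kappa> \<cdot> ((m \<cdot> ((h \<cdot> (x \<otimes> y)) \<otimes> a)) \<otimes> c)"
      by (simp add: form_h_elem)
  qed
  note this[of "Id M" M "Id N" N "Id X" X "Id X" X]
  then have 1: "\<kappa> \<cdot> (Id X \<otimes> (h \<cdot> (l \<otimes> Id N))) = \<kappa> \<cdot> (Id X \<otimes> (m \<cdot> (Id X \<otimes> h)))"
    and 2: "\<kappa> \<cdot> ((h \<cdot> (Id M \<otimes> \<rho>)) \<otimes> Id X) = \<kappa> \<cdot> ((m \<cdot> (h \<otimes> Id X)) \<otimes> Id X)"
    by simp_all
  show "h \<cdot> (l \<otimes> Id N) = m \<cdot> (Id X \<otimes> h)"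
    by (rule dual_pair_test_right[OF form_dual_pair _ _ 1]) simp_all
  show "h \<cdot> (Id M \<otimes> \<rho>) = m \<cdot> (h \<otimes> Id X)"
    by (rule dual_pair_test_left[OF form_dual_pair _ _ 2]) simp_all
qed

lemma h_left_linear [simp]:
  assumes "ty a = U \<rightarrowtail> X" "ty x = V \<rightarrowtail> M" "ty y = W \<rightarrowtail> N"
  shows "h \<cdot> ((l \<cdot> (a \<otimes> x)) \<otimes> y) = m \<cdot> (a \<otimes> (h \<cdot> (x \<otimes> y)))"
  using precomp[OF h_linear(1), of "a \<otimes> x \<otimes> y"] assms by simp

lemma h_right_linear [simp]:
  assumes "ty x = V \<rightarrowtail> M" "ty y = W \<rightarrowtail> N" "ty a = U \<rightarrowtail> X"
  shows "h \<cdot> (x \<otimes> (\<rho> \<cdot> (y \<otimes> a))) = m \<cdot> ((h \<cdot> (x \<otimes> y)) \<otimes> a)"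
  using precomp[OF h_linear(2), of "x \<otimes> y \<otimes> a"] assms by simp

lemma T_pairing: "(d \<otimes> Id M) \<cdot> (Id M \<otimes> T) = l \<cdot> (h \<otimes> Id M)" "(Id N \<otimes> d) \<cdot> (T \<otimes> Id N) = \<rho> \<cdot> (Id N \<otimes> h)"
  unfolding T_def using tensor_over_pairing[OF dual_module module _ _] form_h by simp_all

text \<open>The right coevaluation is a dual basis for \<open>h\<close>: cancelling \<open>b\<close>
  against \<open>d\<close> leaves the two legs of \<open>q\<close> acting in succession, and they
  multiply to the unit.\<close>

lemma b_generates: "\<rho> \<cdot> (Id N \<otimes> h) \<cdot> (b \<otimes> Id N) = Id N" "l \<cdot> (h \<otimes> Id M) \<cdot> (Id M \<otimes> b) = Id M"
proof -
  have "(Id N \<otimes> h) \<cdot> (b \<otimes> Id N) = (Id N \<otimes> (d \<cdot> (Id M \<otimes> \<rho>)) \<otimes> Id X) \<cdot> ((Id N \<otimes> Id M \<otimes> Id N \<otimes> q) \<cdot> (b \<otimes> Id N))"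
  proof -
    have "Id N \<otimes> h = (Id N \<otimes> (d \<cdot> (Id M \<otimes> \<rho>)) \<otimes> Id X) \<cdot> (Id N \<otimes> Id M \<otimes> Id N \<otimes> q)"
      unfolding h_def by (simp del: tensor_rules(4))
    then show ?thesis by (simp del: ich tensor_rules(4))
  qed
  also have "(Id N \<otimes> Id M \<otimes> Id N \<otimes> q) \<cdot> (b \<otimes> Id N) = (b \<otimes> Id N \<otimes> Id X \<otimes> Id X) \<cdot> (Id N \<otimes> q)"
    using coscalar_tensor(2)[of q "X \<odot> X" "b \<otimes> Id N" N "N \<odot> M \<odot> N", symmetric]
      coscalar_tensor(1)[of b "N \<odot> M" "Id N \<otimes> q" N "N \<odot> X \<odot> X", symmetric] by simp
  also have "(Id N \<otimes> (d \<cdot> (Id M \<otimes> \<rho>)) \<otimes> Id X) \<cdot> \<dots> = (((Id N \<otimes> (d \<cdot> (Id M \<otimes> \<rho>))) \<cdot> (b \<otimes> Id N \<otimes> Id X)) \<otimes> Id X) \<cdot> (Id N \<otimes> q)"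
    by (rule comp_eq_tail) (simp_all del: tensor_rules(4))
  also have "(Id N \<otimes> (d \<cdot> (Id M \<otimes> \<rho>))) \<cdot> (b \<otimes> Id N \<otimes> Id X) = \<rho>"
    using dual_pair_transpose_right[OF pairs(2), of \<rho> "N \<odot> X"] by (simp add: ident_tensor_split)
  finally have "\<rho> \<cdot> (Id N \<otimes> h) \<cdot> (b \<otimes> Id N) = (\<rho> \<cdot> (\<rho> \<otimes> Id X)) \<cdot> (Id N \<otimes> q)"
    by (simp del: ich)
  also have "\<dots> = Id N"
    unfolding dual_action_laws(1) by (simp add: mult_q dual_action_laws(2))
  finally show "\<rho> \<cdot> (Id N \<otimes> h) \<cdot> (b \<otimes> Id N) = Id N" .
  have h2: "h = (Id X \<otimes> (d \<cdot> (l \<otimes> Id N))) \<cdot> (q \<otimes> Id M \<otimes> Id N)"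
    using dual_pair_transpose_right[OF form_dual_pair, of h "M \<odot> N"] by (simp add: form_h(2))
  have "(h \<otimes> Id M) \<cdot> (Id M \<otimes> b) = (Id X \<otimes> (d \<cdot> (l \<otimes> Id N)) \<otimes> Id M) \<cdot> ((q \<otimes> Id M \<otimes> Id N \<otimes> Id M) \<cdot> (Id M \<otimes> b))"
  proof -
    have "h \<otimes> Id M = (Id X \<otimes> (d \<cdot> (l \<otimes> Id N)) \<otimes> Id M) \<cdot> (q \<otimes> Id M \<otimes> Id N \<otimes> Id M)"
      by (subst h2) (simp del: tensor_rules(4))
    then show ?thesis by (simp del: ich tensor_rules(4))
  qed
  also have "(q \<otimes> Id M \<otimes> Id N \<otimes> Id M) \<cdot> (Id M \<otimes> b) = (Id X \<otimes> Id X \<otimes> Id M \<otimes> b) \<cdot> (q \<otimes> Id M)"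
    using coscalar_tensor(1)[of q "X \<odot> X" "Id M \<otimes> b" M "M \<odot> N \<odot> M", symmetric]
      coscalar_tensor(2)[of b "N \<odot> M" "q \<otimes> Id M" M "X \<odot> X \<odot> M", symmetric] by simp
  also have "(Id X \<otimes> (d \<cdot> (l \<otimes> Id N)) \<otimes> Id M) \<cdot> \<dots> = (Id X \<otimes> (((d \<cdot> (l \<otimes> Id N)) \<otimes> Id M) \<cdot> (Id X \<otimes> Id M \<otimes> b))) \<cdot> (q \<otimes> Id M)"
    by (rule comp_eq_tail) (simp_all del: tensor_rules(4))
  also have "((d \<cdot> (l \<otimes> Id N)) \<otimes> Id M) \<cdot> (Id X \<otimes> Id M \<otimes> b) = l"
    using dual_pair_transpose_left[OF pairs(2), of l "X \<odot> M"] by (simp add: ident_tensor_split)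
  finally have "l \<cdot> (h \<otimes> Id M) \<cdot> (Id M \<otimes> b) = (l \<cdot> (Id X \<otimes> l)) \<cdot> (q \<otimes> Id M)"
    by (simp del: ich)
  also have "\<dots> = Id M"
    unfolding action_laws(1)[symmetric] by (simp add: mult_q action_laws(2))
  finally show "l \<cdot> (h \<otimes> Id M) \<cdot> (Id M \<otimes> b) = Id M" .
qed

text \<open>Contracting \<open>T\<close> with \<open>d\<close> is acting through \<open>h\<close>,
  for which \<open>b\<close> is a dual basis. Consequently \<open>b\<close> is the embedded unit of
  \<open>E\<close>.\<close>

lemma T_b: "T \<cdot> b = b"
proof -
  have "T \<cdot> b = (Id N \<otimes> ((d \<otimes> Id M) \<cdot> (Id M \<otimes> b))) \<cdot> (T \<cdot> b)"
    using pairs(2) by (simp add: dual_pair_def)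
  also have "\<dots> = (Id N \<otimes> d \<otimes> Id M) \<cdot> ((Id N \<otimes> Id M \<otimes> b) \<cdot> (T \<cdot> b))"
    by (simp add: tensor_ident_comp(1) del: ich tensor_rules(4))
  also have "(Id N \<otimes> Id M \<otimes> b) \<cdot> (T \<cdot> b) = (T \<otimes> Id N \<otimes> Id M) \<cdot> ((b \<otimes> Id N \<otimes> Id M) \<cdot> b)"
    using coscalar_tensor(2)[of b "N \<odot> M" "T \<cdot> b" \<one> "N \<odot> M", symmetric]
      coscalar_tensor(1)[of "T \<cdot> b" "N \<odot> M" b \<one> "N \<odot> M"] by simp
  also have "(Id N \<otimes> d \<otimes> Id M) \<cdot> \<dots> = ((((Id N \<otimes> d) \<cdot> (T \<otimes> Id N)) \<cdot> (b \<otimes> Id N)) \<otimes> Id M) \<cdot> b"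
    by (simp add: tensor_ident_comp(2) del: ich tensor_rules(4))
  also have "\<dots> = b"
    unfolding T_pairing b_generates by simp
  finally show ?thesis .
qed

end

section \<open>The algebra of the module and surjectivity of the pairing\<close>

locale morita_module = module_over C A M l + E: jandl C E
  for C :: "('o, 'm, 'k::field) ribbon_structure" (structure) and A :: "('o, 'm) jandl" and M :: 'o and l :: 'm
    and E :: "('o, 'm) jandl" +
  fixes e r :: 'm
  assumes internal: "internal_end A M l E e r" and interp: "interpolating A M l E e"
begin

definition \<xi> where "\<xi> = (d \<otimes> Id M) \<cdot> (Id M \<otimes> e)"
definition \<mu> where "\<mu> = (Id N \<otimes> d) \<cdot> (e \<otimes> Id N)"

lemma splits_E: "splits (N \<odot> M) T (alg_ob E) e r"
  using internal by (simp add: internal_end_def N_def \<rho>_def T_def)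

lemma E_tys [simp]: "ty e = alg_ob E \<rightarrowtail> (N \<odot> M)" "ty r = (N \<odot> M) \<rightarrowtail> alg_ob E"
  and re: "r \<cdot> e = Id (alg_ob E)" and er: "e \<cdot> r = T"
  using splits_E by (simp_all add: splits_def)

lemma E_algebra: "mult E = r \<cdot> (Id N \<otimes> d \<otimes> Id M) \<cdot> (e \<otimes> e)" "unit E = r \<cdot> b"
  using internal by (simp_all add: internal_end_def N_def d_def b_def)

lemma E_action_tys [simp]: "ty \<xi> = (M \<odot> alg_ob E) \<rightarrowtail> M" "ty \<mu> = (alg_ob E \<odot> N) \<rightarrowtail> N"
  by (simp_all add: \<xi>_def \<mu>_def)

lemma r_balanced: "r \<cdot> (\<rho> \<otimes> Id M) = r \<cdot> (Id N \<otimes> l)"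
  using splits_balanced(2)[OF dual_module module] splits_E by (simp add: T_def)

lemma r_balanced_elem [simp]:
  assumes "ty y = U \<rightarrowtail> N" "ty a = V \<rightarrowtail> X" "ty x = W \<rightarrowtail> M"
  shows "r \<cdot> ((\<rho> \<cdot> (y \<otimes> a)) \<otimes> x) = r \<cdot> (y \<otimes> (l \<cdot> (a \<otimes> x)))"
  using precomp[OF r_balanced, of "y \<otimes> a \<otimes> x"] assms by simp

lemma E_action_r: "\<xi> \<cdot> (Id M \<otimes> r) = l \<cdot> (h \<otimes> Id M)" "\<mu> \<cdot> (r \<otimes> Id N) = \<rho> \<cdot> (Id N \<otimes> h)"
  using T_pairing by (simp_all add: \<xi>_def \<mu>_def er)

lemma E_action_r_elem [simp]:
  assumes "ty x = U \<rightarrowtail> M" "ty y = V \<rightarrowtail> N" "ty z = W \<rightarrowtail> M"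
  shows "\<xi> \<cdot> (x \<otimes> (r \<cdot> (y \<otimes> z))) = l \<cdot> ((h \<cdot> (x \<otimes> y)) \<otimes> z)"
  using precomp[OF E_action_r(1), of "x \<otimes> y \<otimes> z"] assms by simp

lemma E_action_r_elem' [simp]:
  assumes "ty y = U \<rightarrowtail> N" "ty z = V \<rightarrowtail> M" "ty x = W \<rightarrowtail> N"
  shows "\<mu> \<cdot> ((r \<cdot> (y \<otimes> z)) \<otimes> x) = \<rho> \<cdot> (y \<otimes> (h \<cdot> (z \<otimes> x)))"
  using precomp[OF E_action_r(2), of "y \<otimes> z \<otimes> x"] assms by simp

text \<open>The product of \<open>E\<close> is defined with the scalar evaluation \<open>d\<close>,
  but the idempotent turns \<open>d\<close> into the algebra-valued \<open>h\<close>. This is the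
  formula for the product in \<open>hermitian_family\<close>.\<close>

lemma E_mult_r: "mult E \<cdot> (r \<otimes> r) = r \<cdot> ((\<rho> \<cdot> (Id N \<otimes> h)) \<otimes> Id M)"
proof -
  have 0: "(Id N \<otimes> d \<otimes> Id M) \<cdot> (T \<otimes> T) = (Id N \<otimes> ((d \<otimes> Id M) \<cdot> (Id M \<otimes> T))) \<cdot> (T \<otimes> Id N \<otimes> Id M)"
  proof -
    have "T \<otimes> T = (Id N \<otimes> Id M \<otimes> T) \<cdot> (T \<otimes> Id N \<otimes> Id M)" by simp
    moreover have "(Id N \<otimes> d \<otimes> Id M) \<cdot> ((Id N \<otimes> Id M \<otimes> T) \<cdot> (T \<otimes> Id N \<otimes> Id M)) =
        (Id N \<otimes> ((d \<otimes> Id M) \<cdot> (Id M \<otimes> T))) \<cdot> (T \<otimes> Id N \<otimes> Id M)"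
      by (rule comp_eq_tail) (simp_all del: tensor_rules(4))
    ultimately show ?thesis by (simp only:)
  qed
  have "mult E \<cdot> (r \<otimes> r) = r \<cdot> ((Id N \<otimes> d \<otimes> Id M) \<cdot> (T \<otimes> T))"
    unfolding E_algebra by (simp add: er)
  then have 1: "mult E \<cdot> (r \<otimes> r) = r \<cdot> ((Id N \<otimes> (l \<cdot> (h \<otimes> Id M))) \<cdot> (T \<otimes> Id N \<otimes> Id M))"
    unfolding 0 T_pairing .
  have 2: "r \<cdot> (Id N \<otimes> (l \<cdot> (h \<otimes> Id M))) = r \<cdot> ((\<rho> \<cdot> (Id N \<otimes> h)) \<otimes> Id M)"
    using r_balanced_elem[of "Id N" N h "M \<odot> N" "Id M" M] by simp
  have 3: "\<rho> \<cdot> (Id N \<otimes> h) \<cdot> (T \<otimes> Id N) = \<rho> \<cdot> (Id N \<otimes> h)"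
  proof -
    have "(\<rho> \<cdot> (Id N \<otimes> h)) \<cdot> (Id \<one> \<otimes> \<rho> \<otimes> Id M \<otimes> Id N) = (\<rho> \<cdot> (Id N \<otimes> h)) \<cdot> (Id \<one> \<otimes> Id N \<otimes> l \<otimes> Id N)"
      using dual_action_assoc[of "Id N" N "Id X" X h "M \<odot> N"] h_linear(1)
      by (simp del: dual_action_assoc h_left_linear)
    then have "(\<rho> \<cdot> (Id N \<otimes> h)) \<cdot> (Id \<one> \<otimes> T \<otimes> Id N) = \<rho> \<cdot> (Id N \<otimes> h)"
      unfolding T_def by (intro balanced_tensor_over_whisker[OF dual_module module, where Z = N]) simp_all
    then show ?thesis by simp
  qed
  have "mult E \<cdot> (r \<otimes> r) = (r \<cdot> (Id N \<otimes> (l \<cdot> (h \<otimes> Id M)))) \<cdot> (T \<otimes> Id N \<otimes> Id M)"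
    unfolding 1 by (simp del: ich)
  also have "\<dots> = r \<cdot> ((\<rho> \<cdot> (Id N \<otimes> h) \<cdot> (T \<otimes> Id N)) \<otimes> Id M)"
    unfolding 2 by (simp del: tensor_rules(4) r_balanced_elem)
  finally show ?thesis unfolding 3 .
qed

lemma E_mult_r_elem [simp]:
  assumes "ty y = U \<rightarrowtail> N" "ty x = V \<rightarrowtail> M" "ty z = W \<rightarrowtail> N" "ty v = W' \<rightarrowtail> M"
  shows "mult E \<cdot> ((r \<cdot> (y \<otimes> x)) \<otimes> (r \<cdot> (z \<otimes> v))) = r \<cdot> (y \<otimes> (l \<cdot> ((h \<cdot> (x \<otimes> z)) \<otimes> v)))"
  using precomp[OF E_mult_r, of "y \<otimes> x \<otimes> z \<otimes> v"] assms by simp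

text \<open>Since \<open>r\<close> is a split epimorphism, identities involving \<open>E\<close> may be checked on \<open>r \<cdot> (y \<otimes> x)\<close>.\<close>

lemma r_cancel:
  assumes "ty f = (U \<odot> alg_ob E \<odot> V) \<rightarrowtail> Z" "ty f' = (U \<odot> alg_ob E \<odot> V) \<rightarrowtail> Z" "U \<in> Ob C" "V \<in> Ob C"
    "f \<cdot> (Id U \<otimes> r \<otimes> Id V) = f' \<cdot> (Id U \<otimes> r \<otimes> Id V)"
  shows "f = f'"
  by (rule split_epi_cancel[OF _ _ _ assms(1,2,5), where e = "Id U \<otimes> e \<otimes> Id V" and W = "U \<odot> (N \<odot> M) \<odot> V"])
    (use assms(3,4) in \<open>simp_all add: re\<close>)

lemma E_actions_commute: "\<xi> \<cdot> (l \<otimes> Id (alg_ob E)) = l \<cdot> (Id X \<otimes> \<xi>)" "\<rho> \<cdot> (\<mu> \<otimes> Id X) = \<mu> \<cdot> (Id (alg_ob E) \<otimes> \<rho>)"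
proof -
  have "\<xi> \<cdot> ((l \<cdot> (a \<otimes> x)) \<otimes> (r \<cdot> (y \<otimes> z))) = l \<cdot> (a \<otimes> (\<xi> \<cdot> (x \<otimes> (r \<cdot> (y \<otimes> z)))))"
    "\<rho> \<cdot> ((\<mu> \<cdot> ((r \<cdot> (y \<otimes> z)) \<otimes> v)) \<otimes> a) = \<mu> \<cdot> ((r \<cdot> (y \<otimes> z)) \<otimes> (\<rho> \<cdot> (v \<otimes> a)))"
    if "ty a = U \<rightarrowtail> X" "ty x = V \<rightarrowtail> M" "ty y = W \<rightarrowtail> N" "ty z = V' \<rightarrowtail> M" "ty v = W' \<rightarrowtail> N" for a x y z v U V W V' W'
    using that by simp_all
  note el = this[of "Id X" X "Id M" M "Id N" N "Id M" M "Id N" N]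
  have i: "r \<cdot> (Id N \<otimes> Id M) = r" "l \<cdot> (Id X \<otimes> Id M) = l" by simp_all
  have n: "Id (X \<odot> M) \<otimes> r \<otimes> Id \<one> = Id X \<otimes> Id M \<otimes> r" "Id \<one> \<otimes> r \<otimes> Id (N \<odot> X) = r \<otimes> Id N \<otimes> Id X"
    by (simp_all add: ident_tensor_split)
  have 1: "(\<xi> \<cdot> (l \<otimes> Id (alg_ob E))) \<cdot> (Id (X \<odot> M) \<otimes> r \<otimes> Id \<one>) = (l \<cdot> (Id X \<otimes> \<xi>)) \<cdot> (Id (X \<odot> M) \<otimes> r \<otimes> Id \<one>)"
    unfolding n using el(1) by (simp add: i del: tensor_rules(4) E_action_r_elem E_action_r_elem')
  have 2: "(\<rho> \<cdot> (\<mu> \<otimes> Id X)) \<cdot> (Id \<one> \<otimes> r \<otimes> Id (N \<odot> X)) = (\<mu> \<cdot> (Id (alg_ob E) \<otimes> \<rho>)) \<cdot> (Id \<one> \<otimes> r \<otimes> Id (N \<odot> X))"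
    unfolding n using el(2) by (simp add: i del: tensor_rules(4) E_action_r_elem E_action_r_elem')
  show "\<xi> \<cdot> (l \<otimes> Id (alg_ob E)) = l \<cdot> (Id X \<otimes> \<xi>)"
    by (rule r_cancel[OF _ _ _ _ 1, where Z = M]) simp_all
  show "\<rho> \<cdot> (\<mu> \<otimes> Id X) = \<mu> \<cdot> (Id (alg_ob E) \<otimes> \<rho>)"
    by (rule r_cancel[OF _ _ _ _ 2, where Z = N]) simp_all
qed

lemma E_modules: "right_module E M \<xi>" "left_module E N \<mu>"
proof -
  have el: "\<xi> \<cdot> ((\<xi> \<cdot> (x \<otimes> (r \<cdot> (y \<otimes> z)))) \<otimes> (r \<cdot> (v \<otimes> w))) = \<xi> \<cdot> (x \<otimes> (mult E \<cdot> ((r \<cdot> (y \<otimes> z)) \<otimes> (r \<cdot> (v \<otimes> w)))))"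
    "\<mu> \<cdot> ((r \<cdot> (y \<otimes> z)) \<otimes> (\<mu> \<cdot> ((r \<cdot> (v \<otimes> w)) \<otimes> u))) = \<mu> \<cdot> ((mult E \<cdot> ((r \<cdot> (y \<otimes> z)) \<otimes> (r \<cdot> (v \<otimes> w)))) \<otimes> u)"
    if "ty x = U \<rightarrowtail> M" "ty y = U1 \<rightarrowtail> N" "ty z = U2 \<rightarrowtail> M" "ty v = U3 \<rightarrowtail> N" "ty w = U4 \<rightarrowtail> M" "ty u = U5 \<rightarrowtail> N"
    for x y z v w u U U1 U2 U3 U4 U5
    using that by simp_all
  have s: "r \<otimes> r = (r \<otimes> Id (alg_ob E)) \<cdot> (Id N \<otimes> Id M \<otimes> r)" by simp
  have "(\<xi> \<cdot> (\<xi> \<otimes> Id (alg_ob E))) \<cdot> (Id M \<otimes> r \<otimes> r) = (\<xi> \<cdot> (Id M \<otimes> mult E)) \<cdot> (Id M \<otimes> r \<otimes> r)"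
    "(\<mu> \<cdot> (Id (alg_ob E) \<otimes> \<mu>)) \<cdot> (r \<otimes> r \<otimes> Id N) = (\<mu> \<cdot> (mult E \<otimes> Id N)) \<cdot> (r \<otimes> r \<otimes> Id N)"
    using el[of "Id M" M "Id N" N "Id M" M "Id N" N "Id M" M "Id N" N]
    by (simp_all del: E_action_r_elem E_action_r_elem' E_mult_r_elem)
  note 1 = this
  have x: "\<xi> \<cdot> (\<xi> \<otimes> Id (alg_ob E)) = \<xi> \<cdot> (Id M \<otimes> mult E)"
    by (rule split_epi_cancel[OF _ _ _ _ _ 1(1), where e = "Id M \<otimes> e \<otimes> e" and E = "M \<odot> alg_ob E \<odot> alg_ob E"
          and W = "M \<odot> (N \<odot> M) \<odot> (N \<odot> M)" and Z = M]) (simp_all add: re)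
  have y: "\<mu> \<cdot> (Id (alg_ob E) \<otimes> \<mu>) = \<mu> \<cdot> (mult E \<otimes> Id N)"
    by (rule split_epi_cancel[OF _ _ _ _ _ 1(2), where e = "e \<otimes> e \<otimes> Id N" and E = "alg_ob E \<odot> alg_ob E \<odot> N"
          and W = "(N \<odot> M) \<odot> (N \<odot> M) \<odot> N" and Z = N]) (simp_all add: re)
  have "\<xi> \<cdot> (Id M \<otimes> unit E) = (\<xi> \<cdot> (Id M \<otimes> r)) \<cdot> (Id M \<otimes> b)" "\<mu> \<cdot> (unit E \<otimes> Id N) = (\<mu> \<cdot> (r \<otimes> Id N)) \<cdot> (b \<otimes> Id N)"
    by (simp_all add: E_algebra)
  then have "\<xi> \<cdot> (Id M \<otimes> unit E) = Id M" "\<mu> \<cdot> (unit E \<otimes> Id N) = Id N"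
    using b_generates unfolding E_action_r by simp_all
  then show "right_module E M \<xi>" "left_module E N \<mu>"
    using x y by (simp_all add: right_module_def left_module_def)
qed

text \<open>\<open>interpolating\<close> only provides some isomorphism \<psi>, hence a bilinear
  pairing \<open>p\<close> that hits the unit. Since \<open>h\<close> and \<open>p\<close> are both
  bilinear and induce compatible actions, \<open>h\<close> is \<open>p\<close> multiplied by a fixed
  element \<open>c\<close> that can be compensated.\<close>

lemma h_surjective: "\<exists>v. ty v = \<one> \<rightarrowtail> (M \<odot> N) \<and> h \<cdot> v = \<eta>"
proof -
  obtain Y e' r' \<psi> where s: "splits (M \<odot> N) (tensor_over E M \<xi> N \<mu>) Y e' r'"
    and hom: "bimodule_hom A Y (r' \<cdot> (l \<otimes> Id N) \<cdot> (Id X \<otimes> e')) (r' \<cdot> (Id M \<otimes> \<rho>) \<cdot> (e' \<otimes> Id X)) X m m \<psi>" and "iso \<psi>"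
    using interp unfolding interpolating_def N_def \<rho>_def \<xi>_def \<mu>_def d_def by blast
  let ?Q = "tensor_over E M \<xi> N \<mu>"
  have tyY [simp]: "Y \<in> Ob C" "ty e' = Y \<rightarrowtail> (M \<odot> N)" "ty r' = (M \<odot> N) \<rightarrowtail> Y" "ty \<psi> = Y \<rightarrowtail> X"
    and re': "r' \<cdot> e' = Id Y" and er': "e' \<cdot> r' = ?Q"
    using s hom by (simp_all add: splits_def bimodule_hom_def)
  have bal: "r' \<cdot> (\<xi> \<otimes> Id N) = r' \<cdot> (Id M \<otimes> \<mu>)"
    using E.splits_balanced(2)[OF E_modules s] .
  define p where "p = \<psi> \<cdot> r'"
  have [simp]: "ty p = (M \<odot> N) \<rightarrowtail> X" by (simp add: p_def)
  have [simp]: "r' \<cdot> ((\<xi> \<cdot> (x \<otimes> c)) \<otimes> y) = r' \<cdot> (x \<otimes> (\<mu> \<cdot> (c \<otimes> y)))"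
    if "ty x = U \<rightarrowtail> M" "ty c = V \<rightarrowtail> alg_ob E" "ty y = W \<rightarrowtail> N" for x c y U V W
    using precomp[OF bal, of "x \<otimes> c \<otimes> y"] that by simp
  have cl: "l \<cdot> (a \<otimes> (\<xi> \<cdot> (x \<otimes> c))) = \<xi> \<cdot> ((l \<cdot> (a \<otimes> x)) \<otimes> c)"
    if "ty a = U \<rightarrowtail> X" "ty x = V \<rightarrowtail> M" "ty c = W \<rightarrowtail> alg_ob E" for a x c U V W
    using precomp[OF E_actions_commute(1), of "a \<otimes> x \<otimes> c"] that by simp
  have cr: "\<rho> \<cdot> ((\<mu> \<cdot> (c \<otimes> y)) \<otimes> a) = \<mu> \<cdot> (c \<otimes> (\<rho> \<cdot> (y \<otimes> a)))"
    if "ty a = U \<rightarrowtail> X" "ty y = V \<rightarrowtail> N" "ty c = W \<rightarrowtail> alg_ob E" for a y c U V W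
    using precomp[OF E_actions_commute(2), of "c \<otimes> y \<otimes> a"] that by simp
  have fl: "(r' \<cdot> (l \<otimes> Id N)) \<cdot> (Id X \<otimes> ?Q \<otimes> Id \<one>) = r' \<cdot> (l \<otimes> Id N)"
  proof (rule E.balanced_tensor_over_whisker[OF E_modules, where Z = Y])
    have "r' \<cdot> ((l \<cdot> (a \<otimes> (\<xi> \<cdot> (x \<otimes> c)))) \<otimes> y) = r' \<cdot> ((l \<cdot> (a \<otimes> x)) \<otimes> (\<mu> \<cdot> (c \<otimes> y)))"
      if "ty a = U \<rightarrowtail> X" "ty x = V \<rightarrowtail> M" "ty c = W \<rightarrowtail> alg_ob E" "ty y = W' \<rightarrowtail> N" for a x c y U V W W'
      using that by (simp add: cl)
    from this[of "Id X" X "Id M" M "Id (alg_ob E)" "alg_ob E" "Id N" N]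
    show "(r' \<cdot> (l \<otimes> Id N)) \<cdot> (Id X \<otimes> \<xi> \<otimes> Id N \<otimes> Id \<one>) = (r' \<cdot> (l \<otimes> Id N)) \<cdot> (Id X \<otimes> Id M \<otimes> \<mu> \<otimes> Id \<one>)"
      by simp
  qed simp_all
  have fr: "(r' \<cdot> (Id M \<otimes> \<rho>)) \<cdot> (Id \<one> \<otimes> ?Q \<otimes> Id X) = r' \<cdot> (Id M \<otimes> \<rho>)"
  proof (rule E.balanced_tensor_over_whisker[OF E_modules, where Z = Y])
    have "r' \<cdot> ((\<xi> \<cdot> (x \<otimes> c)) \<otimes> (\<rho> \<cdot> (y \<otimes> a))) = r' \<cdot> (x \<otimes> (\<rho> \<cdot> ((\<mu> \<cdot> (c \<otimes> y)) \<otimes> a)))"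
      if "ty a = U \<rightarrowtail> X" "ty x = V \<rightarrowtail> M" "ty c = W \<rightarrowtail> alg_ob E" "ty y = W' \<rightarrowtail> N" for a x c y U V W W'
      using that by (simp add: cr)
    from this[of "Id X" X "Id M" M "Id (alg_ob E)" "alg_ob E" "Id N" N]
    show "(r' \<cdot> (Id M \<otimes> \<rho>)) \<cdot> (Id \<one> \<otimes> \<xi> \<otimes> Id N \<otimes> Id X) = (r' \<cdot> (Id M \<otimes> \<rho>)) \<cdot> (Id \<one> \<otimes> Id M \<otimes> \<mu> \<otimes> Id X)"
      by simp
  qed simp_all
  have pl: "p \<cdot> (l \<otimes> Id N) = m \<cdot> (Id X \<otimes> p)"
  proof -
    have "\<psi> \<cdot> (r' \<cdot> (l \<otimes> Id N) \<cdot> (Id X \<otimes> e')) = m \<cdot> (Id X \<otimes> \<psi>)"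
      using hom by (simp add: bimodule_hom_def)
    then have "(\<psi> \<cdot> (r' \<cdot> (l \<otimes> Id N) \<cdot> (Id X \<otimes> e'))) \<cdot> (Id X \<otimes> r') = (m \<cdot> (Id X \<otimes> \<psi>)) \<cdot> (Id X \<otimes> r')"
      by (simp only:)
    then show ?thesis
      using fl by (simp add: er' p_def)
  qed
  have pr: "p \<cdot> (Id M \<otimes> \<rho>) = m \<cdot> (p \<otimes> Id X)"
  proof -
    have "\<psi> \<cdot> (r' \<cdot> (Id M \<otimes> \<rho>) \<cdot> (e' \<otimes> Id X)) = m \<cdot> (\<psi> \<otimes> Id X)"
      using hom by (simp add: bimodule_hom_def)
    then have "(\<psi> \<cdot> (r' \<cdot> (Id M \<otimes> \<rho>) \<cdot> (e' \<otimes> Id X))) \<cdot> (r' \<otimes> Id X) = (m \<cdot> (\<psi> \<otimes> Id X)) \<cdot> (r' \<otimes> Id X)"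
      by (simp only:)
    then show ?thesis
      using fr by (simp add: er' p_def)
  qed
  have pl_elem: "p \<cdot> ((l \<cdot> (a \<otimes> x)) \<otimes> y) = m \<cdot> (a \<otimes> (p \<cdot> (x \<otimes> y)))"
    if "ty a = U \<rightarrowtail> X" "ty x = V \<rightarrowtail> M" "ty y = W \<rightarrowtail> N" for a x y U V W
    using precomp[OF pl, of "a \<otimes> x \<otimes> y"] that by simp
  have pr_elem: "p \<cdot> (x \<otimes> (\<rho> \<cdot> (y \<otimes> a))) = m \<cdot> ((p \<cdot> (x \<otimes> y)) \<otimes> a)"
    if "ty a = U \<rightarrowtail> X" "ty x = V \<rightarrowtail> M" "ty y = W \<rightarrowtail> N" for a x y U V W
    using precomp[OF pr, of "x \<otimes> y \<otimes> a"] that by simp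
  \<comment> \<open>In elements h(x, y) p(z, v) = p(h(x, y) z, v) = p(x, y h(z, v)) = p(x, y) h(z,
    v). The middle step moves the element of \<open>E\<close> represented by y \<otimes> z across
    the tensor product over \<open>E\<close>.\<close>
  have key_elem: "m \<cdot> ((h \<cdot> (x \<otimes> y)) \<otimes> (p \<cdot> (z \<otimes> v))) = m \<cdot> ((p \<cdot> (x \<otimes> y)) \<otimes> (h \<cdot> (z \<otimes> v)))"
    if [simp]: "ty x = U \<rightarrowtail> M" "ty y = V \<rightarrowtail> N" "ty z = W \<rightarrowtail> M" "ty v = W' \<rightarrowtail> N" for x y z v U V W W'
  proof -
    have "m \<cdot> ((h \<cdot> (x \<otimes> y)) \<otimes> (p \<cdot> (z \<otimes> v))) = p \<cdot> ((\<xi> \<cdot> (x \<otimes> (r \<cdot> (y \<otimes> z)))) \<otimes> v)"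
      by (simp add: pl_elem)
    also have "\<dots> = p \<cdot> (x \<otimes> (\<mu> \<cdot> ((r \<cdot> (y \<otimes> z)) \<otimes> v)))"
      by (simp add: p_def del: E_action_r_elem E_action_r_elem')
    finally show ?thesis by (simp add: pr_elem)
  qed
  have key: "m \<cdot> (h \<otimes> p) = m \<cdot> (p \<otimes> h)"
    using key_elem[of "Id M" M "Id N" N "Id M" M "Id N" N] by simp
  obtain \<psi>' where [simp]: "ty \<psi>' = X \<rightarrowtail> Y" and \<psi>': "\<psi> \<cdot> \<psi>' = Id X"
    using isoE[OF \<open>iso \<psi>\<close>] tyY(4) by (metis ty_inject)
  define w where "w = e' \<cdot> (\<psi>' \<cdot> \<eta>)"
  have [simp]: "ty w = \<one> \<rightarrowtail> (M \<odot> N)" by (simp add: w_def)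
  have pw: "p \<cdot> w = \<eta>"
  proof -
    have "r' \<cdot> (e' \<cdot> (\<psi>' \<cdot> \<eta>)) = Id Y \<cdot> (\<psi>' \<cdot> \<eta>)"
      by (rule comp_eq_tail[OF re']) simp_all
    moreover have "\<psi> \<cdot> (\<psi>' \<cdot> \<eta>) = Id X \<cdot> \<eta>"
      by (rule comp_eq_tail[OF \<psi>']) simp_all
    ultimately show ?thesis by (simp add: p_def w_def)
  qed
  \<comment> \<open>Putting \<open>w\<close>, where \<open>p\<close> takes the value \<eta>, into
    the first slot of \<open>key\<close> gives h = c p.\<close>
  define c where "c = h \<cdot> w"
  have [simp]: "ty c = \<one> \<rightarrowtail> X" by (simp add: c_def)
  have hc: "m \<cdot> (c \<otimes> p) = h"
  proof -
    have "m \<cdot> (c \<otimes> p) = (m \<cdot> (h \<otimes> p)) \<cdot> (w \<otimes> Id M \<otimes> Id N)"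
      by (simp add: c_def)
    also have "\<dots> = m \<cdot> (\<eta> \<otimes> h)"
      unfolding key using pw by simp
    finally show ?thesis by simp
  qed
  \<comment> \<open>\<open>t\<close> compensates \<open>c\<close>: with \<open>b\<close> written as
    b1 \<otimes> b2, c t(x) = c p(x, b1) b2 = h(x, b1) b2 = x. Hence applying \<open>t\<close> to
    the first leg of \<open>w\<close> yields a preimage of the unit under \<open>h\<close>.\<close>
  define t where "t = l \<cdot> (p \<otimes> Id M) \<cdot> (Id M \<otimes> b)"
  have [simp]: "ty t = M \<rightarrowtail> M" by (simp add: t_def)
  have ct: "l \<cdot> (c \<otimes> t) = Id M"
  proof -
    have "c \<otimes> t = (Id X \<otimes> l) \<cdot> ((c \<otimes> p \<otimes> Id M) \<cdot> (Id M \<otimes> b))"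
      using interchange[of "Id \<one>" \<one> \<one> c X "Id M \<otimes> b" M "M \<odot> N \<odot> M" "p \<otimes> Id M" "X \<odot> M"]
      by (simp add: t_def)
    then have "l \<cdot> (c \<otimes> t) = (l \<cdot> (Id X \<otimes> l)) \<cdot> ((c \<otimes> p \<otimes> Id M) \<cdot> (Id M \<otimes> b))"
      by (simp del: ich action_assoc)
    also have "\<dots> = l \<cdot> ((m \<cdot> (c \<otimes> p)) \<otimes> Id M) \<cdot> (Id M \<otimes> b)"
      unfolding action_laws(1)[symmetric] by (simp del: action_assoc)
    finally show ?thesis unfolding hc b_generates .
  qed
  have "h \<cdot> ((t \<otimes> Id N) \<cdot> w) = (m \<cdot> (c \<otimes> p)) \<cdot> ((t \<otimes> Id N) \<cdot> w)"
    by (simp only: hc)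
  also have "\<dots> = (m \<cdot> (c \<otimes> (p \<cdot> (t \<otimes> Id N)))) \<cdot> w"
    using coscalar_tensor(1)[of c X p "M \<odot> N" X] coscalar_tensor(1)[of c X "p \<cdot> (t \<otimes> Id N)" "M \<odot> N" X] by simp
  also have "m \<cdot> (c \<otimes> (p \<cdot> (t \<otimes> Id N))) = p \<cdot> ((l \<cdot> (c \<otimes> t)) \<otimes> Id N)"
    by (rule pl_elem[symmetric]) simp_all
  also have "\<dots> \<cdot> w = \<eta>" unfolding ct using pw by simp
  finally show ?thesis by (intro exI[of _ "(t \<otimes> Id N) \<cdot> w"]) simp
qed

end

section \<open>The anti-involution defined by an isomorphism with the conjugate module\<close>

locale hermitian_morita_module = morita_module C A M l E e r
  for C :: "('o, 'm, 'k::field) ribbon_structure" (structure) and A :: "('o, 'm) jandl" and M :: 'o and l :: 'm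
    and E :: "('o, 'm) jandl" and e r :: 'm +
  fixes g :: 'm and \<nu> :: 'k
  assumes g_hom: "left_module_hom A M l (du M) (conj_action A M l) g" and g_iso: "iso g"
    and g_dual: "g = scale_arr C \<nu> (left_dual_arr g \<cdot> \<delta> M)"
    and reversion_E: "reversion E = induced_reversion M g e r"
begin

definition g' where "g' = inv_arr g"
text \<open>The twist makes the composites of \<open>t\<close> and \<open>g'\<close> equal to
  twists, as \<open>hermitian\<close> demands; \<open>t\<close> and \<open>g'\<close> are also the
  two legs of \<open>induced_reversion\<close>.\<close>

definition t where "t = g \<cdot> tw M"

lemma g_ty [simp]: "ty g = M \<rightarrowtail> N" "ty g' = N \<rightarrowtail> M"
  and g_inv: "g' \<cdot> g = Id M" "g \<cdot> g' = Id N"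
proof -
  show 1: "ty g = M \<rightarrowtail> N"
    using g_hom by (simp add: left_module_hom_def N_def)
  then obtain k where k: "ty k = N \<rightarrowtail> M" "k \<cdot> g = Id M" "g \<cdot> k = Id N"
    using isoE[OF g_iso] by (metis ty_inject)
  have "g' = k" unfolding g'_def by (rule inv_arr_eq[OF 1 k])
  then show "ty g' = N \<rightarrowtail> M" "g' \<cdot> g = Id M" "g \<cdot> g' = Id N" using k by simp_all
qed

lemma t_ty [simp]: "ty t = M \<rightarrowtail> N"
  by (simp add: t_def)

lemma ev_g: "ev M \<cdot> (g \<otimes> Id M) = d \<cdot> (Id M \<otimes> scale_arr C \<nu> g)"
proof -
  have [simp]: "ty (left_dual_arr g \<cdot> \<delta> M) = M \<rightarrowtail> N"
    using left_dual_arr_ty[OF g_ty(1)] by (simp add: N_def)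
  have "ev M \<cdot> (scale_arr C \<nu> (left_dual_arr g \<cdot> \<delta> M) \<otimes> Id M) = scale_arr C \<nu> (ev M \<cdot> ((left_dual_arr g \<cdot> \<delta> M) \<otimes> Id M))"
    using tensor_scale(1)[of "left_dual_arr g \<cdot> \<delta> M" M N "Id M" M M \<nu>]
      comp_scale(2)[of "(left_dual_arr g \<cdot> \<delta> M) \<otimes> Id M" "M \<odot> M" "N \<odot> M" "ev M" \<one> \<nu>] by simp
  also have "\<dots> = scale_arr C \<nu> (d \<cdot> (Id M \<otimes> g))"
    using ev_left_dual_\<delta>[of g M] by (simp add: N_def[symmetric] d_def)
  also have "\<dots> = d \<cdot> (Id M \<otimes> scale_arr C \<nu> g)"
    using tensor_scale(2)[of "Id M" M M g M N \<nu>] comp_scale(2)[of "Id M \<otimes> g" "M \<odot> M" "M \<odot> N" d \<one> \<nu>] by simp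
  finally show ?thesis using g_dual by simp
qed

text \<open>Linearity of \<open>g\<close> into the conjugate module, tested against evaluation.
  \<open>ev_g\<close> is applied once in each direction, so the scalar cancels.\<close>

lemma conj_g: "\<rho> \<cdot> (g \<otimes> Id X) = g \<cdot> l \<cdot> br M X \<cdot> (Id M \<otimes> \<sigma>)"
proof -
  let ?G = "scale_arr C \<nu> g" and ?c = "conj_action A M l"
  have [simp]: "ty ?c = (X \<odot> N) \<rightarrowtail> N"
    using conj_action_ty[of l A M] by (simp add: N_def)
  have "g \<cdot> l = ?c \<cdot> (Id X \<otimes> g)"
    using g_hom by (simp add: left_module_hom_def)
  then have G: "?G \<cdot> l = ?c \<cdot> (Id X \<otimes> ?G)"
    using comp_scale(1)[of l "X \<odot> M" M g N \<nu>] tensor_scale(2)[of "Id X" X X g M N \<nu>]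
      comp_scale(2)[of "Id X \<otimes> g" "X \<odot> M" "X \<odot> N" ?c N \<nu>] by simp
  have c: "d \<cdot> (Id M \<otimes> ?c) = d \<cdot> ((l \<cdot> br M X \<cdot> (Id M \<otimes> \<sigma>)) \<otimes> Id N)"
    using right_ev_conj_action[of l A M] by (simp add: d_def N_def)
  have "ev M \<cdot> ((\<rho> \<cdot> (g \<otimes> Id X)) \<otimes> Id M) = (ev M \<cdot> (g \<otimes> Id M)) \<cdot> (Id M \<otimes> l)"
    using ev_action_elem[of g M "Id X" X "Id M" M] by simp
  also have "\<dots> = d \<cdot> (Id M \<otimes> (?G \<cdot> l))"
    unfolding ev_g by simp
  also have "\<dots> = (d \<cdot> (Id M \<otimes> ?c)) \<cdot> (Id M \<otimes> Id X \<otimes> ?G)"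
    unfolding G by (simp del: tensor_rules(4))
  also have "\<dots> = (d \<cdot> (Id M \<otimes> ?G)) \<cdot> ((l \<cdot> br M X \<cdot> (Id M \<otimes> \<sigma>)) \<otimes> Id M)"
    unfolding c by simp
  also have "\<dots> = ev M \<cdot> ((g \<cdot> l \<cdot> br M X \<cdot> (Id M \<otimes> \<sigma>)) \<otimes> Id M)"
    unfolding ev_g[symmetric] by simp
  finally have 1: "ev M \<cdot> ((\<rho> \<cdot> (g \<otimes> Id X)) \<otimes> Id M) = ev M \<cdot> ((g \<cdot> l \<cdot> br M X \<cdot> (Id M \<otimes> \<sigma>)) \<otimes> Id M)" .
  show ?thesis
    by (rule dual_pair_test_left[OF pairs(1) _ _ 1, where Z = "M \<odot> X"]) simp_all
qed

text \<open>\<open>conj_g\<close> contributes one \<sigma>; with the second it gives the twist of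
  the algebra, which combines with \<open>tw M\<close> and the double braiding to the twist of
  \<open>X \<odot> M\<close>.\<close>

lemma t_anti: "t \<cdot> l = \<rho> \<cdot> (t \<otimes> \<sigma>) \<cdot> br X M"
proof -
  have "\<rho> \<cdot> (t \<otimes> \<sigma>) \<cdot> br X M = (\<rho> \<cdot> (g \<otimes> Id X)) \<cdot> ((tw M \<otimes> \<sigma>) \<cdot> br X M)"
    by (simp add: t_def)
  also have "\<dots> = g \<cdot> l \<cdot> br M X \<cdot> ((tw M \<otimes> tw X) \<cdot> br X M)"
    unfolding conj_g using reversion_laws(3) by simp
  also have "(tw M \<otimes> tw X) \<cdot> br X M = br X M \<cdot> (tw X \<otimes> tw M)"
    by (rule br_nat[symmetric]) simp_all
  also have "g \<cdot> l \<cdot> br M X \<cdot> \<dots> = g \<cdot> (l \<cdot> tw (X \<odot> M))"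
    by (simp add: twist_tensor)
  also have "l \<cdot> tw (X \<odot> M) = tw M \<cdot> l"
    by (rule tw_nat[symmetric]) simp
  finally show ?thesis by (simp add: t_def)
qed

lemma g'_anti: "g' \<cdot> \<rho> = l \<cdot> (\<sigma> \<otimes> g') \<cdot> br N X"
proof -
  have "g' \<cdot> (\<rho> \<cdot> (g \<otimes> Id X)) = (g' \<cdot> g) \<cdot> (l \<cdot> br M X \<cdot> (Id M \<otimes> \<sigma>))"
    unfolding conj_g by simp
  also have "\<dots> = l \<cdot> (br M X \<cdot> (Id M \<otimes> \<sigma>))"
    by (simp add: g_inv)
  also have "br M X \<cdot> (Id M \<otimes> \<sigma>) = (\<sigma> \<otimes> Id M) \<cdot> br M X"
    by (rule br_nat) simp_all
  finally have 1: "g' \<cdot> (\<rho> \<cdot> (g \<otimes> Id X)) = l \<cdot> ((\<sigma> \<otimes> Id M) \<cdot> br M X)" .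
  have "(l \<cdot> (\<sigma> \<otimes> g') \<cdot> br N X) \<cdot> (g \<otimes> Id X) = l \<cdot> (\<sigma> \<otimes> g') \<cdot> (br N X \<cdot> (g \<otimes> Id X))"
    by (simp del: ich)
  also have "br N X \<cdot> (g \<otimes> Id X) = (Id X \<otimes> g) \<cdot> br M X"
    by (rule br_nat) simp_all
  also have "l \<cdot> (\<sigma> \<otimes> g') \<cdot> \<dots> = l \<cdot> ((\<sigma> \<otimes> Id M) \<cdot> br M X)"
    by (simp add: g_inv)
  finally have 2: "(g' \<cdot> \<rho>) \<cdot> (g \<otimes> Id X) = (l \<cdot> (\<sigma> \<otimes> g') \<cdot> br N X) \<cdot> (g \<otimes> Id X)"
    using 1 by (simp del: ich)
  show ?thesis
    by (rule split_epi_cancel[OF _ _ _ _ _ 2, where e = "g' \<otimes> Id X" and E = "N \<odot> X" and W = "M \<odot> X" and Z = M])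
      (simp_all add: g_inv)
qed

lemma form_reversion: "\<kappa> \<cdot> (\<sigma> \<otimes> \<sigma>) \<cdot> br X X = \<kappa>"
proof -
  have "\<kappa> \<cdot> (\<sigma> \<otimes> \<sigma>) \<cdot> br X X = \<kappa> \<cdot> (br X X \<cdot> (\<sigma> \<otimes> \<sigma>))"
    using br_nat[of \<sigma> X X \<sigma> X X] by (simp del: ich)
  also have "\<dots> = counit A \<cdot> (\<sigma> \<cdot> m)"
    unfolding reversion_laws(2) by (simp add: \<kappa>_def)
  also have "\<dots> = counit A \<cdot> m"
    by (rule comp_eq_tail[OF counit_reversion]) simp_all
  finally show ?thesis by (simp add: \<kappa>_def)
qed

text \<open>Pairing with \<sigma>(a) under \<kappa> reduces the claim to the scalar form
  \<open>d\<close>, by invariance of \<kappa> under \<sigma>. There the symmetry of \<open>g\<close>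
  holds only up to \<nu>, and the factor stays.\<close>

lemma h_anti_scaled: "\<sigma> \<cdot> h = h \<cdot> (g' \<otimes> scale_arr C \<nu> t) \<cdot> br M N"
proof -
  define S where "S = scale_arr C \<nu> t"
  have [simp]: "ty S = M \<rightarrowtail> N" by (simp add: S_def)
  have S: "S = scale_arr C \<nu> g \<cdot> tw M"
    using comp_scale(1)[of "tw M" M M g N \<nu>] by (simp add: S_def t_def)
  have S_anti: "S \<cdot> l = \<rho> \<cdot> (S \<otimes> \<sigma>) \<cdot> br X M"
    using t_anti comp_scale(1)[of l "X \<odot> M" M t N \<nu>] tensor_scale(1)[of t M N \<sigma> X X \<nu>]
      comp_scale(2)[of "t \<otimes> \<sigma>" "M \<odot> X" "N \<odot> X" \<rho> N \<nu>]
      comp_scale(1)[of "br X M" "X \<odot> M" "M \<odot> X" "\<rho> \<cdot> (t \<otimes> \<sigma>)" N \<nu>]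
      comp_scale(1)[of "br X M" "X \<odot> M" "M \<odot> X" "t \<otimes> \<sigma>" "N \<odot> X" \<nu>]
      comp_scale(2)[of "(t \<otimes> \<sigma>) \<cdot> br X M" "X \<odot> M" "N \<odot> X" \<rho> N \<nu>]
    by (simp add: S_def)
  have dS: "d \<cdot> (g' \<otimes> S) \<cdot> br M N = d"
  proof -
    have "d \<cdot> (g' \<otimes> S) \<cdot> br M N = (d \<cdot> (Id M \<otimes> scale_arr C \<nu> g)) \<cdot> ((g' \<otimes> tw M) \<cdot> br M N)"
      by (simp add: S)
    also have "\<dots> = ev M \<cdot> (Id N \<otimes> tw M) \<cdot> br M N"
      unfolding ev_g[symmetric] by (simp add: g_inv)
    finally show ?thesis by (simp add: d_def N_def right_ev_eq)
  qed
  have "(\<kappa> \<cdot> ((\<sigma> \<cdot> h) \<otimes> \<sigma>)) \<cdot> br X (M \<odot> N) = \<kappa> \<cdot> (\<sigma> \<otimes> \<sigma>) \<cdot> ((h \<otimes> Id X) \<cdot> br X (M \<odot> N))"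
    by simp
  also have "(h \<otimes> Id X) \<cdot> br X (M \<odot> N) = br X X \<cdot> (Id X \<otimes> h)"
    by (rule br_nat[symmetric]) simp_all
  also have "\<kappa> \<cdot> (\<sigma> \<otimes> \<sigma>) \<cdot> \<dots> = (\<kappa> \<cdot> (\<sigma> \<otimes> \<sigma>) \<cdot> br X X) \<cdot> (Id X \<otimes> h)"
    by (simp del: ich)
  finally have 1: "(\<kappa> \<cdot> ((\<sigma> \<cdot> h) \<otimes> \<sigma>)) \<cdot> br X (M \<odot> N) = d \<cdot> (l \<otimes> Id N)"
    unfolding form_reversion form_h .
  have "(\<kappa> \<cdot> ((h \<cdot> (g' \<otimes> S) \<cdot> br M N) \<otimes> \<sigma>)) \<cdot> br X (M \<odot> N) =
      (\<kappa> \<cdot> (h \<otimes> Id X)) \<cdot> ((g' \<otimes> S \<otimes> \<sigma>) \<cdot> ((br M N \<otimes> Id X) \<cdot> br X (M \<odot> N)))"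
    by simp
  also have "(br M N \<otimes> Id X) \<cdot> br X (M \<odot> N) = (Id N \<otimes> br X M) \<cdot> br (X \<odot> M) N"
    by (rule yang_baxter[symmetric]) simp_all
  also have "(\<kappa> \<cdot> (h \<otimes> Id X)) \<cdot> ((g' \<otimes> S \<otimes> \<sigma>) \<cdot> \<dots>) = d \<cdot> (g' \<otimes> (\<rho> \<cdot> (S \<otimes> \<sigma>) \<cdot> br X M)) \<cdot> br (X \<odot> M) N"
    unfolding form_h by simp
  also have "\<dots> = d \<cdot> (g' \<otimes> S) \<cdot> ((Id N \<otimes> l) \<cdot> br (X \<odot> M) N)"
    unfolding S_anti[symmetric] by simp
  also have "(Id N \<otimes> l) \<cdot> br (X \<odot> M) N = br M N \<cdot> (l \<otimes> Id N)"
    by (rule br_nat[symmetric]) simp_all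
  also have "d \<cdot> (g' \<otimes> S) \<cdot> \<dots> = (d \<cdot> (g' \<otimes> S) \<cdot> br M N) \<cdot> (l \<otimes> Id N)"
    by (simp del: ich)
  finally have 2: "(\<kappa> \<cdot> ((\<sigma> \<cdot> h) \<otimes> \<sigma>)) \<cdot> br X (M \<odot> N) = (\<kappa> \<cdot> ((h \<cdot> (g' \<otimes> S) \<cdot> br M N) \<otimes> \<sigma>)) \<cdot> br X (M \<odot> N)"
    unfolding dS 1 by simp
  have 3: "\<kappa> \<cdot> ((\<sigma> \<cdot> h) \<otimes> \<sigma>) = \<kappa> \<cdot> ((h \<cdot> (g' \<otimes> S) \<cdot> br M N) \<otimes> \<sigma>)"
    by (rule iso_cancel_right[OF _ _ _ _ 2, where U = "X \<odot> M \<odot> N" and V = "M \<odot> N \<odot> X" and W = \<one>])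
      (simp_all add: braiding_iso)
  have 4: "(\<kappa> \<cdot> ((\<sigma> \<cdot> h) \<otimes> Id X)) \<cdot> (Id (M \<odot> N) \<otimes> \<sigma>) = (\<kappa> \<cdot> ((h \<cdot> (g' \<otimes> S) \<cdot> br M N) \<otimes> Id X)) \<cdot> (Id (M \<odot> N) \<otimes> \<sigma>)"
    using 3 by simp
  have 5: "\<kappa> \<cdot> ((\<sigma> \<cdot> h) \<otimes> Id X) = \<kappa> \<cdot> ((h \<cdot> (g' \<otimes> S) \<cdot> br M N) \<otimes> Id X)"
    by (rule iso_cancel_right[OF _ _ _ _ 4, where U = "M \<odot> N \<odot> X" and V = "M \<odot> N \<odot> X" and W = \<one>])
      (simp_all add: iso_tensor iso_ident reversion_iso)
  show ?thesis
    unfolding S_def[symmetric]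
    by (rule dual_pair_test_left[OF form_dual_pair _ _ 5, where Z = "M \<odot> N"]) simp_all
qed

text \<open>The induced reversion fixes the unit of \<open>E\<close>, so the scalar \<open>\<nu>\<close> acts trivially on \<open>t\<close>.\<close>

lemma t_scaled: "scale_arr C \<nu> t = t"
proof -
  define S where "S = scale_arr C \<nu> t"
  have [simp]: "ty S = M \<rightarrowtail> N" by (simp add: S_def)
  have rev: "reversion E = r \<cdot> (t \<otimes> g') \<cdot> br N M \<cdot> e"
    by (simp add: reversion_E induced_reversion_def g'_def[symmetric] N_def[symmetric] t_def)
  have eu: "e \<cdot> unit E = b"
    using T_b comp_eq_tail[OF er, of b] by (simp add: E_algebra)
  have "b = e \<cdot> (reversion E \<cdot> unit E)"
    using eu E.reversion_laws(1) by simp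
  also have "\<dots> = (e \<cdot> r) \<cdot> ((t \<otimes> g') \<cdot> (br N M \<cdot> (e \<cdot> unit E)))"
    unfolding rev by (simp del: ich)
  finally have Tb: "T \<cdot> ((t \<otimes> g') \<cdot> (br N M \<cdot> b)) = b"
    unfolding er eu by (rule sym)
  \<comment> \<open>The argument is expanded in the dual basis \<open>b\<close>. Anti-linearity of
    \<open>t\<close> and \<open>h_anti_scaled\<close> move everything onto the swapped copy of
    \<open>b\<close> and produce one factor \<open>S\<close>; by \<open>Tb\<close> the swapped copy
    is \<open>b\<close> again, and the zigzag leaves \<open>S\<close> alone.\<close>
  have "t = t \<cdot> (l \<cdot> (h \<otimes> Id M) \<cdot> (Id M \<otimes> b))"
    unfolding b_generates by simp
  also have "\<dots> = (t \<cdot> l) \<cdot> ((h \<otimes> Id M) \<cdot> (Id M \<otimes> b))" by simp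
  also have "\<dots> = \<rho> \<cdot> (t \<otimes> \<sigma>) \<cdot> ((br X M \<cdot> (h \<otimes> Id M)) \<cdot> (Id M \<otimes> b))"
    unfolding t_anti by simp
  also have "br X M \<cdot> (h \<otimes> Id M) = (Id M \<otimes> h) \<cdot> br (M \<odot> N) M"
    by (rule br_nat) simp_all
  also have "\<rho> \<cdot> (t \<otimes> \<sigma>) \<cdot> (\<dots> \<cdot> (Id M \<otimes> b)) = \<rho> \<cdot> (t \<otimes> (\<sigma> \<cdot> h)) \<cdot> (br (M \<odot> N) M \<cdot> (Id M \<otimes> b))"
    by simp
  also have "\<dots> = \<rho> \<cdot> (t \<otimes> (h \<cdot> (g' \<otimes> S))) \<cdot> (((Id M \<otimes> br M N) \<cdot> br (M \<odot> N) M) \<cdot> (Id M \<otimes> b))"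
    unfolding h_anti_scaled S_def[symmetric] by simp
  also have "(Id M \<otimes> br M N) \<cdot> br (M \<odot> N) M = (br N M \<otimes> Id M) \<cdot> br M (N \<odot> M)"
    by (rule yang_baxter) simp_all
  also have "((br N M \<otimes> Id M) \<cdot> br M (N \<odot> M)) \<cdot> (Id M \<otimes> b) = (br N M \<cdot> b) \<otimes> Id M"
    using slide_coscalar(2)[of b "N \<odot> M" M] by simp
  also have "\<rho> \<cdot> (t \<otimes> (h \<cdot> (g' \<otimes> S))) \<cdot> ((br N M \<cdot> b) \<otimes> Id M) =
      (\<rho> \<cdot> (Id N \<otimes> h)) \<cdot> (((t \<otimes> g') \<cdot> (br N M \<cdot> b)) \<otimes> S)"
  proof -
    have "(t \<otimes> (h \<cdot> (g' \<otimes> S))) \<cdot> ((br N M \<cdot> b) \<otimes> Id M) = (Id N \<otimes> h) \<cdot> ((t \<otimes> g' \<otimes> S) \<cdot> ((br N M \<cdot> b) \<otimes> Id M))"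
      by (rule comp_eq_tail[symmetric]) simp_all
    then show ?thesis by simp
  qed
  also have "\<dots> = (Id N \<otimes> d) \<cdot> ((T \<cdot> ((t \<otimes> g') \<cdot> (br N M \<cdot> b))) \<otimes> S)"
    unfolding T_pairing(2)[symmetric] by simp
  also have "\<dots> = (Id N \<otimes> d) \<cdot> (b \<otimes> Id N) \<cdot> S"
    unfolding Tb using coscalar_tensor(1)[of b "N \<odot> M" S M N] by simp
  also have "(Id N \<otimes> d) \<cdot> (b \<otimes> Id N) = Id N"
    using pairs(2) by (simp add: dual_pair_def)
  finally show ?thesis by (simp add: S_def)
qed

lemma hermitian_module: "hermitian N M \<rho> l h g' t b"
proof -
  have "t \<cdot> g' = tw N"
    using tw_nat[of g M N] g_inv comp_eq_tail2[of "tw N" g g "tw M" g' N M N] by (simp add: t_def)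
  moreover have "g' \<cdot> t = tw M"
    using comp_eq_tail[OF g_inv(1), of "tw M"] by (simp add: t_def)
  ultimately show ?thesis
    unfolding hermitian_def
    using dual_module module h_linear g'_anti t_anti h_anti_scaled t_scaled b_generates h_surjective by simp
qed

lemma hermitian_regular: "hermitian X X m m m \<sigma> \<sigma> (\<eta> \<otimes> \<eta>)"
proof -
  have "m \<cdot> (Id X \<otimes> m) \<cdot> ((\<eta> \<otimes> \<eta>) \<otimes> Id X) = Id X" "m \<cdot> (m \<otimes> Id X) \<cdot> (Id X \<otimes> (\<eta> \<otimes> \<eta>)) = Id X"
    by simp_all
  moreover have "m \<cdot> br X X \<cdot> (\<sigma> \<otimes> \<sigma>) = m \<cdot> (\<sigma> \<otimes> \<sigma>) \<cdot> br X X"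
    using br_nat[of \<sigma> X X \<sigma> X X] by (simp del: ich)
  ultimately show ?thesis
    unfolding hermitian_def right_module_def left_module_def
    using algebra_laws reversion_laws by (auto intro!: exI[of _ "\<eta> \<otimes> \<eta>"])
qed

text \<open>\<open>hermitian_family\<close> is applied to the regular module at \<open>False\<close>
  and to \<open>M\<close> with its dual at \<open>True\<close>. The diagonal entries are then
  \<open>A\<close> tensored with itself over \<open>A\<close>, and \<open>E\<close>.\<close>

lemma linked_internal_end:
  assumes complete: idempotent_complete
  shows "\<exists>P m' u s. linking P m' u s \<and> corner P m' u s False A \<and> corner P m' u s True E"
proof -
  define R K where "R i = (if i then N else X)" and "K i = (if i then M else X)" for i
  define \<rho>' l' p where "\<rho>' i = (if i then \<rho> else m)" and "l' i = (if i then l else m)" and "p i = (if i then h else m)" for i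
  define s t' w where "s i = (if i then g' else \<sigma>)" and "t' i = (if i then t else \<sigma>)"
    and "w i = (if i then b else \<eta> \<otimes> \<eta>)" for i
  note defs = R_def K_def \<rho>'_def l'_def p_def s_def t'_def w_def
  have herm: "hermitian (R i) (K i) (\<rho>' i) (l' i) (p i) (s i) (t' i) (w i)" for i
    using hermitian_module hermitian_regular by (simp add: defs)
  have mods: "right_module A (R i) (\<rho>' i)" "left_module A (K i) (l' i)" for i
    using herm[of i] by (simp_all add: hermitian_def)
  have ex: "\<exists>E e r. splits (R i \<odot> K j) (tensor_over A (R i) (\<rho>' i) (K j) (l' j)) E e r" for i j
    by (rule tensor_over_splits[OF complete mods])
  \<comment> \<open>In the linking whose entries are all \<open>A\<close>,
    \<open>linking_splits\<close> yields the multiplication as restriction onto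
    \<open>A\<close>.\<close>
  have reg: "\<exists>f. splits (X \<odot> X) (tensor_over A X m X m) X f m"
  proof -
    have L: "linking (\<lambda>i j. X) (\<lambda>i j k. m) (\<lambda>i. \<eta>) (\<lambda>i j. \<sigma>)" by (rule linking_regular)
    show ?thesis
      by (rule linking_splits[OF L]) auto
  qed
  \<comment> \<open>The two diagonal retracts are prescribed, so that the corners are
    \<open>A\<close> and \<open>E\<close> themselves; the off-diagonal ones are any
    splittings.\<close>
  have "\<exists>E' e' r'. splits (R i \<odot> K j) (tensor_over A (R i) (\<rho>' i) (K j) (l' j)) E' e' r' \<and>
      (i \<and> j \<longrightarrow> E' = alg_ob E \<and> e' = e \<and> r' = r) \<and> (\<not> i \<and> \<not> j \<longrightarrow> E' = X \<and> r' = m)" for i j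
    using ex[of i j] reg splits_E by (cases i; cases j) (auto simp: defs T_def)
  then obtain E' e' r' where spl: "\<And>i j. splits (R i \<odot> K j) (tensor_over A (R i) (\<rho>' i) (K j) (l' j)) (E' i j) (e' i j) (r' i j)"
    and c: "E' True True = alg_ob E" "e' True True = e" "r' True True = r" "E' False False = X" "r' False False = m"
    by metis
  interpret F: hermitian_family C A R K \<rho>' l' p s t' w E' e' r'
    by unfold_locales (rule herm spl)+
  have 1: "F.mul True True True \<cdot> (r \<otimes> r) = mult E \<cdot> (r \<otimes> r)"
    using F.mul_arrow[of True True True] by (simp add: c E_mult_r) (simp add: defs)
  have 1: "F.mul True True True = mult E"
    by (rule split_epi_cancel[OF _ _ _ _ _ 1, where e = "e \<otimes> e" and E = "alg_ob E \<odot> alg_ob E"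
          and W = "(N \<odot> M) \<odot> (N \<odot> M)" and Z = "alg_ob E"])
      (use F.mul_ty[of True True True] in \<open>simp_all add: c re\<close>)
  have 2: "F.mul False False False \<cdot> (m \<otimes> m) = m \<cdot> (m \<otimes> m)"
    using F.mul_arrow[of False False False] mult_assoc[of "Id X" X "Id X" X m "X \<odot> X"]
    by (simp add: c) (simp add: defs algebra_laws(1))
  have me: "(m \<otimes> m) \<cdot> ((\<eta> \<otimes> Id X) \<otimes> (\<eta> \<otimes> Id X)) = Id (X \<odot> X)"
    by (simp del: tensor_rules(1))
  have 2: "F.mul False False False = m"
    by (rule split_epi_cancel[OF me _ _ _ _ 2, where W = "(X \<odot> X) \<odot> (X \<odot> X)" and Z = X])
      (use F.mul_ty[of False False False] in \<open>simp_all add: c\<close>)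
  have 3: "F.un True = unit E" "F.un False = \<eta>"
    by (simp_all add: F.un_def c E_algebra) (simp_all add: defs)
  have 4: "F.inv True True = reversion E"
    by (simp add: F.inv_def c) (simp add: defs reversion_E induced_reversion_def g'_def[symmetric] N_def[symmetric] t_def)
  have 5: "F.inv False False \<cdot> m = \<sigma> \<cdot> m"
    using F.inv_arrow[of False False] br_nat[of \<sigma> X X \<sigma> X X] by (simp add: c reversion_laws(2)) (simp add: defs)
  have 5: "F.inv False False = \<sigma>"
    by (rule split_epi_cancel[OF _ _ _ _ _ 5, where e = "\<eta> \<otimes> Id X" and E = X and W = "X \<odot> X" and Z = X])
      (use F.inv_ty[of False False] in \<open>simp_all add: c\<close>)
  show ?thesis
    using F.linking_of_hermitian 1 2 3 4 5 c
    by (intro exI[of _ E'] exI[of _ F.mul] exI[of _ F.un] exI[of _ F.inv]) (simp add: corner_def)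
qed

end

section \<open>The two relations agree\<close>

context strict_linear_ribbon_category
begin

text \<open>The linking obtained has \<open>E\<close> as a corner; \<open>linkedI\<close> replaces
  it by \<open>B\<close> along the inverse of the given isomorphism.\<close>

lemma linked_of_jandl_related:
  assumes A: "jandl_algebra A" and rel: "jandl_related A B" and complete: idempotent_complete
  shows "linked A B"
proof -
  obtain M l E e r g \<nu> where rel': "left_module A M l" "internal_end A M l E e r" "sym_special_frobenius E"
    "interpolating A M l E e" "left_module_hom A M l (du M) (conj_action A M l) g" "iso g"
    "g = scale_arr C \<nu> (left_dual_arr g \<cdot> \<delta> M)" "reversion E = induced_reversion M g e r" "jandl_isomorphic B E"
    using rel unfolding jandl_related_def by blast
  obtain \<phi> where jB: "jandl_algebra B" and jE: "jandl_algebra E" and \<phi>: "frobenius_iso B E \<phi>" "\<phi> \<cdot> reversion B = reversion E \<cdot> \<phi>"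
    using rel'(9) unfolding jandl_isomorphic_def by blast
  interpret B: jandl C B
    using jB by unfold_locales (simp_all add: jandl_algebra_def)
  interpret hermitian_morita_module C A M l E e r g \<nu>
    using A jE rel' by unfold_locales (simp_all add: jandl_algebra_def)
  obtain P m' u s where L: "linking P m' u s" and cA: "corner P m' u s False A" and cE: "corner P m' u s True E"
    using linked_internal_end[OF complete] by blast
  have [simp]: "ty \<phi> = alg_ob B \<rightarrowtail> alg_ob E" using \<phi>(1) by (simp add: frobenius_iso_def)
  obtain \<psi> where [simp]: "ty \<psi> = alg_ob E \<rightarrowtail> alg_ob B" and \<psi>: "\<psi> \<cdot> \<phi> = Id (alg_ob B)" "\<phi> \<cdot> \<psi> = Id (alg_ob E)"
  proof -
    have "iso \<phi>" using \<phi>(1) by (simp add: frobenius_iso_def)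
    then show ?thesis
      using that \<open>ty \<phi> = alg_ob B \<rightarrowtail> alg_ob E\<close> by (metis isoE ty_inject)
  qed
  have \<psi>x: "\<psi> \<cdot> (\<phi> \<cdot> x) = x" if "ty x = U \<rightarrowtail> alg_ob B" for x U
    using comp_eq_tail[OF \<psi>(1), of x] that by simp
  have m1: "\<phi> \<cdot> mult B = mult E \<cdot> (\<phi> \<otimes> \<phi>)" and u1: "\<phi> \<cdot> unit B = unit E"
    using \<phi>(1) by (simp_all add: frobenius_iso_def)
  have "\<psi> \<cdot> mult E = \<psi> \<cdot> ((mult E \<cdot> (\<phi> \<otimes> \<phi>)) \<cdot> (\<psi> \<otimes> \<psi>))"
    by (simp add: \<psi>)
  then have m2: "\<psi> \<cdot> mult E = mult B \<cdot> (\<psi> \<otimes> \<psi>)"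
    unfolding m1[symmetric] by (simp add: \<psi>x)
  have u2: "\<psi> \<cdot> unit E = unit B"
    unfolding u1[symmetric] by (rule \<psi>x) simp
  have "\<psi> \<cdot> reversion E = \<psi> \<cdot> ((reversion E \<cdot> \<phi>) \<cdot> \<psi>)"
    by (simp add: \<psi>)
  then have s2: "\<psi> \<cdot> reversion E = reversion B \<cdot> \<psi>"
    unfolding \<phi>(2)[symmetric] by (simp add: \<psi>x)
  have "iso \<psi>"
    by (rule isoI[OF _ _ \<psi>(2,1)]) simp_all
  note [simp] = corner_def[of P m' u s False A, THEN iffD1, OF cA] corner_def[of P m' u s True E, THEN iffD1, OF cE]
  show ?thesis
    using linkedI[OF L, of "\<lambda>i. if i then \<psi> else Id X" "\<lambda>i. if i then B else A"] \<open>iso \<psi>\<close>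
    by (simp add: m2 u2 s2 iso_ident split: if_splits)
qed

end

theorem lemma14:
  fixes C :: "('o, 'm, 'k::field) ribbon_structure"
  assumes "strict_linear_ribbon_category C"
    and "ribbon_data.additive C"
    and "ribbon_data.idempotent_complete C"
    and "ribbon_data.simple_object C (unit_ob C)"
    and "ribbon_data.absolutely_simple C (unit_ob C)"
  shows "equiv (ribbon_data.simple_jandl_algebras C) (ribbon_data.jandl_relation C)"
proof -
  interpret strict_linear_ribbon_category C by fact
  let ?J = simple_jandl_algebras
  have jandl: "jandl_algebra A" "jandl C A" if "A \<in> ?J" for A
  proof -
    show "jandl_algebra A" using that by (simp add: simple_jandl_algebras_def simple_jandl_algebra_def)
    then show "jandl C A" by unfold_locales (simp_all add: jandl_algebra_def)
  qed
  have rel: "jandl_relation = {(A, B) \<in> ?J \<times> ?J. linked A B}"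
    unfolding jandl_relation_def
    using linked_of_jandl_related jandl_related_of_linked jandl(1) assms(3) by blast
  show ?thesis
    unfolding rel
  proof (rule equivI)
    show "refl_on ?J {(A, B) \<in> ?J \<times> ?J. linked A B}"
      using jandl.linked_refl[OF jandl(2)] by (auto simp: refl_on_def)
    show "sym {(A, B) \<in> ?J \<times> ?J. linked A B}"
      using linked_sym by (auto simp: sym_def)
    show "trans {(A, B) \<in> ?J \<times> ?J. linked A B}"
      \<comment> \<open>In \<open>linked_trans\<close> the middle algebra is the second argument of
        both links, so the second link is reversed first.\<close>
      using jandl.linked_trans[OF jandl(2) _ linked_sym assms(3)] by (auto simp: trans_def)
  qed auto
qed

end
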